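(* Let $\iota:R\to A$ be a split Frobenius extension and let $T$ be a left $R$-module. Assume that $U=A\otimes_R T\in\operatorname{add}_R(T)$ as an $R$-module (by restriction along $\iota$). If $U$ is a Wakamatsu tilting $A$-module, then $T$ is a Wakamatsu tilting $R$-module.
   Context: All rings are associative with unit; modules are left modules unless otherwise specified. A ring extension $\iota:R\to A$ is a unital ring homomorphism, and $A$-modules are viewed as $R$-modules by restriction along $\iota$. It is a Frobenius extension if $A$ is finitely generated projective as a left $R$-module and $A\cong\operatorname{Hom}_R(A,R)$ as $A$-$R$-bimodules, where $(af)(x)=f(xa)$ and $(fr)(x)=f(x)r$. The extension is split if $\iota$ admits an $R$-$R$-bimodule retraction. For an $R$-module $M$, $\operatorname{add}_R(M)$ is the class of direct summands of finite direct sums of copies of $M$. An $R$-module $T$ is Wakamatsu tilting if: (1) $T$ has a projective resolution by finitely generated projective $R$-modules; (2) $\operatorname{Ext}_R^i(T,T)=0$ for all $i>0$; (3) there is an exact sequence $0\to R\to T_0\to T_1\to T_2\to\cdots$ with each $T_j\in\operatorname{add}_R(T)$ which remains exact after applying $\operatorname{Hom}_R(-,T)$. *)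

theory Defs
  imports "HOL-Algebra.Module" "HOL-Algebra.AbelCoset" "HOL-Algebra.Elementary_Groups"
    "HOL-Algebra.Free_Abelian_Groups"
begin

section \<open>Left modules over a (not necessarily commutative) ring\<close>

text \<open>
  The record of \<^locale>\<open>module\<close> and the predicate \<^locale>\<open>submodule\<close> are taken from HOL-Algebra, whose
  \<^locale>\<open>module\<close> itself requires a commutative ring. As there, the fields \<open>mult\<close> and \<open>one\<close> that a
  module record inherits from the ring record carry no meaning.
\<close>

locale left_module = R?: ring R + M?: abelian_group M
  for R :: "('r, 'k) ring_scheme" (structure) and M :: "('r, 'm, 'e) module_scheme" (structure) +
  assumes smult_closed [simp, intro]:
      "\<lbrakk>a \<in> carrier R; x \<in> carrier M\<rbrakk> \<Longrightarrow> a \<odot>\<^bsub>M\<^esub> x \<in> carrier M"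
    and smult_l_distr:
      "\<lbrakk>a \<in> carrier R; b \<in> carrier R; x \<in> carrier M\<rbrakk> \<Longrightarrow>
       (a \<oplus> b) \<odot>\<^bsub>M\<^esub> x = a \<odot>\<^bsub>M\<^esub> x \<oplus>\<^bsub>M\<^esub> b \<odot>\<^bsub>M\<^esub> x"
    and smult_r_distr:
      "\<lbrakk>a \<in> carrier R; x \<in> carrier M; y \<in> carrier M\<rbrakk> \<Longrightarrow>
       a \<odot>\<^bsub>M\<^esub> (x \<oplus>\<^bsub>M\<^esub> y) = a \<odot>\<^bsub>M\<^esub> x \<oplus>\<^bsub>M\<^esub> a \<odot>\<^bsub>M\<^esub> y"
    and smult_assoc1:
      "\<lbrakk>a \<in> carrier R; b \<in> carrier R; x \<in> carrier M\<rbrakk> \<Longrightarrow>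
       (a \<otimes> b) \<odot>\<^bsub>M\<^esub> x = a \<odot>\<^bsub>M\<^esub> (b \<odot>\<^bsub>M\<^esub> x)"
    and smult_one [simp]: "x \<in> carrier M \<Longrightarrow> \<one> \<odot>\<^bsub>M\<^esub> x = x"

definition module_hom ::
    "('r, 'k) ring_scheme \<Rightarrow> ('r, 'm, 'e) module_scheme \<Rightarrow> ('r, 'n, 'f) module_scheme \<Rightarrow> ('m \<Rightarrow> 'n) set"
  where "module_hom R M N = {f \<in> carrier M \<rightarrow> carrier N.
    (\<forall>x\<in>carrier M. \<forall>y\<in>carrier M. f (x \<oplus>\<^bsub>M\<^esub> y) = f x \<oplus>\<^bsub>N\<^esub> f y) \<and>
    (\<forall>r\<in>carrier R. \<forall>x\<in>carrier M. f (r \<odot>\<^bsub>M\<^esub> x) = r \<odot>\<^bsub>N\<^esub> f x)}"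

definition module_iso ::
    "('r, 'k) ring_scheme \<Rightarrow> ('r, 'm, 'e) module_scheme \<Rightarrow> ('r, 'n, 'f) module_scheme \<Rightarrow> ('m \<Rightarrow> 'n) set"
  where "module_iso R M N = {f \<in> module_hom R M N. bij_betw f (carrier M) (carrier N)}"

definition regular_module :: "('r, 'k) ring_scheme \<Rightarrow> ('r, 'r) module"
  where "regular_module R = \<lparr>carrier = carrier R, mult = undefined, one = undefined,
    ring.zero = \<zero>\<^bsub>R\<^esub>, add = add R, smult = mult R\<rparr>"

definition restrict_scalars :: "('r \<Rightarrow> 'a) \<Rightarrow> ('a, 'm, 'e) module_scheme \<Rightarrow> ('r, 'm) module"
  where "restrict_scalars \<iota> M = \<lparr>carrier = carrier M, mult = undefined, one = undefined,
    ring.zero = \<zero>\<^bsub>M\<^esub>, add = add M, smult = (\<lambda>r x. \<iota> r \<odot>\<^bsub>M\<^esub> x)\<rparr>"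

text \<open>The direct sum of copies of \<open>M\<close> indexed by \<open>X\<close>: finitely supported functions on \<open>X\<close>.\<close>

definition direct_sum_copies :: "('r, 'm, 'e) module_scheme \<Rightarrow> 'x set \<Rightarrow> ('r, 'x \<Rightarrow> 'm) module"
  where "direct_sum_copies M X = \<lparr>
    carrier = {f \<in> X \<rightarrow>\<^sub>E carrier M. finite {x \<in> X. f x \<noteq> \<zero>\<^bsub>M\<^esub>}},
    mult = undefined, one = undefined,
    ring.zero = (\<lambda>x\<in>X. \<zero>\<^bsub>M\<^esub>),
    add = (\<lambda>f g. \<lambda>x\<in>X. f x \<oplus>\<^bsub>M\<^esub> g x),
    smult = (\<lambda>r f. \<lambda>x\<in>X. r \<odot>\<^bsub>M\<^esub> f x)\<rparr>"

definition is_direct_summand ::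
    "('r, 'k) ring_scheme \<Rightarrow> 'm set \<Rightarrow> ('r, 'm, 'e) module_scheme \<Rightarrow> bool"
  where "is_direct_summand R N M \<longleftrightarrow> submodule N R M \<and>
    (\<exists>N'. submodule N' R M \<and> N \<inter> N' = {\<zero>\<^bsub>M\<^esub>} \<and>
          {x \<oplus>\<^bsub>M\<^esub> y | x y. x \<in> N \<and> y \<in> N'} = carrier M)"

definition iso_direct_summand ::
    "('r, 'k) ring_scheme \<Rightarrow> ('r, 'm, 'e) module_scheme \<Rightarrow> ('r, 'n, 'f) module_scheme \<Rightarrow> bool"
  where "iso_direct_summand R M N \<longleftrightarrow>
    (\<exists>N' f. is_direct_summand R N' N \<and> f \<in> module_iso R M (N\<lparr>carrier := N'\<rparr>))"

definition in_add ::
    "('r, 'k) ring_scheme \<Rightarrow> ('r, 'm, 'e) module_scheme \<Rightarrow> ('r, 'n, 'f) module_scheme \<Rightarrow> bool"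
  where "in_add R M N \<longleftrightarrow> left_module R N \<and>
    (\<exists>n::nat. iso_direct_summand R N (direct_sum_copies M {..<n}))"

definition finitely_generated :: "('r, 'k) ring_scheme \<Rightarrow> ('r, 'm, 'e) module_scheme \<Rightarrow> bool"
  where "finitely_generated R M \<longleftrightarrow>
    (\<exists>S. finite S \<and> S \<subseteq> carrier M \<and> (\<forall>N. submodule N R M \<and> S \<subseteq> N \<longrightarrow> N = carrier M))"

text \<open>
  Projective: isomorphic to a direct summand of a free module. Basis sets \<open>X\<close> in the element type
  of the module suffice, since a projective \<open>P\<close> is a summand of the free module on \<open>carrier P\<close>.
\<close>

definition projective :: "('r, 'k) ring_scheme \<Rightarrow> ('r, 'm, 'e) module_scheme \<Rightarrow> bool"
  where "projective R P \<longleftrightarrow> left_module R P \<and>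
    (\<exists>X :: 'm set. iso_direct_summand R P (direct_sum_copies (regular_module R) X))"


section \<open>Bimodules, tensor products and ring extensions\<close>

text \<open>The left action is \<open>smult\<close>; \<open>rsmult\<close> is the right action of a second ring.\<close>

record ('a, 'r, 'm) bimodule = "('a, 'm) module" +
  rsmult :: "'m \<Rightarrow> 'r \<Rightarrow> 'm"

definition bimodule_hom :: "('a, 'k) ring_scheme \<Rightarrow> ('r, 'l) ring_scheme \<Rightarrow>
    ('a, 'r, 'm) bimodule \<Rightarrow> ('a, 'r, 'n) bimodule \<Rightarrow> ('m \<Rightarrow> 'n) set"
  where "bimodule_hom A R M N = {f \<in> module_hom A M N.
    \<forall>x\<in>carrier M. \<forall>r\<in>carrier R. f (rsmult M x r) = rsmult N (f x) r}"

definition bimodule_iso :: "('a, 'k) ring_scheme \<Rightarrow> ('r, 'l) ring_scheme \<Rightarrow>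
    ('a, 'r, 'm) bimodule \<Rightarrow> ('a, 'r, 'n) bimodule \<Rightarrow> ('m \<Rightarrow> 'n) set"
  where "bimodule_iso A R M N = {f \<in> bimodule_hom A R M N. bij_betw f (carrier M) (carrier N)}"

text \<open>The ring \<open>A\<close> as a bimodule along two ring homomorphisms into it: \<open>s \<cdot> a \<cdot> t = f s a g t\<close>.\<close>

definition ring_bimodule :: "('s \<Rightarrow> 'a) \<Rightarrow> ('a, 'k) ring_scheme \<Rightarrow> ('t \<Rightarrow> 'a) \<Rightarrow> ('s, 't, 'a) bimodule"
  where "ring_bimodule f A g = \<lparr>carrier = carrier A, mult = undefined, one = undefined,
    ring.zero = \<zero>\<^bsub>A\<^esub>, add = add A,
    smult = (\<lambda>s a. f s \<otimes>\<^bsub>A\<^esub> a), rsmult = (\<lambda>a t. a \<otimes>\<^bsub>A\<^esub> g t)\<rparr>"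

text \<open>
  For a bimodule \<open>B\<close> over \<open>A\<close> (left) and \<open>R\<close> (right) and a left \<open>R\<close>-module \<open>T\<close>, the left \<open>A\<close>-module
  \<open>B \<otimes>\<^sub>R T\<close> is the free abelian group on \<open>B \<times> T\<close> modulo the subgroup generated by the
  bilinearity and balancing relations. Its elements are cosets. The scalar \<open>a\<close> sends the coset of
  \<open>\<Sum> n\<^sub>i (b\<^sub>i, t\<^sub>i)\<close> to that of \<open>\<Sum> n\<^sub>i (a b\<^sub>i, t\<^sub>i)\<close>; adding the relation subgroup \<open>K\<close> to the
  image of the coset under this map turns it into a coset again.
\<close>

definition tensor_relations ::
    "('r, 'k) ring_scheme \<Rightarrow> ('a, 'r, 'b) bimodule \<Rightarrow> ('r, 't, 'e) module_scheme \<Rightarrow> ('b \<times> 't \<Rightarrow>\<^sub>0 int) set"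
  where "tensor_relations R B T =
    {frag_of (b \<oplus>\<^bsub>B\<^esub> b', t) - (frag_of (b, t) + frag_of (b', t)) | b b' t.
        b \<in> carrier B \<and> b' \<in> carrier B \<and> t \<in> carrier T} \<union>
    {frag_of (b, t \<oplus>\<^bsub>T\<^esub> t') - (frag_of (b, t) + frag_of (b, t')) | b t t'.
        b \<in> carrier B \<and> t \<in> carrier T \<and> t' \<in> carrier T} \<union>
    {frag_of (rsmult B b r, t) - frag_of (b, r \<odot>\<^bsub>T\<^esub> t) | b r t.
        b \<in> carrier B \<and> r \<in> carrier R \<and> t \<in> carrier T}"

definition tensor_product ::
    "('r, 'k) ring_scheme \<Rightarrow> ('a, 'r, 'b) bimodule \<Rightarrow> ('r, 't, 'e) module_scheme \<Rightarrow>
     ('a, ('b \<times> 't \<Rightarrow>\<^sub>0 int) set) module"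
  where "tensor_product R B T = (
    let F = free_Abelian_group (carrier B \<times> carrier T);
        K = generate F (tensor_relations R B T)
    in \<lparr>carrier = carrier (F Mod K), mult = undefined, one = undefined,
        ring.zero = one (F Mod K), add = mult (F Mod K),
        smult = (\<lambda>a c. K <#>\<^bsub>F\<^esub> frag_extend (\<lambda>(b, t). frag_of (a \<odot>\<^bsub>B\<^esub> b, t)) ` c)\<rparr>)"

abbreviation induced_module ::
    "('r, 'k) ring_scheme \<Rightarrow> ('a, 'l) ring_scheme \<Rightarrow> ('r \<Rightarrow> 'a) \<Rightarrow> ('r, 't, 'e) module_scheme \<Rightarrow>
     ('a, ('a \<times> 't \<Rightarrow>\<^sub>0 int) set) module"
  where "induced_module R A \<iota> T \<equiv> tensor_product R (ring_bimodule id A \<iota>) T"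

definition ring_extension :: "('r, 'k) ring_scheme \<Rightarrow> ('a, 'l) ring_scheme \<Rightarrow> ('r \<Rightarrow> 'a) \<Rightarrow> bool"
  where "ring_extension R A \<iota> \<longleftrightarrow> ring R \<and> ring A \<and> \<iota> \<in> ring_hom R A"

text \<open>Homomorphism groups, written multiplicatively as in HOL-Algebra; homs are extensional.\<close>

definition hom_group :: "('r, 'k) ring_scheme \<Rightarrow> ('r, 'm, 'e) module_scheme \<Rightarrow>
    ('r, 'n, 'f) module_scheme \<Rightarrow> ('m \<Rightarrow> 'n) monoid"
  where "hom_group R M N = \<lparr>carrier = module_hom R M N \<inter> extensional (carrier M),
    mult = (\<lambda>f g. \<lambda>x\<in>carrier M. f x \<oplus>\<^bsub>N\<^esub> g x), one = (\<lambda>x\<in>carrier M. \<zero>\<^bsub>N\<^esub>)\<rparr>"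

text \<open>The bimodule \<open>Hom\<^sub>R(A, R)\<close> with \<open>(a f) x = f (x a)\<close> and \<open>(f r) x = f x r\<close>.\<close>

definition dual_bimodule :: "('r, 'k) ring_scheme \<Rightarrow> ('a, 'l) ring_scheme \<Rightarrow> ('r \<Rightarrow> 'a) \<Rightarrow>
    ('a, 'r, 'a \<Rightarrow> 'r) bimodule"
  where "dual_bimodule R A \<iota> = (
    let H = hom_group R (restrict_scalars \<iota> (regular_module A)) (regular_module R)
    in \<lparr>carrier = carrier H, mult = undefined, one = undefined, ring.zero = one H, add = mult H,
        smult = (\<lambda>a f. \<lambda>x\<in>carrier A. f (x \<otimes>\<^bsub>A\<^esub> a)),
        rsmult = (\<lambda>f r. \<lambda>x\<in>carrier A. f x \<otimes>\<^bsub>R\<^esub> r)\<rparr>)"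

definition frobenius_extension :: "('r, 'k) ring_scheme \<Rightarrow> ('a, 'l) ring_scheme \<Rightarrow> ('r \<Rightarrow> 'a) \<Rightarrow> bool"
  where "frobenius_extension R A \<iota> \<longleftrightarrow> ring_extension R A \<iota> \<and>
    finitely_generated R (restrict_scalars \<iota> (regular_module A)) \<and>
    projective R (restrict_scalars \<iota> (regular_module A)) \<and>
    bimodule_iso A R (ring_bimodule id A \<iota>) (dual_bimodule R A \<iota>) \<noteq> {}"

definition split_extension :: "('r, 'k) ring_scheme \<Rightarrow> ('a, 'l) ring_scheme \<Rightarrow> ('r \<Rightarrow> 'a) \<Rightarrow> bool"
  where "split_extension R A \<iota> \<longleftrightarrow> ring_extension R A \<iota> \<and>
    (\<exists>\<pi> \<in> bimodule_hom R R (ring_bimodule \<iota> A \<iota>) (ring_bimodule id R id).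
       \<forall>r\<in>carrier R. \<pi> (\<iota> r) = r)"


section \<open>Resolutions and Ext\<close>

text \<open>\<open>\<cdots> \<rightarrow> P\<^sub>1 \<rightarrow> P\<^sub>0 \<rightarrow> M \<rightarrow> 0\<close> with \<open>d n : P\<^sub>n\<^sub>+\<^sub>1 \<rightarrow> P\<^sub>n\<close> and augmentation \<open>e : P\<^sub>0 \<rightarrow> M\<close>.\<close>

definition projective_resolution :: "('r, 'k) ring_scheme \<Rightarrow> ('r, 'm, 'e) module_scheme \<Rightarrow>
    (nat \<Rightarrow> ('r, 'p) module) \<Rightarrow> (nat \<Rightarrow> 'p \<Rightarrow> 'p) \<Rightarrow> ('p \<Rightarrow> 'm) \<Rightarrow> bool"
  where "projective_resolution R M P d e \<longleftrightarrow>
    (\<forall>n. projective R (P n)) \<and>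
    (\<forall>n. d n \<in> module_hom R (P (Suc n)) (P n)) \<and> e \<in> module_hom R (P 0) M \<and>
    e ` carrier (P 0) = carrier M \<and>
    d 0 ` carrier (P 1) = a_kernel (P 0) M e \<and>
    (\<forall>n. d (Suc n) ` carrier (P (Suc (Suc n))) = a_kernel (P (Suc n)) (P n) (d n))"

text \<open>\<open>0 \<rightarrow> M \<rightarrow> C\<^sub>0 \<rightarrow> C\<^sub>1 \<rightarrow> \<cdots>\<close> with \<open>e : M \<rightarrow> C\<^sub>0\<close> and \<open>d n : C\<^sub>n \<rightarrow> C\<^sub>n\<^sub>+\<^sub>1\<close>.\<close>

definition coresolution :: "('r, 'k) ring_scheme \<Rightarrow> ('r, 'm, 'e) module_scheme \<Rightarrow>
    (nat \<Rightarrow> ('r, 'c) module) \<Rightarrow> (nat \<Rightarrow> 'c \<Rightarrow> 'c) \<Rightarrow> ('m \<Rightarrow> 'c) \<Rightarrow> bool"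
  where "coresolution R M C d e \<longleftrightarrow>
    (\<forall>n. left_module R (C n)) \<and>
    (\<forall>n. d n \<in> module_hom R (C n) (C (Suc n))) \<and> e \<in> module_hom R M (C 0) \<and>
    inj_on e (carrier M) \<and>
    e ` carrier M = a_kernel (C 0) (C 1) (d 0) \<and>
    (\<forall>n. d n ` carrier (C n) = a_kernel (C (Suc n)) (C (Suc (Suc n))) (d (Suc n)))"

text \<open>The map \<open>Hom(M, N) \<rightarrow> Hom(L, N)\<close> induced by \<open>f : L \<rightarrow> M\<close>.\<close>

definition hom_precomp :: "('r, 'l, 'e) module_scheme \<Rightarrow> ('l \<Rightarrow> 'm) \<Rightarrow> ('m \<Rightarrow> 'n) \<Rightarrow> 'l \<Rightarrow> 'n"
  where "hom_precomp L f = (\<lambda>h. compose (carrier L) h f)"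

text \<open>Exactness of \<open>\<cdots> \<rightarrow> Hom(C\<^sub>1, N) \<rightarrow> Hom(C\<^sub>0, N) \<rightarrow> Hom(M, N) \<rightarrow> 0\<close>.\<close>

definition hom_into_exact :: "('r, 'k) ring_scheme \<Rightarrow> ('r, 'm, 'e) module_scheme \<Rightarrow>
    (nat \<Rightarrow> ('r, 'c) module) \<Rightarrow> (nat \<Rightarrow> 'c \<Rightarrow> 'c) \<Rightarrow> ('m \<Rightarrow> 'c) \<Rightarrow> ('r, 'n, 'f) module_scheme \<Rightarrow> bool"
  where "hom_into_exact R M C d e N \<longleftrightarrow>
    hom_precomp M e ` carrier (hom_group R (C 0) N) = carrier (hom_group R M N) \<and>
    hom_precomp (C 0) (d 0) ` carrier (hom_group R (C 1) N) =
      kernel (hom_group R (C 0) N) (hom_group R M N) (hom_precomp M e) \<and>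
    (\<forall>n. hom_precomp (C (Suc n)) (d (Suc n)) ` carrier (hom_group R (C (Suc (Suc n))) N) =
      kernel (hom_group R (C (Suc n)) N) (hom_group R (C n) N) (hom_precomp (C n) (d n)))"

text \<open>The cohomology in degree \<open>i\<close> of \<open>0 \<rightarrow> Hom(P\<^sub>0, N) \<rightarrow> Hom(P\<^sub>1, N) \<rightarrow> \<cdots>\<close>.\<close>

definition hom_cohomology :: "('r, 'k) ring_scheme \<Rightarrow> (nat \<Rightarrow> ('r, 'p) module) \<Rightarrow> (nat \<Rightarrow> 'p \<Rightarrow> 'p) \<Rightarrow>
    ('r, 'n, 'f) module_scheme \<Rightarrow> nat \<Rightarrow> ('p \<Rightarrow> 'n) set monoid"
  where "hom_cohomology R P d N i = (
    let C = (\<lambda>n. hom_group R (P n) N);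
        \<delta> = (\<lambda>n. hom_precomp (P (Suc n)) (d n));
        Z = kernel (C i) (C (Suc i)) (\<delta> i);
        B = (case i of 0 \<Rightarrow> {one (C 0)} | Suc j \<Rightarrow> \<delta> j ` carrier (C j))
    in (C i)\<lparr>carrier := Z\<rparr> Mod B)"

type_synonym ('r, 'm) resolvent = "('r + 'm + nat) list"

subsection \<open>Existence of projective resolutions\<close>

lemma left_moduleI:
  assumes "ring R" "abelian_group M"
    and "\<And>a x. \<lbrakk>a \<in> carrier R; x \<in> carrier M\<rbrakk> \<Longrightarrow> a \<odot>\<^bsub>M\<^esub> x \<in> carrier M"
    and "\<And>a b x. \<lbrakk>a \<in> carrier R; b \<in> carrier R; x \<in> carrier M\<rbrakk> \<Longrightarrow>
       (a \<oplus>\<^bsub>R\<^esub> b) \<odot>\<^bsub>M\<^esub> x = a \<odot>\<^bsub>M\<^esub> x \<oplus>\<^bsub>M\<^esub> b \<odot>\<^bsub>M\<^esub> x"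
    and "\<And>a x y. \<lbrakk>a \<in> carrier R; x \<in> carrier M; y \<in> carrier M\<rbrakk> \<Longrightarrow>
       a \<odot>\<^bsub>M\<^esub> (x \<oplus>\<^bsub>M\<^esub> y) = a \<odot>\<^bsub>M\<^esub> x \<oplus>\<^bsub>M\<^esub> a \<odot>\<^bsub>M\<^esub> y"
    and "\<And>a b x. \<lbrakk>a \<in> carrier R; b \<in> carrier R; x \<in> carrier M\<rbrakk> \<Longrightarrow>
       (a \<otimes>\<^bsub>R\<^esub> b) \<odot>\<^bsub>M\<^esub> x = a \<odot>\<^bsub>M\<^esub> (b \<odot>\<^bsub>M\<^esub> x)"
    and "\<And>x. x \<in> carrier M \<Longrightarrow> \<one>\<^bsub>R\<^esub> \<odot>\<^bsub>M\<^esub> x = x"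
  shows "left_module R M"
  using assms by (simp add: left_module_def left_module_axioms_def)

lemma left_module_regular:
  assumes "ring R" shows "left_module R (regular_module R)"
proof -
  interpret R: ring R by fact
  show ?thesis
    by (intro left_moduleI abelian_groupI assms)
      (auto simp: regular_module_def R.a_ac R.l_distr R.r_distr R.m_assoc intro: R.add.l_inv_ex)
qed

context left_module
begin

lemma smult_l_null [simp]: "x \<in> carrier M \<Longrightarrow> \<zero> \<odot>\<^bsub>M\<^esub> x = \<zero>\<^bsub>M\<^esub>"
  using smult_l_distr[of \<zero> \<zero> x] by (simp add: M.add.l_cancel_one')

lemma smult_r_null [simp]: "a \<in> carrier R \<Longrightarrow> a \<odot>\<^bsub>M\<^esub> \<zero>\<^bsub>M\<^esub> = \<zero>\<^bsub>M\<^esub>"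
  using smult_r_distr[of a "\<zero>\<^bsub>M\<^esub>" "\<zero>\<^bsub>M\<^esub>"] by (simp add: M.add.l_cancel_one')

lemma finsum_smult:
  assumes "finite S" "a \<in> carrier R" "f \<in> S \<rightarrow> carrier M"
  shows "a \<odot>\<^bsub>M\<^esub> finsum M f S = (\<Oplus>\<^bsub>M\<^esub>i\<in>S. a \<odot>\<^bsub>M\<^esub> f i)"
  using assms by (induction S rule: finite_induct) (auto simp: smult_r_distr Pi_iff)

lemma direct_sum_copies_left_module: "left_module R (direct_sum_copies M X)"
proof (rule left_moduleI)
  let ?D = "direct_sum_copies M X"
  show "abelian_group ?D"
  proof (rule abelian_groupI)
    fix f g assume fg: "f \<in> carrier ?D" "g \<in> carrier ?D"
    have "finite {x \<in> X. f x \<oplus>\<^bsub>M\<^esub> g x \<noteq> \<zero>\<^bsub>M\<^esub>}"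
      by (rule finite_subset[of _ "{x \<in> X. f x \<noteq> \<zero>\<^bsub>M\<^esub>} \<union> {x \<in> X. g x \<noteq> \<zero>\<^bsub>M\<^esub>}"])
        (use fg in \<open>auto simp: direct_sum_copies_def\<close>)
    then show "f \<oplus>\<^bsub>?D\<^esub> g \<in> carrier ?D"
      using fg by (auto simp: direct_sum_copies_def PiE_iff cong: conj_cong)
  next
    show "\<zero>\<^bsub>?D\<^esub> \<in> carrier ?D"
      by (auto simp: direct_sum_copies_def cong: conj_cong)
  next
    fix f g h assume "f \<in> carrier ?D" "g \<in> carrier ?D" "h \<in> carrier ?D"
    then show "f \<oplus>\<^bsub>?D\<^esub> g \<oplus>\<^bsub>?D\<^esub> h = f \<oplus>\<^bsub>?D\<^esub> (g \<oplus>\<^bsub>?D\<^esub> h)"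
      by (auto simp: direct_sum_copies_def PiE_iff M.a_assoc intro!: restrict_ext)
  next
    fix f g assume "f \<in> carrier ?D" "g \<in> carrier ?D"
    then show "f \<oplus>\<^bsub>?D\<^esub> g = g \<oplus>\<^bsub>?D\<^esub> f"
      by (auto simp: direct_sum_copies_def PiE_iff M.a_comm intro!: restrict_ext)
  next
    fix f assume f: "f \<in> carrier ?D"
    then show "\<zero>\<^bsub>?D\<^esub> \<oplus>\<^bsub>?D\<^esub> f = f"
      by (auto simp: direct_sum_copies_def PiE_iff intro!: extensionalityI[of _ X])
    have "(\<lambda>x\<in>X. \<ominus>\<^bsub>M\<^esub> f x) \<in> carrier ?D"
    proof -
      have "{x \<in> X. \<ominus>\<^bsub>M\<^esub> f x \<noteq> \<zero>\<^bsub>M\<^esub>} \<subseteq> {x \<in> X. f x \<noteq> \<zero>\<^bsub>M\<^esub>}"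
        by auto
      with f have "finite {x \<in> X. \<ominus>\<^bsub>M\<^esub> f x \<noteq> \<zero>\<^bsub>M\<^esub>}"
        by (auto simp: direct_sum_copies_def intro: finite_subset)
      with f show ?thesis
        by (auto simp: direct_sum_copies_def PiE_iff cong: conj_cong)
    qed
    moreover have "(\<lambda>x\<in>X. \<ominus>\<^bsub>M\<^esub> f x) \<oplus>\<^bsub>?D\<^esub> f = \<zero>\<^bsub>?D\<^esub>"
      using f by (auto simp: direct_sum_copies_def PiE_iff M.l_neg intro!: restrict_ext)
    ultimately show "\<exists>y\<in>carrier ?D. y \<oplus>\<^bsub>?D\<^esub> f = \<zero>\<^bsub>?D\<^esub>"
      by blast
  qed
next
  fix a f assume af: "a \<in> carrier R" "f \<in> carrier (direct_sum_copies M X)"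
  have "{x \<in> X. a \<odot>\<^bsub>M\<^esub> f x \<noteq> \<zero>\<^bsub>M\<^esub>} \<subseteq> {x \<in> X. f x \<noteq> \<zero>\<^bsub>M\<^esub>}"
    using af by auto
  with af have "finite {x \<in> X. a \<odot>\<^bsub>M\<^esub> f x \<noteq> \<zero>\<^bsub>M\<^esub>}"
    by (auto simp: direct_sum_copies_def intro: finite_subset)
  with af show "a \<odot>\<^bsub>direct_sum_copies M X\<^esub> f \<in> carrier (direct_sum_copies M X)"
    by (auto simp: direct_sum_copies_def PiE_iff cong: conj_cong)
qed (auto simp: direct_sum_copies_def PiE_iff smult_l_distr smult_r_distr smult_assoc1 R.ring_axioms
       intro!: restrict_ext extensionalityI[of _ X])

end

definition transport :: "('m \<Rightarrow> 'n) \<Rightarrow> ('r, 'm) module \<Rightarrow> ('r, 'n) module"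
  where "transport h M = (let k = inv_into (carrier M) h in
    \<lparr>carrier = h ` carrier M, mult = undefined, one = undefined,
     ring.zero = h \<zero>\<^bsub>M\<^esub>, add = (\<lambda>x y. h (k x \<oplus>\<^bsub>M\<^esub> k y)), smult = (\<lambda>r x. h (r \<odot>\<^bsub>M\<^esub> k x))\<rparr>)"

lemma transport:
  assumes "left_module R M" "inj_on h (carrier M)"
  shows "left_module R (transport h M)"
    and "inv_into (carrier M) h \<in> module_iso R (transport h M) M"
proof -
  interpret left_module R M by fact
  let ?k = "inv_into (carrier M) h" and ?T = "transport h M"
  have k [simp]: "x \<in> carrier M \<Longrightarrow> ?k (h x) = x" for x
    using assms(2) by simp
  show "left_module R ?T"
  proof (rule left_moduleI)
    show "abelian_group ?T"
      by (rule abelian_groupI)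
        (auto simp: transport_def Let_def M.a_ac intro!: bexI[of _ "\<ominus>\<^bsub>M\<^esub> _"] M.l_neg arg_cong[of _ _ h])
  qed (auto simp: transport_def Let_def smult_l_distr smult_r_distr smult_assoc1 R.ring_axioms)
  show "?k \<in> module_iso R ?T M"
    using assms(2)
    by (auto simp: module_iso_def module_hom_def transport_def Let_def intro!: bij_betw_inv_into inj_on_imp_bij_betw)
qed

lemma iso_imp_iso_direct_summand:
  assumes "left_module R N" "f \<in> module_iso R M N"
  shows "iso_direct_summand R M (N :: ('r, 'n) module)"
proof -
  interpret left_module R N by fact
  have sub: "submodule (carrier N) R N" "submodule {\<zero>\<^bsub>N\<^esub>} R N"
    by (auto intro!: submodule.intro subgroup.intro
        simp: submodule_axioms_def M.a_inv_closed[unfolded a_inv_def] M.add.inv_one[unfolded a_inv_def])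
  have "is_direct_summand R (carrier N) N"
    unfolding is_direct_summand_def using sub by (force intro!: exI[of _ "{\<zero>\<^bsub>N\<^esub>}"])
  with assms(2) show ?thesis
    unfolding iso_direct_summand_def by (intro exI[of _ "carrier N"] exI[of _ f]) simp
qed

text \<open>
  The element type \<open>resolvent\<close> can encode the finitely supported functions from itself to \<open>'r\<close>, and
  hence the free module on any set of its own elements.
\<close>

primrec word_encoding :: "(('r + 'm + nat) list \<times> 'r) list \<Rightarrow> ('r + 'm + nat) list"
  where "word_encoding [] = []"
  | "word_encoding (p # ps) = Inr (Inr (length (fst p))) # fst p @ Inl (snd p) # word_encoding ps"

lemma word_encoding_inject: "word_encoding ps = word_encoding qs \<Longrightarrow> ps = qs"
proof (induction ps arbitrary: qs)
  case Nil
  then show ?case by (cases qs) auto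
next
  case (Cons p ps)
  then show ?case by (cases qs) (auto simp: prod_eq_iff)
qed

definition fun_encoding :: "('r, 'k) ring_scheme \<Rightarrow> ('r, 'm) resolvent set \<Rightarrow>
    (('r, 'm) resolvent \<Rightarrow> 'r) \<Rightarrow> ('r, 'm) resolvent"
  where "fun_encoding R X f =
    word_encoding (SOME ps. set ps = (\<lambda>x. (x, f x)) ` {x \<in> X. f x \<noteq> \<zero>\<^bsub>R\<^esub>})"

lemma inj_fun_encoding:
  fixes R :: "('r, 'k) ring_scheme" and X :: "('r, 'm) resolvent set"
  shows "inj_on (fun_encoding R X) (carrier (direct_sum_copies (regular_module R) X))"
proof (rule inj_onI)
  fix f g
  have l: "set (SOME ps. set ps = G) = G" if "finite G" for G :: "(('r, 'm) resolvent \<times> 'r) set"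
    using finite_list[OF that] by (rule someI_ex)
  let ?gr = "\<lambda>f. (\<lambda>x. (x, f x)) ` {x \<in> X. f x \<noteq> \<zero>\<^bsub>R\<^esub>}"
  let ?l = "\<lambda>f. SOME ps. set ps = ?gr f"
  assume f: "f \<in> carrier (direct_sum_copies (regular_module R) X)"
    and g: "g \<in> carrier (direct_sum_copies (regular_module R) X)"
    and "fun_encoding R X f = fun_encoding R X g"
  then have "?l f = ?l g"
    unfolding fun_encoding_def by (blast dest: word_encoding_inject)
  have "finite (?gr f)" "finite (?gr g)"
    using f g by (simp_all add: direct_sum_copies_def regular_module_def)
  note L = this[THEN l]
  have "?gr f = set (?l f)" by (rule L(1)[symmetric])
  also have "\<dots> = set (?l g)" by (rule arg_cong[OF \<open>?l f = ?l g\<close>])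
  also have "\<dots> = ?gr g" by (rule L(2))
  finally have "?gr f = ?gr g" .
  then have "f x = g x" if "x \<in> X" for x
  proof -
    have "f x \<noteq> \<zero>\<^bsub>R\<^esub> \<Longrightarrow> (x, f x) \<in> ?gr g" "g x \<noteq> \<zero>\<^bsub>R\<^esub> \<Longrightarrow> (x, g x) \<in> ?gr f"
      using that \<open>?gr f = ?gr g\<close> by blast+
    then show ?thesis by (cases "f x = \<zero>\<^bsub>R\<^esub>"; cases "g x = \<zero>\<^bsub>R\<^esub>") auto
  qed
  with f g show "f = g"
    by (auto simp: direct_sum_copies_def PiE_iff intro: extensionalityI)
qed

lemma free_cover:
  assumes "left_module R M"
  shows "\<exists>g \<in> module_hom R (direct_sum_copies (regular_module R) (carrier M)) M.
    g ` carrier (direct_sum_copies (regular_module R) (carrier M)) = carrier M"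
proof -
  interpret left_module R M by fact
  let ?C = "carrier M"
  let ?D = "direct_sum_copies (regular_module R) ?C"
  define S where "S f = {x \<in> ?C. f x \<noteq> \<zero>\<^bsub>R\<^esub>}" for f
  define g where "g f = (\<Oplus>\<^bsub>M\<^esub>x\<in>S f. f x \<odot>\<^bsub>M\<^esub> x)" for f
  have D: "f \<in> carrier ?D \<longleftrightarrow> f \<in> ?C \<rightarrow>\<^sub>E carrier R \<and> finite (S f)" for f
    by (simp add: direct_sum_copies_def regular_module_def S_def)
  have g: "g f = (\<Oplus>\<^bsub>M\<^esub>x\<in>V. f x \<odot>\<^bsub>M\<^esub> x)"
    if "f \<in> carrier ?D" "finite V" "S f \<subseteq> V" "V \<subseteq> ?C" for f V
    unfolding g_def using that
    by (intro M.add.finprod_mono_neutral_cong_left) (auto simp: D S_def PiE_iff Pi_iff)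
  have "g \<in> module_hom R ?D M"
    unfolding module_hom_def
  proof (intro CollectI conjI ballI Pi_I)
    fix f assume "f \<in> carrier ?D"
    then show "g f \<in> ?C"
      unfolding g_def by (intro M.finsum_closed) (auto simp: D S_def PiE_iff)
  next
    fix f f' assume f: "f \<in> carrier ?D" "f' \<in> carrier ?D"
    interpret D: left_module R ?D
      using left_module_regular[OF R.ring_axioms] by (rule left_module.direct_sum_copies_left_module)
    let ?V = "S f \<union> S f'"
    have V: "finite ?V" "?V \<subseteq> ?C" using f by (auto simp: D S_def)
    have s: "(f \<oplus>\<^bsub>?D\<^esub> f') x = f x \<oplus>\<^bsub>R\<^esub> f' x" if "x \<in> ?C" for x
      using that by (simp add: direct_sum_copies_def regular_module_def)
    have "S (f \<oplus>\<^bsub>?D\<^esub> f') \<subseteq> ?V"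
      using f by (auto simp: S_def s)
    then have "g (f \<oplus>\<^bsub>?D\<^esub> f') = (\<Oplus>\<^bsub>M\<^esub>x\<in>?V. (f \<oplus>\<^bsub>?D\<^esub> f') x \<odot>\<^bsub>M\<^esub> x)"
      using f V by (intro g) auto
    also have "\<dots> = (\<Oplus>\<^bsub>M\<^esub>x\<in>?V. f x \<odot>\<^bsub>M\<^esub> x \<oplus>\<^bsub>M\<^esub> f' x \<odot>\<^bsub>M\<^esub> x)"
      using f V by (intro M.finsum_cong') (auto simp: s smult_l_distr D PiE_iff subset_iff)
    also have "\<dots> = g f \<oplus>\<^bsub>M\<^esub> g f'"
      using f V by (subst M.finsum_addf) (auto simp: g[of f ?V] g[of f' ?V] D PiE_iff subset_iff)
    finally show "g (f \<oplus>\<^bsub>?D\<^esub> f') = g f \<oplus>\<^bsub>M\<^esub> g f'" .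
  next
    fix r f assume f: "r \<in> carrier R" "f \<in> carrier ?D"
    interpret D: left_module R ?D
      using left_module_regular[OF R.ring_axioms] by (rule left_module.direct_sum_copies_left_module)
    have V: "finite (S f)" "S f \<subseteq> ?C" using f by (auto simp: D S_def)
    have s: "(r \<odot>\<^bsub>?D\<^esub> f) x = r \<otimes>\<^bsub>R\<^esub> f x" if "x \<in> ?C" for x
      using that by (simp add: direct_sum_copies_def regular_module_def)
    have "S (r \<odot>\<^bsub>?D\<^esub> f) \<subseteq> S f"
      using f by (auto simp: S_def s)
    then have "g (r \<odot>\<^bsub>?D\<^esub> f) = (\<Oplus>\<^bsub>M\<^esub>x\<in>S f. (r \<odot>\<^bsub>?D\<^esub> f) x \<odot>\<^bsub>M\<^esub> x)"
      using f V by (intro g) auto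
    also have "\<dots> = (\<Oplus>\<^bsub>M\<^esub>x\<in>S f. r \<odot>\<^bsub>M\<^esub> (f x \<odot>\<^bsub>M\<^esub> x))"
      using f V by (intro M.finsum_cong') (auto simp: s smult_assoc1 D PiE_iff subset_iff)
    also have "\<dots> = r \<odot>\<^bsub>M\<^esub> g f"
      unfolding g_def using f V by (subst finsum_smult) (auto simp: D PiE_iff subset_iff)
    finally show "g (r \<odot>\<^bsub>?D\<^esub> f) = r \<odot>\<^bsub>M\<^esub> g f" .
  qed
  moreover have "y \<in> g ` carrier ?D" if y: "y \<in> ?C" for y
  proof
    let ?f = "\<lambda>x\<in>?C. if x = y then \<one>\<^bsub>R\<^esub> else \<zero>\<^bsub>R\<^esub>"
    have "S ?f \<subseteq> {y}" by (auto simp: S_def split: if_splits)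
    moreover from this show "?f \<in> carrier ?D"
      by (auto simp: D intro: finite_subset)
    ultimately show "y = g ?f"
      using y by (subst g[of _ "{y}"]) (auto simp: M.finsum_insert)
  qed
  ultimately show ?thesis
    by (intro bexI[of _ g]) (auto simp: module_hom_def)
qed

lemma module_hom_comp:
  "\<lbrakk>f \<in> module_hom R L M; g \<in> module_hom R M N\<rbrakk> \<Longrightarrow> g \<circ> f \<in> module_hom R L N"
  by (auto simp: module_hom_def Pi_iff)

lemma projective_cover_exists:
  fixes K :: "('r, ('r, 'm) resolvent) module"
  assumes "left_module R K"
  shows "\<exists>(F :: ('r, ('r, 'm) resolvent) module) g.
    projective R F \<and> g \<in> module_hom R F K \<and> g ` carrier F = carrier K"
proof -
  interpret left_module R K by fact
  let ?D = "direct_sum_copies (regular_module R) (carrier K)"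
  let ?h = "fun_encoding R (carrier K)"
  let ?F = "transport ?h ?D" and ?k = "inv_into (carrier ?D) ?h"
  have D: "left_module R ?D"
    using left_module_regular[OF R.ring_axioms] by (rule left_module.direct_sum_copies_left_module)
  obtain g where g: "g \<in> module_hom R ?D K" "g ` carrier ?D = carrier K"
    using free_cover[OF assms] by blast
  note F = transport[OF D inj_fun_encoding]
  have "projective R ?F"
    unfolding projective_def using F iso_imp_iso_direct_summand[OF D F(2)] by blast
  moreover have "g \<circ> ?k \<in> module_hom R ?F K"
    using F(2) g by (auto intro: module_hom_comp simp: module_iso_def)
  moreover have "(g \<circ> ?k) ` carrier ?F = carrier K"
    using F(2) g(2) by (simp add: module_iso_def bij_betw_def flip: image_image image_comp)
  ultimately show ?thesis by blast
qed

lemma left_module_kernel: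
  assumes "left_module R M" "left_module R N" "f \<in> module_hom R M N"
  shows "left_module R (M\<lparr>carrier := a_kernel M N f\<rparr>)"
proof -
  interpret M: left_module R M by fact
  interpret N: left_module R N by fact
  have f [simp]: "f x \<in> carrier N" "f (x \<oplus>\<^bsub>M\<^esub> y) = f x \<oplus>\<^bsub>N\<^esub> f y"
    "r \<in> carrier R \<Longrightarrow> f (r \<odot>\<^bsub>M\<^esub> x) = r \<odot>\<^bsub>N\<^esub> f x"
    if "x \<in> carrier M" "y \<in> carrier M" for x y r
    using assms(3) that by (auto simp: module_hom_def)
  have k: "a_kernel M N f = {x \<in> carrier M. f x = \<zero>\<^bsub>N\<^esub>}"
    by (auto simp: a_kernel_def kernel_def)
  have z: "f \<zero>\<^bsub>M\<^esub> = \<zero>\<^bsub>N\<^esub>"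
    using f(3)[of "\<zero>\<^bsub>M\<^esub>" "\<zero>\<^bsub>M\<^esub>" "\<zero>\<^bsub>R\<^esub>"] f(1)[of "\<zero>\<^bsub>M\<^esub>" "\<zero>\<^bsub>M\<^esub>"] by simp
  have n: "\<exists>y. y \<in> carrier M \<and> f y = \<zero>\<^bsub>N\<^esub> \<and> x \<oplus>\<^bsub>M\<^esub> y = \<zero>\<^bsub>M\<^esub>"
    if "x \<in> carrier M" "f x = \<zero>\<^bsub>N\<^esub>" for x
    using f(2)[of "\<ominus>\<^bsub>M\<^esub> x" x] f(1)[of "\<ominus>\<^bsub>M\<^esub> x" x] that z
    by (intro exI[of _ "\<ominus>\<^bsub>M\<^esub> x"]) (simp add: M.M.l_neg M.M.r_neg)
  show ?thesis
    by (intro left_moduleI abelian_groupI M.R.ring_axioms)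
      (auto simp: k z M.M.a_ac M.smult_l_distr M.smult_r_distr M.smult_assoc1 intro!: n)
qed

theorem projective_resolution_exists:
  fixes M :: "('r, 'm, 'e) module_scheme"
  assumes "left_module R M"
  shows "\<exists>(P :: nat \<Rightarrow> ('r, ('r, 'm) resolvent) module) d e. projective_resolution R M P d e"
proof -
  let ?M = "restrict_scalars id M"
  let ?i = "\<lambda>x :: 'm. [Inr (Inl x)] :: ('r, 'm) resolvent"
  interpret M: left_module R M by fact
  have M: "left_module R ?M"
    by (intro left_moduleI abelian_groupI M.R.ring_axioms)
      (auto simp: restrict_scalars_def M.M.a_ac M.smult_l_distr M.smult_r_distr M.smult_assoc1
        intro!: M.M.add.l_inv_ex)
  have "inj_on ?i (carrier ?M)" by (simp add: inj_on_def)
  note tr = transport[OF M this]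
  define i where "i = inv_into (carrier ?M) ?i"
  have i: "i \<in> module_hom R (transport ?i ?M) M" "i ` carrier (transport ?i ?M) = carrier M"
    using tr(2) by (auto simp: i_def module_iso_def module_hom_def restrict_scalars_def bij_betw_def)
  obtain P0 :: "('r, ('r, 'm) resolvent) module" and e0
    where P0: "projective R P0" "e0 \<in> module_hom R P0 (transport ?i ?M)"
      "e0 ` carrier P0 = carrier (transport ?i ?M)"
    using projective_cover_exists[OF tr(1)] by blast
  define e where "e = i \<circ> e0"
  have e: "e \<in> module_hom R P0 M" "e ` carrier P0 = carrier M"
    using P0(2,3) i unfolding e_def by (blast intro: module_hom_comp, simp only: image_comp[symmetric])
  define K where "K s = (fst s)\<lparr>carrier := snd s\<rparr>"
    for s :: "('r, ('r, 'm) resolvent) module \<times> ('r, 'm) resolvent set"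
  define ok where "ok s \<longleftrightarrow> projective R (fst s) \<and> left_module R (K s) \<and> snd s \<subseteq> carrier (fst s)" for s
  define link where "link s t g \<longleftrightarrow> g \<in> module_hom R (fst t) (fst s) \<and> g ` carrier (fst t) = snd s \<and>
      snd t = a_kernel (fst t) (fst s) g"
    for s t :: "('r, ('r, 'm) resolvent) module \<times> ('r, 'm) resolvent set" and g
  have "\<exists>t. ok t \<and> (\<exists>g. link s t g)" if s: "ok s" for s
  proof -
    obtain F :: "('r, ('r, 'm) resolvent) module" and g where F: "projective R F" "g \<in> module_hom R F (K s)" "g ` carrier F = carrier (K s)"
      using projective_cover_exists[of R "K s"] s unfolding ok_def by blast
    have g: "g \<in> module_hom R F (fst s)"
      using F(2) s by (auto simp: module_hom_def K_def ok_def)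
    have "ok (F, a_kernel F (fst s) g)"
      using left_module_kernel[OF _ _ g] F s
      by (auto simp: ok_def K_def projective_def a_kernel_def kernel_def)
    moreover have "link s (F, a_kernel F (fst s) g) g"
      using g F by (auto simp: link_def K_def)
    ultimately show ?thesis by blast
  qed
  moreover have "ok (P0, a_kernel P0 M e)"
    using left_module_kernel[OF _ assms e(1)] P0
    by (auto simp: ok_def K_def projective_def a_kernel_def kernel_def)
  ultimately obtain s where s: "s 0 = (P0, a_kernel P0 M e)" "\<And>n. ok (s n)"
    "\<And>n. \<exists>g. link (s n) (s (Suc n)) g"
    using dependent_nat_choice[of "\<lambda>n s. ok s \<and> (n = 0 \<longrightarrow> s = (P0, a_kernel P0 M e))"
        "\<lambda>n s t. \<exists>g. link s t g"] by (metis nat.distinct(1))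
  then obtain d where d: "\<And>n. link (s n) (s (Suc n)) (d n)" by metis
  have "projective_resolution R M (\<lambda>n. fst (s n)) d e"
    using s(1,2) d e by (auto simp: projective_resolution_def link_def ok_def)
  then show ?thesis by blast
qed


subsection \<open>Ext\<close>

text \<open>
  Ext is computed from a chosen projective resolution; its members have the element type
  \<open>resolvent\<close>, which is large enough by \<open>projective_resolution_exists\<close>.
\<close>

definition chosen_resolution :: "('r, 'k) ring_scheme \<Rightarrow> ('r, 'm, 'e) module_scheme \<Rightarrow>
    (nat \<Rightarrow> ('r, ('r, 'm) resolvent) module) \<times>
    (nat \<Rightarrow> ('r, 'm) resolvent \<Rightarrow> ('r, 'm) resolvent) \<times> (('r, 'm) resolvent \<Rightarrow> 'm)"
  where "chosen_resolution R M = (SOME (P, d, e). projective_resolution R M P d e)"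

definition Ext :: "('r, 'k) ring_scheme \<Rightarrow> nat \<Rightarrow> ('r, 'm, 'e) module_scheme \<Rightarrow>
    ('r, 'n, 'f) module_scheme \<Rightarrow> (('r, 'm) resolvent \<Rightarrow> 'n) set monoid"
  where "Ext R i M N = (case chosen_resolution R M of (P, d, e) \<Rightarrow> hom_cohomology R P d N i)"


section \<open>Wakamatsu tilting modules\<close>

text \<open>
  The element types of the modules in the two sequences lose no generality: a finitely generated
  projective module is isomorphic to a submodule of some \<open>R\<^sup>n\<close>, a module in \<open>add T\<close> to a
  submodule of some \<open>T\<^sup>n\<close>, and both are realised on functions on the natural numbers.
\<close>

definition wakamatsu_tilting :: "('r, 'k) ring_scheme \<Rightarrow> ('r, 't, 'e) module_scheme \<Rightarrow> bool"
  where "wakamatsu_tilting R T \<longleftrightarrow> left_module R T \<and>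
    (\<exists>(P :: nat \<Rightarrow> ('r, nat \<Rightarrow> 'r) module) d e.
        projective_resolution R T P d e \<and> (\<forall>n. finitely_generated R (P n))) \<and>
    (\<forall>i>0. trivial_group (Ext R i T T)) \<and>
    (\<exists>(C :: nat \<Rightarrow> ('r, nat \<Rightarrow> 't) module) d e.
        coresolution R (regular_module R) C d e \<and> (\<forall>n. in_add R T (C n)) \<and>
        hom_into_exact R (regular_module R) C d e T)"

end

theory Submission
  imports Defs
begin

text \<open>
  Write \<open>U = A \<otimes>\<^sub>R T\<close>. The retraction of \<open>\<iota>\<close> makes \<open>T\<close> a direct summand of \<open>U\<close> over \<open>R\<close> and \<open>R\<close> a direct
  summand of \<open>A\<close>, so it suffices to restrict everything from \<open>A\<close> to \<open>R\<close> and to pass to summands.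

  The Frobenius form \<open>E : A \<rightarrow> R\<close> with dual bases \<open>a\<^sub>i\<close>, \<open>b\<^sub>i\<close> identifies \<open>U\<close> with the coinduced module:
  an \<open>R\<close>-linear \<open>f : X \<rightarrow> T\<close> on an \<open>A\<close>-module \<open>X\<close> is \<open>(E \<otimes> 1) \<circ> h\<close> for the \<open>A\<close>-linear map
  \<open>h x = \<Sum> b\<^sub>i \<otimes> f (a\<^sub>i x)\<close>. Both the vanishing of Ext and the exactness under \<open>Hom(-, N)\<close> say that
  homomorphisms into \<open>N\<close> extend from the (co)syzygies to the modules containing them; hence extension of
  \<open>A\<close>-homomorphisms into \<open>U\<close> gives extension of \<open>R\<close>-homomorphisms into \<open>T\<close>.

  For summands, the finitely generated resolution and the vanishing of Ext descend by Schanuel's lemma,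
  and the coresolution of \<open>A\<close> by \<open>add T\<close> is modified step by step into one of \<open>R\<close>.
\<close>

section \<open>Module homomorphisms and submodules\<close>

text \<open>Two obstacles shape the argument. The idempotent of \<open>A\<close> with image
  \<open>R\<close> extends to the first term \<open>C 0\<close> of the coresolution, but the
  extension need not be idempotent, so the \<open>C n\<close> do not split along it. What survives
  is a module \<open>D n\<close>, isomorphic to the direct sum of \<open>C 0\<close>, ...,
  \<open>C n\<close>, with a submodule \<open>H n\<close> carrying an idempotent whose image is the
  current cosyzygy of \<open>R\<close>. Likewise, a syzygy of a summand under an unrelated cover is
  a summand only up to a map through a projective; \<open>stable_retract\<close> is the form that
  passes from each syzygy to the next.

  The second obstacle is that Ext is computed from an arbitrarily chosen resolution over each ring,
  on its own element type, and nothing makes its terms finitely generated. Restriction to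
  \<open>R\<close> is therefore done on the finitely generated resolution that tilting provides,
  with a comparison of resolutions before and after. Sums of maps through \<open>T\<close> are kept
  as the inductive predicate \<open>factors\<close>, so that closure properties of add follow by
  induction without matrices; the membership of \<open>U\<close> in add \<open>T\<close> enters
  through transitivity of that predicate.\<close>

lemma (in abelian_group) minus_eq_zero_iff:
  "\<lbrakk>x \<in> carrier G; y \<in> carrier G\<rbrakk> \<Longrightarrow> x \<ominus> y = \<zero> \<longleftrightarrow> x = y"
  by (metis a_minus_def add.inv_solve_right' add.m_comm l_zero a_inv_def r_neg zero_closed)

lemma (in abelian_group) minus_self [simp]: "x \<in> carrier G \<Longrightarrow> x \<ominus> x = \<zero>"
  by (simp add: a_minus_def r_neg)

lemma module_homI:
  assumes "\<And>x. x \<in> carrier M \<Longrightarrow> f x \<in> carrier N"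
    and "\<And>x y. \<lbrakk>x \<in> carrier M; y \<in> carrier M\<rbrakk> \<Longrightarrow> f (x \<oplus>\<^bsub>M\<^esub> y) = f x \<oplus>\<^bsub>N\<^esub> f y"
    and "\<And>r x. \<lbrakk>r \<in> carrier R; x \<in> carrier M\<rbrakk> \<Longrightarrow> f (r \<odot>\<^bsub>M\<^esub> x) = r \<odot>\<^bsub>N\<^esub> f x"
  shows "f \<in> module_hom R M N"
  using assms by (auto simp: module_hom_def)

lemma module_homD:
  assumes "f \<in> module_hom R M N" "x \<in> carrier M"
  shows module_hom_closed: "f x \<in> carrier N"
    and module_hom_add: "y \<in> carrier M \<Longrightarrow> f (x \<oplus>\<^bsub>M\<^esub> y) = f x \<oplus>\<^bsub>N\<^esub> f y"
    and module_hom_smult: "r \<in> carrier R \<Longrightarrow> f (r \<odot>\<^bsub>M\<^esub> x) = r \<odot>\<^bsub>N\<^esub> f x"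
  using assms by (auto simp: module_hom_def)

lemma module_hom_compose:
  "\<lbrakk>f \<in> module_hom R L M; g \<in> module_hom R M N\<rbrakk> \<Longrightarrow> (\<lambda>x. g (f x)) \<in> module_hom R L N"
  by (auto simp: module_hom_def Pi_iff)

lemma module_hom_cong:
  assumes "f \<in> module_hom R M N" "left_module R M" "\<And>x. x \<in> carrier M \<Longrightarrow> g x = f x"
  shows "g \<in> module_hom R M N"
proof -
  interpret M: left_module R M by fact
  show ?thesis using assms(1,3) by (auto simp: module_hom_def Pi_iff)
qed

lemma module_hom_ident: "(\<lambda>x. x) \<in> module_hom R M M"
  by (auto simp: module_hom_def)

lemma module_hom_zero_map: "left_module R N \<Longrightarrow> (\<lambda>x. \<zero>\<^bsub>N\<^esub>) \<in> module_hom R M N"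
proof -
  assume "left_module R N"
  then interpret N: left_module R N .
  show ?thesis by (auto simp: module_hom_def)
qed

lemma module_hom_plus:
  assumes "left_module R N" "f \<in> module_hom R M N" "g \<in> module_hom R M N"
  shows "(\<lambda>x. f x \<oplus>\<^bsub>N\<^esub> g x) \<in> module_hom R M N"
proof -
  interpret N: left_module R N by fact
  show ?thesis
    using assms(2,3)
    by (intro module_homI) (auto simp: module_homD N.smult_r_distr N.M.a_ac)
qed

lemma module_hom_zero:
  assumes "left_module R M" "left_module R N" "f \<in> module_hom R M N"
  shows "f \<zero>\<^bsub>M\<^esub> = \<zero>\<^bsub>N\<^esub>"
proof -
  interpret M: left_module R M by fact
  interpret N: left_module R N by fact
  show ?thesis
    using module_hom_smult[OF assms(3), of "\<zero>\<^bsub>M\<^esub>" "\<zero>\<^bsub>R\<^esub>"] module_hom_closed[OF assms(3), of "\<zero>\<^bsub>M\<^esub>"]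
    by simp
qed

text \<open>Reduces negation to scalar multiplication, so that homomorphisms, submodules and
  differences need no separate treatment of inverses.\<close>

lemma (in left_module) uminus_eq_smult: "x \<in> carrier M \<Longrightarrow> \<ominus>\<^bsub>M\<^esub> x = (\<ominus> \<one>) \<odot>\<^bsub>M\<^esub> x"
  using smult_l_distr[of "\<ominus> \<one>" \<one> x] by (simp add: M.minus_equality R.l_neg)

lemma module_hom_uminus:
  assumes "left_module R M" "left_module R N" "f \<in> module_hom R M N" "x \<in> carrier M"
  shows "f (\<ominus>\<^bsub>M\<^esub> x) = \<ominus>\<^bsub>N\<^esub> f x"
proof -
  interpret M: left_module R M by fact
  interpret N: left_module R N by fact
  show ?thesis
    using assms(3,4) by (simp add: M.uminus_eq_smult N.uminus_eq_smult module_homD)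
qed

lemma module_hom_minus:
  assumes "left_module R M" "left_module R N" "f \<in> module_hom R M N"
    and "x \<in> carrier M" "y \<in> carrier M"
  shows "f (x \<ominus>\<^bsub>M\<^esub> y) = f x \<ominus>\<^bsub>N\<^esub> f y"
proof -
  interpret M: left_module R M by fact
  interpret N: left_module R N by fact
  show ?thesis
    using assms(3-) by (simp add: a_minus_def module_homD module_hom_uminus[OF assms(1,2)])
qed

lemma module_hom_diff:
  assumes "left_module R N" "f \<in> module_hom R M N" "g \<in> module_hom R M N"
  shows "(\<lambda>x. f x \<ominus>\<^bsub>N\<^esub> g x) \<in> module_hom R M N"
proof -
  interpret N: left_module R N by fact
  show ?thesis
    using assms(2,3)
    by (intro module_homI)
       (auto simp: module_homD a_minus_def N.smult_r_distr N.M.a_ac N.M.minus_add N.uminus_eq_smult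
          N.R.l_minus N.R.r_minus simp flip: N.smult_assoc1)
qed

section \<open>Kernels, images and submodules\<close>

lemma mem_a_kernel: "x \<in> a_kernel M N f \<longleftrightarrow> x \<in> carrier M \<and> f x = \<zero>\<^bsub>N\<^esub>"
  by (auto simp: a_kernel_def kernel_def)

lemma (in left_module) submoduleI:
  assumes "H \<subseteq> carrier M" "\<zero>\<^bsub>M\<^esub> \<in> H" "\<And>x y. \<lbrakk>x \<in> H; y \<in> H\<rbrakk> \<Longrightarrow> x \<oplus>\<^bsub>M\<^esub> y \<in> H"
    "\<And>r x. \<lbrakk>r \<in> carrier R; x \<in> H\<rbrakk> \<Longrightarrow> r \<odot>\<^bsub>M\<^esub> x \<in> H"
  shows "submodule H R M"
proof -
  have "inv\<^bsub>add_monoid M\<^esub> x \<in> H" if "x \<in> H" for x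
    using uminus_eq_smult[of x] assms(1) assms(4)[of "\<ominus> \<one>" x] that by (auto simp: a_inv_def)
  then show ?thesis
    using assms by (auto intro!: submodule.intro subgroup.intro simp: submodule_axioms_def)
qed

lemma submodule_subset: "submodule H R M \<Longrightarrow> H \<subseteq> carrier M"
  and submodule_zero: "submodule H R M \<Longrightarrow> \<zero>\<^bsub>M\<^esub> \<in> H"
  and submodule_add: "submodule H R M \<Longrightarrow> x \<in> H \<Longrightarrow> y \<in> H \<Longrightarrow> x \<oplus>\<^bsub>M\<^esub> y \<in> H"
  and submodule_smult: "submodule H R M \<Longrightarrow> r \<in> carrier R \<Longrightarrow> x \<in> H \<Longrightarrow> r \<odot>\<^bsub>M\<^esub> x \<in> H"
  by (auto simp: submodule_def subgroup_def submodule_axioms_def)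

lemma submodule_left_module:
  assumes "left_module R M" "submodule H R M"
  shows "left_module R (M\<lparr>carrier := H\<rparr>)"
proof -
  interpret left_module R M by fact
  note H = submodule_subset[OF assms(2)] submodule_zero[OF assms(2)] submodule_add[OF assms(2)]
    submodule_smult[OF assms(2)]
  have "\<exists>y\<in>H. y \<oplus>\<^bsub>M\<^esub> x = \<zero>\<^bsub>M\<^esub>" if "x \<in> H" for x
    using H(1) H(4)[of "\<ominus>\<^bsub>R\<^esub> \<one>\<^bsub>R\<^esub>" x] that uminus_eq_smult[of x] M.l_neg[of x] by auto
  then show ?thesis
    using H by (intro left_moduleI abelian_groupI R.ring_axioms)
      (auto simp: smult_l_distr smult_r_distr smult_assoc1 M.a_ac subset_iff)
qed

lemma submodule_kernel:
  assumes "left_module R M" "left_module R N" "f \<in> module_hom R M N"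
  shows "submodule (a_kernel M N f) R M"
proof -
  interpret M: left_module R M by fact
  interpret N: left_module R N by fact
  show ?thesis
    using assms(3) module_hom_zero[OF assms]
    by (intro M.submoduleI) (auto simp: mem_a_kernel module_homD)
qed

lemma submodule_image:
  assumes "left_module R M" "left_module R N" "f \<in> module_hom R M N"
  shows "submodule (f ` carrier M) R N"
proof -
  interpret M: left_module R M by fact
  interpret N: left_module R N by fact
  show ?thesis
    using module_hom_closed[OF assms(3)] module_hom_zero[OF assms]
    by (intro N.submoduleI)
      (auto intro: image_eqI[of "\<zero>\<^bsub>N\<^esub>" f "\<zero>\<^bsub>M\<^esub>"] simp flip: module_homD(2,3)[OF assms(3)])
qed

lemma module_hom_restrict:
  "f \<in> module_hom R M N \<Longrightarrow> H \<subseteq> carrier M \<Longrightarrow> f \<in> module_hom R (M\<lparr>carrier := H\<rparr>) N"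
  by (auto simp: module_hom_def subset_iff)

lemma module_hom_corestrict:
  "f \<in> module_hom R M N \<Longrightarrow> (\<And>x. x \<in> carrier M \<Longrightarrow> f x \<in> H) \<Longrightarrow> f \<in> module_hom R M (N\<lparr>carrier := H\<rparr>)"
  by (auto simp: module_hom_def)

lemma module_hom_expand:
  "f \<in> module_hom R M (N\<lparr>carrier := H\<rparr>) \<Longrightarrow> H \<subseteq> carrier N \<Longrightarrow> f \<in> module_hom R M N"
  by (auto simp: module_hom_def)

text \<open>The homomorphism theorem, phrased on the image of \<open>b\<close> instead of a quotient
  of \<open>L\<close>: the value at a point of the image is \<open>f\<close> of any preimage, and
  the kernel condition makes the choice irrelevant. Working in the image keeps the element type of
  \<open>M\<close>.\<close>

lemma module_hom_factor:
  assumes L: "left_module R L" and M: "left_module R M" and N: "left_module R N"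
    and f: "f \<in> module_hom R L N" and b: "b \<in> module_hom R L M"
    and k: "\<And>x. x \<in> carrier L \<Longrightarrow> b x = \<zero>\<^bsub>M\<^esub> \<Longrightarrow> f x = \<zero>\<^bsub>N\<^esub>"
  shows "\<exists>g \<in> module_hom R (M\<lparr>carrier := b ` carrier L\<rparr>) N. \<forall>x\<in>carrier L. g (b x) = f x"
proof -
  interpret L: left_module R L by fact
  interpret M: left_module R M by fact
  interpret N: left_module R N by fact
  have wd: "f x = f y" if "x \<in> carrier L" "y \<in> carrier L" "b x = b y" for x y
  proof -
    have "b (x \<ominus>\<^bsub>L\<^esub> y) = \<zero>\<^bsub>M\<^esub>"
      using that b by (simp add: module_hom_minus[OF L M b] module_homD)
    then have "f x \<ominus>\<^bsub>N\<^esub> f y = \<zero>\<^bsub>N\<^esub>"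
      using k[of "x \<ominus>\<^bsub>L\<^esub> y"] that by (simp add: module_hom_minus[OF L N f])
    then show ?thesis
      using f that by (simp add: module_homD N.M.minus_eq_zero_iff)
  qed
  define g where "g y = f (SOME x. x \<in> carrier L \<and> b x = y)" for y
  have g: "g (b x) = f x" if "x \<in> carrier L" for x
  proof -
    have "(SOME x'. x' \<in> carrier L \<and> b x' = b x) \<in> carrier L \<and>
        b (SOME x'. x' \<in> carrier L \<and> b x' = b x) = b x"
      by (rule someI[of _ x]) (use that in auto)
    then show ?thesis unfolding g_def using wd that by blast
  qed
  moreover have "g \<in> module_hom R (M\<lparr>carrier := b ` carrier L\<rparr>) N"
    by (intro module_homI)
       (auto simp: g module_homD[OF f] simp flip: module_homD(2,3)[OF b])
  ultimately show ?thesis by blast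
qed

lemma module_hom_inverse:
  assumes "left_module R M" "f \<in> module_hom R M N" "bij_betw f (carrier M) (carrier N)"
  shows "inv_into (carrier M) f \<in> module_hom R N M"
proof -
  interpret M: left_module R M by fact
  let ?k = "inv_into (carrier M) f"
  have k: "?k y \<in> carrier M" "f (?k y) = y" if "y \<in> carrier N" for y
    using assms(3) that by (auto simp: bij_betw_def inv_into_into f_inv_into_f)
  have i: "?k (f x) = x" if "x \<in> carrier M" for x
    using assms(3) that by (auto simp: bij_betw_def)
  show ?thesis
  proof (intro module_homI)
    fix x y assume xy: "x \<in> carrier N" "y \<in> carrier N"
    have "?k (f (?k x \<oplus>\<^bsub>M\<^esub> ?k y)) = ?k x \<oplus>\<^bsub>M\<^esub> ?k y"
      using k xy by (intro i) auto
    then show "?k (x \<oplus>\<^bsub>N\<^esub> y) = ?k x \<oplus>\<^bsub>M\<^esub> ?k y"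
      using k xy module_hom_add[OF assms(2), of "?k x" "?k y"] by simp
  next
    fix r x assume xy: "x \<in> carrier N" "r \<in> carrier R"
    have "?k (f (r \<odot>\<^bsub>M\<^esub> ?k x)) = r \<odot>\<^bsub>M\<^esub> ?k x"
      using k xy by (intro i) auto
    then show "?k (r \<odot>\<^bsub>N\<^esub> x) = r \<odot>\<^bsub>M\<^esub> ?k x"
      using k xy module_hom_smult[OF assms(2), of "?k x" r] by simp
  qed (use k in auto)
qed

section \<open>Direct summands as retracts\<close>

lemma iso_direct_summand_imp_retract:
  assumes N: "left_module R N" and M: "left_module R M" and "iso_direct_summand R M N"
  shows "\<exists>s \<in> module_hom R M N. \<exists>p \<in> module_hom R N M. \<forall>x\<in>carrier M. p (s x) = x"
proof -
  interpret N: left_module R N by fact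
  obtain N' N'' f where f: "f \<in> module_hom R M (N\<lparr>carrier := N'\<rparr>)" "bij_betw f (carrier M) N'"
    and N': "submodule N' R N" and N'': "submodule N'' R N"
    and cap: "N' \<inter> N'' = {\<zero>\<^bsub>N\<^esub>}" and sum: "{x \<oplus>\<^bsub>N\<^esub> y | x y. x \<in> N' \<and> y \<in> N''} = carrier N"
    using assms(3) unfolding iso_direct_summand_def is_direct_summand_def module_iso_def by auto
  note s = submodule_subset[OF N'] submodule_subset[OF N'']
  note sL = submodule_left_module[OF N N'] submodule_left_module[OF N N'']
  interpret N': left_module R "N\<lparr>carrier := N'\<rparr>" by (rule sL)
  interpret N'': left_module R "N\<lparr>carrier := N''\<rparr>" by (rule sL)
  \<comment> \<open>The difference x - x' = y' - y lies in both complementary submodules, hence is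
    zero.\<close>
  have uniq: "x = x'" if "x \<in> N'" "x' \<in> N'" "y \<in> N''" "y' \<in> N''" "x \<oplus>\<^bsub>N\<^esub> y = x' \<oplus>\<^bsub>N\<^esub> y'" for x x' y y'
  proof -
    have in': "x \<in> carrier N" "x' \<in> carrier N" "y \<in> carrier N" "y' \<in> carrier N" using that s by auto
    have "x \<ominus>\<^bsub>N\<^esub> x' = y' \<ominus>\<^bsub>N\<^esub> y"
      using that(5) in' by (smt (verit) N.M.a_ac N.M.a_closed N.M.a_inv_closed N.M.r_neg1 N.M.r_neg2 a_minus_def)
    moreover have "x \<ominus>\<^bsub>N\<^esub> x' \<in> N'"
      using submodule_add[OF N', of x "(\<ominus>\<^bsub>R\<^esub> \<one>\<^bsub>R\<^esub>) \<odot>\<^bsub>N\<^esub> x'"] submodule_smult[OF N'] that in'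
      by (simp add: a_minus_def N.uminus_eq_smult)
    moreover have "y' \<ominus>\<^bsub>N\<^esub> y \<in> N''"
      using submodule_add[OF N'', of y' "(\<ominus>\<^bsub>R\<^esub> \<one>\<^bsub>R\<^esub>) \<odot>\<^bsub>N\<^esub> y"] submodule_smult[OF N''] that in'
      by (simp add: a_minus_def N.uminus_eq_smult)
    ultimately have "x \<ominus>\<^bsub>N\<^esub> x' = \<zero>\<^bsub>N\<^esub>" using cap by auto
    then show ?thesis using in' by (simp add: N.M.minus_eq_zero_iff)
  qed
  \<comment> \<open>The projection onto \<open>N'\<close> along \<open>N''\<close>; by
    \<open>uniq\<close> the choice has only one candidate.\<close>
  define q where "q z = (SOME x. x \<in> N' \<and> (\<exists>y\<in>N''. z = x \<oplus>\<^bsub>N\<^esub> y))" for z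
  have q: "q (x \<oplus>\<^bsub>N\<^esub> y) = x" if "x \<in> N'" "y \<in> N''" for x y
  proof -
    have "q (x \<oplus>\<^bsub>N\<^esub> y) \<in> N' \<and> (\<exists>y'\<in>N''. x \<oplus>\<^bsub>N\<^esub> y = q (x \<oplus>\<^bsub>N\<^esub> y) \<oplus>\<^bsub>N\<^esub> y')"
      unfolding q_def by (rule someI[of _ x]) (use that in auto)
    then show ?thesis using uniq that by metis
  qed
  have ex: "\<exists>x\<in>N'. \<exists>y\<in>N''. z = x \<oplus>\<^bsub>N\<^esub> y" if "z \<in> carrier N" for z
    using that by (auto simp flip: sum)
  have "q \<in> module_hom R N (N\<lparr>carrier := N'\<rparr>)"
  proof (intro module_homI)
    fix z assume "z \<in> carrier N"
    then show "q z \<in> carrier (N\<lparr>carrier := N'\<rparr>)" using ex[of z] q by auto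
  next
    fix z z' assume "z \<in> carrier N" "z' \<in> carrier N"
    then obtain x y x' y' where xy: "x \<in> N'" "y \<in> N''" "z = x \<oplus>\<^bsub>N\<^esub> y" "x' \<in> N'" "y' \<in> N''" "z' = x' \<oplus>\<^bsub>N\<^esub> y'"
      using ex by meson
    then have "z \<oplus>\<^bsub>N\<^esub> z' = (x \<oplus>\<^bsub>N\<^esub> x') \<oplus>\<^bsub>N\<^esub> (y \<oplus>\<^bsub>N\<^esub> y')"
      using s by (simp add: subset_iff N.M.a_ac)
    then have "q (z \<oplus>\<^bsub>N\<^esub> z') = x \<oplus>\<^bsub>N\<^esub> x'"
      using q[of "x \<oplus>\<^bsub>N\<^esub> x'" "y \<oplus>\<^bsub>N\<^esub> y'"] xy submodule_add[OF N'] submodule_add[OF N''] by simp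
    with xy q show "q (z \<oplus>\<^bsub>N\<^esub> z') = q z \<oplus>\<^bsub>N\<lparr>carrier := N'\<rparr>\<^esub> q z'" by simp
  next
    fix r z assume r: "r \<in> carrier R" and "z \<in> carrier N"
    then obtain x y where xy: "x \<in> N'" "y \<in> N''" "z = x \<oplus>\<^bsub>N\<^esub> y"
      using ex by meson
    then have "r \<odot>\<^bsub>N\<^esub> z = r \<odot>\<^bsub>N\<^esub> x \<oplus>\<^bsub>N\<^esub> r \<odot>\<^bsub>N\<^esub> y"
      using s r by (simp add: N.smult_r_distr subset_iff)
    then show "q (r \<odot>\<^bsub>N\<^esub> z) = r \<odot>\<^bsub>N\<lparr>carrier := N'\<rparr>\<^esub> q z"
      using q xy submodule_smult[OF N' r] submodule_smult[OF N'' r] by simp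
  qed
  moreover have "q x = x" if "x \<in> N'" for x
    using q[of x "\<zero>\<^bsub>N\<^esub>"] submodule_zero[OF N''] that s by auto
  moreover have "inv_into (carrier M) f \<in> module_hom R (N\<lparr>carrier := N'\<rparr>) M"
    using module_hom_inverse[OF M f(1)] f(2) by simp
  moreover have "inv_into (carrier M) f (f x) = x" if "x \<in> carrier M" for x
    using that f(2) by (auto simp: bij_betw_def)
  ultimately show ?thesis
    using f s(1) module_hom_closed[OF f(1)]
    by (intro bexI[of _ f] bexI[of _ "\<lambda>x. inv_into (carrier M) f (q x)"])
       (auto intro: module_hom_expand module_hom_compose)
qed

text \<open>The complement is the kernel of \<open>p\<close>, through the decomposition z = s (p z)
  + (z - s (p z)).\<close>

lemma retract_imp_iso_direct_summand:
  assumes N: "left_module R N" and M: "left_module R M"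
    and s: "s \<in> module_hom R M N" and p: "p \<in> module_hom R N M"
    and ps: "\<And>x. x \<in> carrier M \<Longrightarrow> p (s x) = x"
  shows "iso_direct_summand R M N"
proof -
  interpret N: left_module R N by fact
  interpret M: left_module R M by fact
  have "s ` carrier M \<inter> a_kernel N M p = {\<zero>\<^bsub>N\<^esub>}"
    using ps module_hom_zero[OF M N s] module_hom_zero[OF N M p]
    by (auto simp: mem_a_kernel intro: image_eqI[of "\<zero>\<^bsub>N\<^esub>" s "\<zero>\<^bsub>M\<^esub>"])
  moreover have "\<exists>x y. z = x \<oplus>\<^bsub>N\<^esub> y \<and> x \<in> s ` carrier M \<and> y \<in> a_kernel N M p" if z: "z \<in> carrier N" for z
  proof (intro exI conjI)
    show "z = s (p z) \<oplus>\<^bsub>N\<^esub> (z \<ominus>\<^bsub>N\<^esub> s (p z))"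
      using s p z by (simp add: a_minus_def module_homD N.M.a_lcomm N.M.r_neg)
    show "s (p z) \<in> s ` carrier M" "z \<ominus>\<^bsub>N\<^esub> s (p z) \<in> a_kernel N M p"
      using s p z by (auto simp: mem_a_kernel module_homD module_hom_minus[OF N M p] ps)
  qed
  ultimately have "is_direct_summand R (s ` carrier M) N"
    unfolding is_direct_summand_def
    using submodule_image[OF M N s] submodule_kernel[OF N M p] module_homD(1)[OF s]
    by (intro conjI exI[of _ "a_kernel N M p"]) (auto simp: mem_a_kernel)
  moreover have "s \<in> module_iso R M (N\<lparr>carrier := s ` carrier M\<rparr>)"
    using module_hom_corestrict[OF s, of "s ` carrier M"] inj_on_inverseI[of "carrier M" p s] ps
    by (simp add: module_iso_def bij_betw_def)
  ultimately show ?thesis unfolding iso_direct_summand_def by blast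
qed

section \<open>Maps that factor through finite direct sums\<close>

text \<open>For the identity map this says that \<open>M\<close> lies in \<open>add T\<close>.\<close>

inductive factors :: "('r, 'k) ring_scheme \<Rightarrow> ('r, 't, 'e) module_scheme \<Rightarrow>
    ('r, 'm, 'f) module_scheme \<Rightarrow> ('r, 'n, 'g) module_scheme \<Rightarrow> ('m \<Rightarrow> 'n) \<Rightarrow> bool"
  for R T M N where
  zero: "(\<And>x. x \<in> carrier M \<Longrightarrow> f x = \<zero>\<^bsub>N\<^esub>) \<Longrightarrow> factors R T M N f"
| step: "\<lbrakk>factors R T M N f; s \<in> module_hom R M T; p \<in> module_hom R T N;
    \<And>x. x \<in> carrier M \<Longrightarrow> g x = f x \<oplus>\<^bsub>N\<^esub> p (s x)\<rbrakk> \<Longrightarrow> factors R T M N g"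

lemma factors_hom:
  assumes "left_module R M" "left_module R N" "factors R T M N f"
  shows "f \<in> module_hom R M N"
  using assms(3)
proof induction
  case (zero f)
  then show ?case
    by (intro module_hom_cong[OF module_hom_zero_map[OF assms(2)] assms(1)])
next
  case (step f s p g)
  then show ?case
    by (intro module_hom_cong[OF module_hom_plus[OF assms(2) step(5) module_hom_compose[OF step(2,3)]] assms(1)])
qed

text \<open>Both introduction rules prescribe values on the carrier only, so the behaviour of a map
  outside it never matters.\<close>

lemma factors_cong:
  assumes "factors R T M N f" "\<And>x. x \<in> carrier M \<Longrightarrow> g x = f x"
  shows "factors R T M N g"
  using assms by cases (auto intro: factors.intros)

lemma factors_plus:
  assumes "left_module R M" "left_module R N" "factors R T M N f" "factors R T M N g"
  shows "factors R T M N (\<lambda>x. f x \<oplus>\<^bsub>N\<^esub> g x)"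
proof -
  interpret N: left_module R N by fact
  note f = factors_hom[OF assms(1-3)]
  from assms(4) show ?thesis
  proof induction
    case (zero g)
    then show ?case
      using module_hom_closed[OF f] by (intro factors_cong[OF assms(3)]) auto
  next
    case (step g s p h)
    show ?case
      using module_hom_closed[OF f] module_hom_closed[OF factors_hom[OF assms(1,2) step(1)]]
        module_hom_closed[OF module_hom_compose[OF step(2,3)]]
      by (intro factors.step[OF step(5,2,3)]) (simp add: step(4) N.M.a_assoc)
  qed
qed

lemma factors_single:
  assumes "left_module R M" "left_module R N" "s \<in> module_hom R M T" "p \<in> module_hom R T N"
  shows "factors R T M N (\<lambda>x. p (s x))"
proof -
  interpret N: left_module R N by fact
  show ?thesis
    using module_hom_closed[OF module_hom_compose[OF assms(3,4)]]
    by (intro factors.step[OF factors.zero[of M "\<lambda>x. \<zero>\<^bsub>N\<^esub>"] assms(3,4)]) auto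
qed

lemma factors_compose_left:
  assumes M: "left_module R M" and N: "left_module R N" and L: "left_module R L"
    and "factors R T M N f" and h: "h \<in> module_hom R N L"
  shows "factors R T M L (\<lambda>x. h (f x))"
  using assms(4)
proof induction
  case (zero f)
  then show ?case using module_hom_zero[OF N L h] by (intro factors.zero) simp
next
  case (step f s p g)
  show ?case
    using module_hom_closed[OF factors_hom[OF M N step(1)]]
      module_hom_closed[OF module_hom_compose[OF step(2,3)]]
    by (intro factors.step[OF step(5,2) module_hom_compose[OF step(3) h]])
      (simp add: step(4) module_hom_add[OF h])
qed

lemma factors_compose_right:
  assumes "factors R T M N f" and k: "k \<in> module_hom R K M"
  shows "factors R T K N (\<lambda>x. f (k x))"
  using assms(1)
proof induction
  case (zero f)
  then show ?case using module_hom_closed[OF k] by (intro factors.zero) simp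
next
  case (step f s p g)
  show ?case
    using module_hom_closed[OF k]
    by (intro factors.step[OF step(5) module_hom_compose[OF k step(2)] step(3)]) (simp add: step(4))
qed

text \<open>Transitivity of add: each summand \<open>p (s x)\<close> through \<open>N\<close> has
  the identity of \<open>N\<close> inserted between \<open>s\<close> and \<open>p\<close>, and that
  identity is a sum of maps through \<open>T\<close>.\<close>

lemma factors_trans:
  assumes M: "left_module R M" and N: "left_module R N" and L: "left_module R L"
    and "factors R N M L f" and T: "factors R T N N (\<lambda>x. x)"
  shows "factors R T M L f"
  using assms(4)
proof induction
  case (zero f)
  then show ?case by (intro factors.zero)
next
  case (step f s p g)
  show ?case
    by (rule factors_cong[OF factors_plus[OF M L step(5)
            factors_compose_left[OF M N L factors_compose_right[OF T step(2)] step(3)]]])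
      (auto simp: step(4))
qed

section \<open>Finite powers of a module and the class add\<close>

lemma direct_sum_copies_simps:
  "f \<in> carrier (direct_sum_copies M X) \<longleftrightarrow> f \<in> X \<rightarrow>\<^sub>E carrier M \<and> finite {x \<in> X. f x \<noteq> \<zero>\<^bsub>M\<^esub>}"
  "\<zero>\<^bsub>direct_sum_copies M X\<^esub> = (\<lambda>x\<in>X. \<zero>\<^bsub>M\<^esub>)"
  "f \<oplus>\<^bsub>direct_sum_copies M X\<^esub> g = (\<lambda>x\<in>X. f x \<oplus>\<^bsub>M\<^esub> g x)"
  "r \<odot>\<^bsub>direct_sum_copies M X\<^esub> f = (\<lambda>x\<in>X. r \<odot>\<^bsub>M\<^esub> f x)"
  by (auto simp: direct_sum_copies_def)

lemma direct_sum_copies_proj: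
  "i \<in> X \<Longrightarrow> (\<lambda>f. f i) \<in> module_hom R (direct_sum_copies M X) M"
  by (intro module_homI) (auto simp: direct_sum_copies_simps PiE_iff)

lemma direct_sum_copies_inj:
  assumes "left_module R M" "i \<in> X"
  shows "(\<lambda>m. \<lambda>x\<in>X. if x = i then m else \<zero>\<^bsub>M\<^esub>) \<in> module_hom R M (direct_sum_copies M X)"
proof -
  interpret left_module R M by fact
  have "finite {x \<in> X. (if x = i then m else \<zero>\<^bsub>M\<^esub>) \<noteq> \<zero>\<^bsub>M\<^esub>}" for m
    by (rule finite_subset[of _ "{i}"]) (auto split: if_splits)
  then show ?thesis
    using assms(2) by (intro module_homI) (auto simp: direct_sum_copies_simps cong: conj_cong)
qed

text \<open>Truncation to \<open>Y\<close> is the sum over \<open>Y\<close> of injection after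
  projection. With \<open>Y\<close> equal to a finite \<open>X\<close> it is the identity of a
  finite power; with \<open>X\<close> infinite it isolates the finitely many coordinates that a
  finitely generated module uses.\<close>

lemma factors_truncate:
  assumes M: "left_module R M" and "finite Y" "Y \<subseteq> X"
  shows "factors R M (direct_sum_copies M X) (direct_sum_copies M X)
    (\<lambda>f. \<lambda>x\<in>X. if x \<in> Y then f x else \<zero>\<^bsub>M\<^esub>)"
proof -
  interpret left_module R M by fact
  show ?thesis
    using assms(2,3)
  proof induction
    case empty
    then show ?case by (intro factors.zero) (auto simp: direct_sum_copies_simps restrict_def)
  next
    case (insert y Y)
    then have y: "y \<in> X" "y \<notin> Y" "Y \<subseteq> X" by auto
    show ?case
      using y
      by (intro factors.step[OF insert(3)[OF y(3)] direct_sum_copies_proj[OF y(1)] direct_sum_copies_inj[OF M y(1)]])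
        (auto simp: direct_sum_copies_simps PiE_iff intro!: restrict_ext)
  qed
qed

text \<open>The exponent counts the \<open>step\<close> rules in the derivation; each of them
  contributes one more coordinate.\<close>

lemma factors_imp_power:
  assumes M: "left_module R M" and N: "left_module R N" and T: "left_module R T"
    and "factors R T M N f"
  shows "\<exists>(n::nat) s p. s \<in> module_hom R M (direct_sum_copies T {..<n}) \<and>
    p \<in> module_hom R (direct_sum_copies T {..<n}) N \<and> (\<forall>x\<in>carrier M. f x = p (s x))"
  using assms(4)
proof induction
  interpret T: left_module R T by fact
  interpret N: left_module R N by fact
  case (zero f)
  have "(\<lambda>x. \<zero>\<^bsub>direct_sum_copies T {..<0::nat}\<^esub>) \<in> module_hom R M (direct_sum_copies T {..<0})"
    by (intro module_hom_zero_map T.direct_sum_copies_left_module)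
  then show ?case
    using zero module_hom_zero_map[OF N, of "direct_sum_copies T {..<0::nat}"] by blast
next
  interpret T: left_module R T by fact
  interpret N: left_module R N by fact
  case (step f s0 p0 g)
  then obtain n :: nat and s p where s: "s \<in> module_hom R M (direct_sum_copies T {..<n})"
    and p: "p \<in> module_hom R (direct_sum_copies T {..<n}) N"
    and f: "\<And>x. x \<in> carrier M \<Longrightarrow> f x = p (s x)" by blast
  interpret D: left_module R "direct_sum_copies T {..<Suc n}" by (rule T.direct_sum_copies_left_module)
  \<comment> \<open>The new map into \<open>T\<close> occupies coordinate \<open>n\<close>, and
    \<open>?r\<close> forgets that coordinate again.\<close>
  let ?s = "\<lambda>x. \<lambda>i\<in>{..<Suc n}. if i < n then s x i else s0 x"
  let ?r = "\<lambda>y. \<lambda>i\<in>{..<n}. y i"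
  have s': "?s \<in> module_hom R M (direct_sum_copies T {..<Suc n})"
    using module_homD[OF s] module_homD[OF step(2)]
    by (intro module_homI) (auto simp: direct_sum_copies_simps PiE_iff intro!: restrict_ext)
  have r: "?r \<in> module_hom R (direct_sum_copies T {..<Suc n}) (direct_sum_copies T {..<n})"
    by (intro module_homI) (auto simp: direct_sum_copies_simps PiE_iff intro!: restrict_ext)
  have q: "(\<lambda>y. y n) \<in> module_hom R (direct_sum_copies T {..<Suc n}) T"
    by (intro direct_sum_copies_proj) simp
  have rs: "?r (?s x) = s x" if "x \<in> carrier M" for x
    using module_hom_closed[OF s that]
    by (auto simp: direct_sum_copies_simps PiE_iff intro!: extensionalityI[of _ "{..<n}"])
  have "g x = p (?r (?s x)) \<oplus>\<^bsub>N\<^esub> p0 (?s x n)" if "x \<in> carrier M" for x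
    unfolding rs[OF that] step(4)[OF that] f[OF that] by simp
  with s' module_hom_plus[OF N module_hom_compose[OF r p] module_hom_compose[OF q step(3)]]
  show ?case by blast
qed

text \<open>The bridge between summands of finite powers and the inductive predicate; membership in
  add is manipulated on the right-hand side and translated back only when a sequence is
  delivered.\<close>

lemma in_add_iff_factors:
  assumes T: "left_module R T"
  shows "in_add R T M \<longleftrightarrow> left_module R M \<and> factors R T M M (\<lambda>x. x)"
proof -
  interpret T: left_module R T by fact
  note D = T.direct_sum_copies_left_module
  show ?thesis
  proof (intro iffI conjI)
    assume a: "in_add R T M"
    then show M: "left_module R M" by (simp add: in_add_def)
    from a obtain n :: nat where "iso_direct_summand R M (direct_sum_copies T {..<n})"
      by (auto simp: in_add_def)
    from iso_direct_summand_imp_retract[OF D M this]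
    obtain s p where s: "s \<in> module_hom R M (direct_sum_copies T {..<n})"
      and p: "p \<in> module_hom R (direct_sum_copies T {..<n}) M"
      and ps: "\<And>x. x \<in> carrier M \<Longrightarrow> p (s x) = x" by blast
    have "factors R T (direct_sum_copies T {..<n}) (direct_sum_copies T {..<n}) (\<lambda>x. x)"
      by (rule factors_cong[OF factors_truncate[OF T, of "{..<n}"]])
        (auto simp: direct_sum_copies_simps PiE_iff intro!: extensionalityI[of _ "{..<n}"])
    from factors_compose_left[OF M D M factors_compose_right[OF this s] p]
    show "factors R T M M (\<lambda>x. x)" by (rule factors_cong) (simp add: ps)
  next
    assume a: "left_module R M \<and> factors R T M M (\<lambda>x. x)"
    then obtain n :: nat and s p where "s \<in> module_hom R M (direct_sum_copies T {..<n})"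
      "p \<in> module_hom R (direct_sum_copies T {..<n}) M" "\<And>x. x \<in> carrier M \<Longrightarrow> x = p (s x)"
      using factors_imp_power[of R M M T "\<lambda>x. x"] T by blast
    then show "in_add R T M"
      unfolding in_add_def using a
      by (intro conjI exI[of _ n] retract_imp_iso_direct_summand[OF D, of M s _ p]) auto
  qed
qed

section \<open>Biproducts on a fixed element type\<close>

definition product_module :: "('r, 'm, 'e) module_scheme \<Rightarrow> ('r, 'n, 'f) module_scheme \<Rightarrow> ('r, 'm \<times> 'n) module"
  where "product_module M N = \<lparr>carrier = carrier M \<times> carrier N, mult = undefined, one = undefined,
    ring.zero = (\<zero>\<^bsub>M\<^esub>, \<zero>\<^bsub>N\<^esub>), add = (\<lambda>x y. (fst x \<oplus>\<^bsub>M\<^esub> fst y, snd x \<oplus>\<^bsub>N\<^esub> snd y)),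
    smult = (\<lambda>r x. (r \<odot>\<^bsub>M\<^esub> fst x, r \<odot>\<^bsub>N\<^esub> snd x))\<rparr>"

lemma product_module_left_module:
  assumes "left_module R M" "left_module R N"
  shows "left_module R (product_module M N)"
proof -
  interpret M: left_module R M by fact
  interpret N: left_module R N by fact
  have "\<exists>y\<in>carrier (product_module M N). y \<oplus>\<^bsub>product_module M N\<^esub> x = \<zero>\<^bsub>product_module M N\<^esub>"
    if "x \<in> carrier (product_module M N)" for x
    using that by (intro bexI[of _ "(\<ominus>\<^bsub>M\<^esub> fst x, \<ominus>\<^bsub>N\<^esub> snd x)"])
      (auto simp: product_module_def M.M.l_neg N.M.l_neg)
  then show ?thesis
    by (intro left_moduleI abelian_groupI M.R.ring_axioms)
      (auto simp: product_module_def M.M.a_ac N.M.a_ac M.smult_l_distr N.smult_l_distr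
        M.smult_r_distr N.smult_r_distr M.smult_assoc1 N.smult_assoc1)
qed

text \<open>Wakamatsu tilting asks for modules whose elements are functions from \<open>nat\<close>
  to the elements of \<open>T\<close>. The image of a split embedding into a finite power of
  \<open>T\<close> is an isomorphic copy of that kind.\<close>

lemma factors_id_realize:
  fixes M :: "('r, 'm, 'e) module_scheme" and T :: "('r, 't, 'f) module_scheme"
  assumes M: "left_module R M" and T: "left_module R T" and f: "factors R T M M (\<lambda>x. x)"
  shows "\<exists>(D :: ('r, nat \<Rightarrow> 't) module) i q. in_add R T D \<and> i \<in> module_hom R M D \<and>
    q \<in> module_hom R D M \<and> (\<forall>x\<in>carrier M. q (i x) = x) \<and> (\<forall>y\<in>carrier D. i (q y) = y)"
proof -
  interpret T: left_module R T by fact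
  note P = T.direct_sum_copies_left_module
  obtain n :: nat and s p where s: "s \<in> module_hom R M (direct_sum_copies T {..<n})"
    and p: "p \<in> module_hom R (direct_sum_copies T {..<n}) M"
    and ps: "\<And>x. x \<in> carrier M \<Longrightarrow> p (s x) = x"
    using factors_imp_power[OF M M T f] by metis
  let ?D = "(direct_sum_copies T {..<n})\<lparr>carrier := s ` carrier M\<rparr>"
  have D: "left_module R ?D"
    by (intro submodule_left_module[OF P] submodule_image[OF M P s])
  have i: "s \<in> module_hom R M ?D"
    using s by (intro module_hom_corestrict) auto
  have q: "p \<in> module_hom R ?D M"
    using module_hom_closed[OF s] by (intro module_hom_restrict[OF p]) auto
  have "factors R T ?D ?D (\<lambda>x. x)"
    by (rule factors_cong[OF factors_compose_left[OF D M D factors_compose_right[OF f q] i]])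
      (auto simp: ps)
  then have "in_add R T ?D"
    using D in_add_iff_factors[OF T] by blast
  with i q show ?thesis by (intro exI[of _ ?D] exI[of _ s] exI[of _ p]) (auto simp: ps)
qed

text \<open>The direct sum of \<open>M\<close> and \<open>N\<close> given by its structure maps but
  realised on functions from \<open>nat\<close>, so that forming it repeatedly does not change the
  element type. For \<open>T\<close> the regular module it yields finitely generated
  projectives.\<close>

lemma biproduct_in_add:
  fixes M :: "('r, 'm, 'e) module_scheme" and N :: "('r, 'n, 'g) module_scheme"
    and T :: "('r, 't, 'f) module_scheme"
  assumes M: "left_module R M" and N: "left_module R N" and T: "left_module R T"
    and fM: "factors R T M M (\<lambda>x. x)" and fN: "factors R T N N (\<lambda>x. x)"
  shows "\<exists>(D :: ('r, nat \<Rightarrow> 't) module) i j p q. in_add R T D \<and>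
    i \<in> module_hom R M D \<and> j \<in> module_hom R N D \<and> p \<in> module_hom R D M \<and> q \<in> module_hom R D N \<and>
    (\<forall>x\<in>carrier M. p (i x) = x \<and> q (i x) = \<zero>\<^bsub>N\<^esub>) \<and> (\<forall>y\<in>carrier N. p (j y) = \<zero>\<^bsub>M\<^esub> \<and> q (j y) = y) \<and>
    (\<forall>z\<in>carrier D. i (p z) \<oplus>\<^bsub>D\<^esub> j (q z) = z)"
proof -
  interpret M: left_module R M by fact
  interpret N: left_module R N by fact
  let ?P = "product_module M N"
  note P = product_module_left_module[OF M N]
  have i: "(\<lambda>x. (x, \<zero>\<^bsub>N\<^esub>)) \<in> module_hom R M ?P" and j: "(\<lambda>y. (\<zero>\<^bsub>M\<^esub>, y)) \<in> module_hom R N ?P"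
    and p: "fst \<in> module_hom R ?P M" and q: "snd \<in> module_hom R ?P N"
    by (auto intro!: module_homI simp: product_module_def)
  have "factors R T ?P ?P (\<lambda>x. (fst x, \<zero>\<^bsub>N\<^esub>) \<oplus>\<^bsub>?P\<^esub> (\<zero>\<^bsub>M\<^esub>, snd x))"
    using factors_compose_left[OF P M P factors_compose_right[OF fM p] i]
      factors_compose_left[OF P N P factors_compose_right[OF fN q] j]
    by (rule factors_plus[OF P P])
  then have "factors R T ?P ?P (\<lambda>x. x)"
    by (rule factors_cong) (auto simp: product_module_def)
  from factors_id_realize[OF P T this]
  obtain D :: "('r, nat \<Rightarrow> 't) module" and f g where D: "in_add R T D"
    and f: "f \<in> module_hom R ?P D" and g: "g \<in> module_hom R D ?P"
    and gf: "\<And>x. x \<in> carrier ?P \<Longrightarrow> g (f x) = x" and fg: "\<And>y. y \<in> carrier D \<Longrightarrow> f (g y) = y"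
    by blast
  have in_P: "(x, y) \<in> carrier ?P" if "x \<in> carrier M" "y \<in> carrier N" for x y
    using that by (simp add: product_module_def)
  have "f (fst (g z), \<zero>\<^bsub>N\<^esub>) \<oplus>\<^bsub>D\<^esub> f (\<zero>\<^bsub>M\<^esub>, snd (g z)) = z" if "z \<in> carrier D" for z
  proof -
    have "g z \<in> carrier ?P" using module_hom_closed[OF g that] .
    then have gz: "fst (g z) \<in> carrier M" "snd (g z) \<in> carrier N" by (auto simp: product_module_def)
    then have "f (fst (g z), \<zero>\<^bsub>N\<^esub>) \<oplus>\<^bsub>D\<^esub> f (\<zero>\<^bsub>M\<^esub>, snd (g z)) =
        f ((fst (g z), \<zero>\<^bsub>N\<^esub>) \<oplus>\<^bsub>?P\<^esub> (\<zero>\<^bsub>M\<^esub>, snd (g z)))"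
      by (simp add: module_hom_add[OF f] in_P)
    also have "(fst (g z), \<zero>\<^bsub>N\<^esub>) \<oplus>\<^bsub>?P\<^esub> (\<zero>\<^bsub>M\<^esub>, snd (g z)) = g z"
      using gz by (simp add: product_module_def)
    finally show ?thesis using fg that by simp
  qed
  then show ?thesis
    using D module_hom_compose[OF i f] module_hom_compose[OF j f] module_hom_compose[OF g p]
      module_hom_compose[OF g q]
    by (intro exI[of _ D] exI[of _ "\<lambda>x. f (x, \<zero>\<^bsub>N\<^esub>)"] exI[of _ "\<lambda>y. f (\<zero>\<^bsub>M\<^esub>, y)"]
        exI[of _ "\<lambda>z. fst (g z)"] exI[of _ "\<lambda>z. snd (g z)"])
      (simp add: gf in_P)
qed

section \<open>Projective modules\<close>

abbreviation free_module :: "('r, 'k) ring_scheme \<Rightarrow> 'x set \<Rightarrow> ('r, 'x \<Rightarrow> 'r) module"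
  where "free_module R X \<equiv> direct_sum_copies (regular_module R) X"

definition unit_vector :: "('r, 'k) ring_scheme \<Rightarrow> 'x set \<Rightarrow> 'x \<Rightarrow> 'x \<Rightarrow> 'r"
  where "unit_vector R X x = (\<lambda>y\<in>X. if y = x then \<one>\<^bsub>R\<^esub> else \<zero>\<^bsub>R\<^esub>)"

lemma regular_module_simps [simp]:
  "carrier (regular_module R) = carrier R" "\<zero>\<^bsub>regular_module R\<^esub> = \<zero>\<^bsub>R\<^esub>"
  "x \<oplus>\<^bsub>regular_module R\<^esub> y = x \<oplus>\<^bsub>R\<^esub> y" "r \<odot>\<^bsub>regular_module R\<^esub> x = r \<otimes>\<^bsub>R\<^esub> x"
  by (simp_all add: regular_module_def)

lemma free_module_left_module: "ring R \<Longrightarrow> left_module R (free_module R X)"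
  using left_module_regular by (rule left_module.direct_sum_copies_left_module)

lemma unit_vector_closed:
  assumes "ring R" "x \<in> X"
  shows "unit_vector R X x \<in> carrier (free_module R X)"
proof -
  interpret ring R by fact
  show ?thesis
    using module_hom_closed[OF direct_sum_copies_inj[OF left_module_regular[OF assms(1)] assms(2)], of "\<one>\<^bsub>R\<^esub>"]
    unfolding regular_module_simps unit_vector_def by blast
qed

lemma free_module_hom_exists:
  assumes Q: "left_module R Q" and q: "\<And>x. x \<in> X \<Longrightarrow> q x \<in> carrier Q"
  shows "\<exists>h \<in> module_hom R (free_module R X) Q. \<forall>x\<in>X. h (unit_vector R X x) = q x"
proof -
  interpret left_module R Q by fact
  let ?D = "free_module R X"
  interpret D: left_module R ?D using R.ring_axioms by (rule free_module_left_module)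
  define S where "S f = {x \<in> X. f x \<noteq> \<zero>\<^bsub>R\<^esub>}" for f
  define g where "g f = (\<Oplus>\<^bsub>Q\<^esub>x\<in>S f. f x \<odot>\<^bsub>Q\<^esub> q x)" for f
  have D: "f \<in> carrier ?D \<longleftrightarrow> f \<in> X \<rightarrow>\<^sub>E carrier R \<and> finite (S f)" for f
    by (simp add: direct_sum_copies_simps S_def)
  \<comment> \<open>The sum over the support may be taken over any larger finite index set; this
    lets two elements be compared on the union of their supports.\<close>
  have g: "g f = (\<Oplus>\<^bsub>Q\<^esub>x\<in>V. f x \<odot>\<^bsub>Q\<^esub> q x)"
    if "f \<in> carrier ?D" "finite V" "S f \<subseteq> V" "V \<subseteq> X" for f V
    unfolding g_def using that q
    by (intro M.add.finprod_mono_neutral_cong_left) (auto simp: D S_def PiE_iff Pi_iff)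
  have "g \<in> module_hom R ?D Q"
  proof (intro module_homI)
    fix f assume "f \<in> carrier ?D"
    then show "g f \<in> carrier Q"
      unfolding g_def using q by (intro M.finsum_closed) (auto simp: D S_def PiE_iff)
  next
    fix f f' assume f: "f \<in> carrier ?D" "f' \<in> carrier ?D"
    let ?V = "S f \<union> S f'"
    have V: "finite ?V" "?V \<subseteq> X" using f by (auto simp: D S_def)
    have s: "(f \<oplus>\<^bsub>?D\<^esub> f') x = f x \<oplus>\<^bsub>R\<^esub> f' x" if "x \<in> X" for x
      using that by (simp add: direct_sum_copies_simps)
    have c: "f x \<in> carrier R" "f' x \<in> carrier R" if "x \<in> X" for x
      using f that by (auto simp: D PiE_iff)
    have "S (f \<oplus>\<^bsub>?D\<^esub> f') \<subseteq> ?V"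
      by (auto simp: S_def s)
    then have "g (f \<oplus>\<^bsub>?D\<^esub> f') = (\<Oplus>\<^bsub>Q\<^esub>x\<in>?V. (f \<oplus>\<^bsub>?D\<^esub> f') x \<odot>\<^bsub>Q\<^esub> q x)"
      using f V by (intro g) auto
    also have "\<dots> = (\<Oplus>\<^bsub>Q\<^esub>x\<in>?V. f x \<odot>\<^bsub>Q\<^esub> q x \<oplus>\<^bsub>Q\<^esub> f' x \<odot>\<^bsub>Q\<^esub> q x)"
      using c V q by (intro M.finsum_cong') (auto simp: s smult_l_distr subset_iff)
    also have "\<dots> = g f \<oplus>\<^bsub>Q\<^esub> g f'"
      using f c V q by (subst M.finsum_addf) (auto simp: g[of f ?V] g[of f' ?V] subset_iff)
    finally show "g (f \<oplus>\<^bsub>?D\<^esub> f') = g f \<oplus>\<^bsub>Q\<^esub> g f'" .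
  next
    fix r f assume f: "r \<in> carrier R" "f \<in> carrier ?D"
    have V: "finite (S f)" "S f \<subseteq> X" using f by (auto simp: D S_def)
    have s: "(r \<odot>\<^bsub>?D\<^esub> f) x = r \<otimes>\<^bsub>R\<^esub> f x" if "x \<in> X" for x
      using that by (simp add: direct_sum_copies_simps)
    have c: "f x \<in> carrier R" if "x \<in> X" for x
      using f that by (auto simp: D PiE_iff)
    have "S (r \<odot>\<^bsub>?D\<^esub> f) \<subseteq> S f"
      using f by (auto simp: S_def s)
    then have "g (r \<odot>\<^bsub>?D\<^esub> f) = (\<Oplus>\<^bsub>Q\<^esub>x\<in>S f. (r \<odot>\<^bsub>?D\<^esub> f) x \<odot>\<^bsub>Q\<^esub> q x)"
      using f V by (intro g) auto
    also have "\<dots> = (\<Oplus>\<^bsub>Q\<^esub>x\<in>S f. r \<odot>\<^bsub>Q\<^esub> (f x \<odot>\<^bsub>Q\<^esub> q x))"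
      using f c V q by (intro M.finsum_cong') (auto simp: s smult_assoc1 subset_iff)
    also have "\<dots> = r \<odot>\<^bsub>Q\<^esub> g f"
      unfolding g_def using f c V q by (subst finsum_smult) (auto simp: subset_iff)
    finally show "g (r \<odot>\<^bsub>?D\<^esub> f) = r \<odot>\<^bsub>Q\<^esub> g f" .
  qed
  moreover have "g (unit_vector R X x) = q x" if "x \<in> X" for x
    using that q unit_vector_closed[OF R.ring_axioms that]
    by (subst g[of _ "{x}"]) (auto simp: S_def unit_vector_def split: if_splits)
  ultimately show ?thesis by blast
qed

text \<open>An element is its truncation to its finite support, and a truncation grows from zero by
  one multiple of a unit vector at a time.\<close>

lemma free_module_hom_eq:
  assumes M: "left_module R M" and h: "h \<in> module_hom R (free_module R X) M"
    and k: "k \<in> module_hom R (free_module R X) M"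
    and eq: "\<And>x. x \<in> X \<Longrightarrow> h (unit_vector R X x) = k (unit_vector R X x)"
    and f: "f \<in> carrier (free_module R X)"
  shows "h f = k f"
proof -
  interpret left_module R M by fact
  let ?D = "free_module R X"
  note D = free_module_left_module[OF R.ring_axioms]
  interpret D: left_module R ?D by (rule D)
  let ?t = "\<lambda>Y. \<lambda>x\<in>X. if x \<in> Y then f x else \<zero>\<^bsub>R\<^esub>"
  have fc: "f x \<in> carrier R" if "x \<in> X" for x
    using f that by (auto simp: direct_sum_copies_simps PiE_iff)
  have *: "?t Y \<in> carrier ?D \<and> h (?t Y) = k (?t Y)" if "finite Y" "Y \<subseteq> X" for Y
    using that
  proof induction
    case empty
    have "?t {} = \<zero>\<^bsub>?D\<^esub>" by (auto simp: direct_sum_copies_simps)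
    then show ?case
      using module_hom_zero[OF D M h] module_hom_zero[OF D M k] D.M.zero_closed by metis
  next
    case (insert y Y)
    then have y: "y \<in> X" and IH: "?t Y \<in> carrier ?D" "h (?t Y) = k (?t Y)" by blast+
    note u = unit_vector_closed[OF R.ring_axioms y]
    have t: "?t (insert y Y) = ?t Y \<oplus>\<^bsub>?D\<^esub> f y \<odot>\<^bsub>?D\<^esub> unit_vector R X y"
      using insert(2) fc fc[OF y] by (auto simp: unit_vector_def direct_sum_copies_simps intro!: restrict_ext)
    show ?case
      unfolding t using IH u fc[OF y] eq[OF y]
      by (simp only: module_homD[OF h] module_homD[OF k] D.smult_closed D.M.a_closed simp_thms)
  qed
  let ?S = "{x \<in> X. f x \<noteq> \<zero>\<^bsub>R\<^esub>}"
  have "h (?t ?S) = k (?t ?S)"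
    using *[of ?S] f unfolding direct_sum_copies_simps regular_module_simps by blast
  moreover have "?t ?S = f"
    using f by (auto simp: direct_sum_copies_simps PiE_iff intro!: extensionalityI[of _ X])
  ultimately show ?thesis by (simp only:)
qed

section \<open>Lifting and finite generation\<close>

lemma projective_left_module: "projective R P \<Longrightarrow> left_module R P"
  by (simp add: projective_def)

text \<open>Preimages are chosen for the images of the unit vectors of a free module that retracts
  onto \<open>P\<close>; the resulting map on the free module is then composed with the embedding
  \<open>s\<close>.\<close>

lemma projective_lift:
  fixes P :: "('r, 'p, 'e) module_scheme"
  assumes P: "projective R P" and Q: "left_module R Q" and M: "left_module R M"
    and b: "b \<in> module_hom R Q M" "b ` carrier Q = carrier M" and f: "f \<in> module_hom R P M"
  shows "\<exists>g \<in> module_hom R P Q. \<forall>x\<in>carrier P. b (g x) = f x"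
proof -
  interpret M: left_module R M by fact
  from P obtain X :: "'p set" where PL: "left_module R P" and iX: "iso_direct_summand R P (free_module R X)"
    by (auto simp: projective_def)
  note F = free_module_left_module[OF M.R.ring_axioms]
  from iso_direct_summand_imp_retract[OF F PL iX]
  obtain s p where s: "s \<in> module_hom R P (free_module R X)" and p: "p \<in> module_hom R (free_module R X) P"
    and ps: "\<And>x. x \<in> carrier P \<Longrightarrow> p (s x) = x" by blast
  note fp = module_hom_compose[OF p f]
  have "\<forall>x\<in>X. \<exists>y\<in>carrier Q. b y = f (p (unit_vector R X x))"
  proof
    fix x assume "x \<in> X"
    then have "f (p (unit_vector R X x)) \<in> b ` carrier Q"
      unfolding b(2) by (intro module_hom_closed[OF fp] unit_vector_closed[OF M.R.ring_axioms])
    then show "\<exists>y\<in>carrier Q. b y = f (p (unit_vector R X x))" by (elim imageE, intro bexI) (erule sym)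
  qed
  then obtain q where q: "\<And>x. x \<in> X \<Longrightarrow> q x \<in> carrier Q" "\<And>x. x \<in> X \<Longrightarrow> b (q x) = f (p (unit_vector R X x))"
    by metis
  have "\<exists>h \<in> module_hom R (free_module R X) Q. \<forall>x\<in>X. h (unit_vector R X x) = q x"
    using Q q(1) by (rule free_module_hom_exists)
  then obtain h where h: "h \<in> module_hom R (free_module R X) Q" "\<And>x. x \<in> X \<Longrightarrow> h (unit_vector R X x) = q x"
    by (elim bexE) simp
  have "b (h y) = f (p y)" if "y \<in> carrier (free_module R X)" for y
    by (rule free_module_hom_eq[OF M module_hom_compose[OF h(1) b(1)] fp _ that]) (simp only: h q)
  then have "\<forall>x\<in>carrier P. b (h (s x)) = f x"
    using module_hom_closed[OF s] ps by simp
  then show ?thesis by (intro bexI[OF _ module_hom_compose[OF s h(1)]])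
qed

text \<open>Lifting without a basis: a summand \<open>p (s x)\<close> equals \<open>s x\<close>
  times \<open>p \<one>\<close>, so it lifts through any preimage of
  \<open>p \<one>\<close>.\<close>

lemma factors_regular_lift:
  assumes Q: "left_module R Q" and P: "left_module R P" and M: "left_module R M"
    and b: "b \<in> module_hom R Q M" "b ` carrier Q = carrier M"
    and "factors R (regular_module R) P M f"
  shows "\<exists>g \<in> module_hom R P Q. \<forall>x\<in>carrier P. b (g x) = f x"
  using assms(6)
proof induction
  case (zero f)
  then show ?case
    using module_hom_zero[OF Q M b(1)] by (intro bexI[OF _ module_hom_zero_map[OF Q]]) simp
next
  interpret Q: left_module R Q by (rule Q)
  interpret M: left_module R M by (rule M)
  case (step f s p f')
  then obtain g where g: "g \<in> module_hom R P Q" "\<And>x. x \<in> carrier P \<Longrightarrow> b (g x) = f x" by blast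
  have "p \<one>\<^bsub>R\<^esub> \<in> b ` carrier Q" using module_hom_closed[OF step(3)] by (simp add: b(2))
  then obtain q where q: "q \<in> carrier Q" "b q = p \<one>\<^bsub>R\<^esub>" by (metis imageE)
  have "(\<lambda>r. r \<odot>\<^bsub>Q\<^esub> q) \<in> module_hom R (regular_module R) Q"
    using q(1) by (intro module_homI) (auto simp: Q.smult_l_distr Q.smult_assoc1)
  from module_hom_compose[OF step(2) this] have sq: "(\<lambda>x. s x \<odot>\<^bsub>Q\<^esub> q) \<in> module_hom R P Q" .
  have "b (g x \<oplus>\<^bsub>Q\<^esub> s x \<odot>\<^bsub>Q\<^esub> q) = f' x" if x: "x \<in> carrier P" for x
  proof -
    have "s x \<in> carrier R" using module_hom_closed[OF step(2) x] by simp
    then show ?thesis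
      using x q module_hom_smult[OF step(3), of "\<one>\<^bsub>R\<^esub>" "s x"] module_hom_closed[OF g(1) x]
      by (simp add: module_homD[OF b(1)] g step(4))
  qed
  then show ?case by (intro bexI[OF _ module_hom_plus[OF Q g(1) sq]]) simp
qed

text \<open>The definition of \<open>projective\<close> wants a basis set in the element type of
  \<open>P\<close>, whereas \<open>factors\<close> provides finite powers of the ring. Splitting the
  cover by the free module on \<open>carrier P\<close> produces a basis of the required
  type.\<close>

lemma factors_regular_projective:
  assumes P: "left_module R P" and f: "factors R (regular_module R) P P (\<lambda>x. x)"
  shows "projective R P"
proof -
  interpret P: left_module R P by fact
  note F = free_module_left_module[OF P.R.ring_axioms]
  obtain g where g: "g \<in> module_hom R (free_module R (carrier P)) P"
    "g ` carrier (free_module R (carrier P)) = carrier P"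
    using free_cover[OF P] by blast
  from factors_regular_lift[OF F P P g f] obtain s where
    "s \<in> module_hom R P (free_module R (carrier P))" "\<And>x. x \<in> carrier P \<Longrightarrow> g (s x) = x" by blast
  from retract_imp_iso_direct_summand[OF F P this(1) g(1), OF this(2)]
  show ?thesis using P unfolding projective_def by blast
qed

text \<open>The images of the unit under the maps out of the ring generate \<open>P\<close>.\<close>

lemma factors_regular_finitely_generated:
  assumes P: "left_module R P" and f: "factors R (regular_module R) P P (\<lambda>x. x)"
  shows "finitely_generated R P"
proof -
  interpret P: left_module R P by fact
  \<comment> \<open>The induction runs over arbitrary maps, since the partial sums of the identity
    are not identities; only the image of \<open>f\<close> is required to lie in every submodule
    that contains \<open>S\<close>.\<close>
  have "\<exists>S. finite S \<and> S \<subseteq> carrier P \<and> (\<forall>N. submodule N R P \<and> S \<subseteq> N \<longrightarrow> (\<forall>x\<in>carrier P. f x \<in> N))"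
    if "factors R (regular_module R) P P f" for f
    using that
  proof induction
    case (zero f)
    then show ?case by (intro exI[of _ "{}"]) (auto dest: submodule_zero)
  next
    case (step f s p f')
    then obtain S where S: "finite S" "S \<subseteq> carrier P"
      and SN: "\<forall>N. submodule N R P \<and> S \<subseteq> N \<longrightarrow> (\<forall>x\<in>carrier P. f x \<in> N)"
      by (elim exE conjE) (rule that)
    have p1: "p \<one>\<^bsub>R\<^esub> \<in> carrier P" using module_hom_closed[OF step(3)] by simp
    have "f' x \<in> N" if N: "submodule N R P" "insert (p \<one>\<^bsub>R\<^esub>) S \<subseteq> N" and x: "x \<in> carrier P" for N x
    proof -
      have sx: "s x \<in> carrier R" using module_hom_closed[OF step(2) x] by simp
      then have "p (s x) = s x \<odot>\<^bsub>P\<^esub> p \<one>\<^bsub>R\<^esub>"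
        using module_hom_smult[OF step(3), of "\<one>\<^bsub>R\<^esub>" "s x"] by simp
      then show ?thesis
        using SN N sx x by (simp add: step(4) submodule_add submodule_smult)
    qed
    then show ?case using S(1,2) p1 by (intro exI[of _ "insert (p \<one>\<^bsub>R\<^esub>) S"]) auto
  qed
  from this[OF f] obtain S where "finite S" "S \<subseteq> carrier P"
    and S: "\<forall>N. submodule N R P \<and> S \<subseteq> N \<longrightarrow> (\<forall>x\<in>carrier P. x \<in> N)"
    by (elim exE conjE) (rule that)
  moreover have "N = carrier P" if "submodule N R P" "S \<subseteq> N" for N
    using S that submodule_subset[OF that(1)] by blast
  ultimately show ?thesis unfolding finitely_generated_def by (intro exI[of _ S]) simp
qed

text \<open>Finitely many generators involve only finitely many coordinates of the ambient free
  module, so truncating to those coordinates does not change the embedded copy of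
  \<open>P\<close>.\<close>

lemma fg_projective_factors:
  fixes P :: "('r, 'p, 'e) module_scheme"
  assumes "projective R P" and "finitely_generated R P"
  shows "factors R (regular_module R) P P (\<lambda>x. x)"
proof -
  from assms(1) obtain X :: "'p set" where P: "left_module R P" and iX: "iso_direct_summand R P (free_module R X)"
    by (auto simp: projective_def)
  interpret P: left_module R P by fact
  note F = free_module_left_module[OF P.R.ring_axioms]
  interpret F: left_module R "free_module R X" by (rule F)
  obtain s p where s: "s \<in> module_hom R P (free_module R X)" and p: "p \<in> module_hom R (free_module R X) P"
    and ps: "\<And>x. x \<in> carrier P \<Longrightarrow> p (s x) = x"
    using iso_direct_summand_imp_retract[OF F P iX] by blast
  obtain S where S: "finite S" "S \<subseteq> carrier P" "\<And>N. submodule N R P \<Longrightarrow> S \<subseteq> N \<Longrightarrow> N = carrier P"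
    using assms(2) by (auto simp: finitely_generated_def)
  define Y where "Y = (\<Union>x\<in>S. {i \<in> X. s x i \<noteq> \<zero>\<^bsub>R\<^esub>})"
  have Y: "finite Y" "Y \<subseteq> X"
    using S(1,2) module_hom_closed[OF s] by (auto simp: Y_def direct_sum_copies_simps)
  \<comment> \<open>The elements supported in \<open>Y\<close> form a submodule that contains the
    generators, hence all of \<open>P\<close>.\<close>
  let ?N = "{x \<in> carrier P. \<forall>i\<in>X - Y. s x i = \<zero>\<^bsub>R\<^esub>}"
  have "submodule ?N R P"
    using module_homD[OF s] module_hom_zero[OF P F s]
    by (intro P.submoduleI) (auto simp: direct_sum_copies_simps)
  moreover have "S \<subseteq> ?N" using S(2) by (auto simp: Y_def)
  ultimately have N: "?N = carrier P" by (rule S(3))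
  let ?t = "\<lambda>f. \<lambda>i\<in>X. if i \<in> Y then f i else \<zero>\<^bsub>R\<^esub>"
  have "?t (s x) = s x" if "x \<in> carrier P" for x
  proof (rule extensionalityI[of _ X])
    show "s x \<in> extensional X"
      using module_hom_closed[OF s that] by (simp add: direct_sum_copies_simps PiE_iff)
    have "x \<in> ?N" using that N by simp
    then show "?t (s x) i = s x i" if "i \<in> X" for i using that by auto
  qed simp
  then have pts: "p (?t (s x)) = x" if "x \<in> carrier P" for x
    using that ps by simp
  have "factors R (regular_module R) (free_module R X) (free_module R X) ?t"
    using factors_truncate[OF left_module_regular[OF P.R.ring_axioms] Y] unfolding regular_module_simps .
  from factors_compose_left[OF P F P factors_compose_right[OF this s] p]
  show ?thesis by (rule factors_cong) (simp only: pts)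
qed

lemma in_add_regular:
  assumes "ring R"
  shows "in_add R (regular_module R) P \<longleftrightarrow> projective R P \<and> finitely_generated R P"
proof -
  note reg = in_add_iff_factors[OF left_module_regular[OF assms]]
  show ?thesis
    unfolding reg
    using factors_regular_projective[of R P] factors_regular_finitely_generated[of R P]
      fg_projective_factors[of R P] projective_left_module[of R P]
    by blast
qed

section \<open>Comparison of projective resolutions\<close>

text \<open>The common form of both conditions on \<open>Hom(-, N)\<close>: surjectivity of
  restriction from \<open>P\<close> to the submodule on \<open>K\<close>. For \<open>P\<close>
  projective and \<open>K\<close> the kernel of an epimorphism from \<open>P\<close> onto
  \<open>M\<close>, this is the vanishing of the first Ext group of \<open>M\<close> and
  \<open>N\<close>.\<close>

definition extends :: "('r, 'k) ring_scheme \<Rightarrow> ('r, 'p, 'e) module_scheme \<Rightarrow> 'p set \<Rightarrow>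
    ('r, 'n, 'f) module_scheme \<Rightarrow> bool"
  where "extends R P K N \<longleftrightarrow> (\<forall>f \<in> module_hom R (P\<lparr>carrier := K\<rparr>) N. \<exists>g \<in> module_hom R P N. \<forall>x\<in>K. g x = f x)"

text \<open>\<open>M\<close> is a retract of \<open>G\<close> modulo maps through \<open>W\<close>.
  With \<open>W\<close> projective this survives taking kernels of unrelated projective covers,
  which being a plain retract does not.\<close>

definition stable_retract :: "('r, 'k) ring_scheme \<Rightarrow> ('r, 'm, 'e) module_scheme \<Rightarrow>
    ('r, 'g, 'f) module_scheme \<Rightarrow> ('r, 'w, 'h) module_scheme \<Rightarrow> bool"
  where "stable_retract R M G W \<longleftrightarrow> (\<exists>s \<in> module_hom R M G. \<exists>p \<in> module_hom R G M.
    \<exists>u \<in> module_hom R M W. \<exists>v \<in> module_hom R W M. \<forall>x\<in>carrier M. p (s x) \<oplus>\<^bsub>M\<^esub> v (u x) = x)"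

lemma module_hom_sub:
  assumes "f \<in> module_hom R M N" "H \<subseteq> carrier M" "\<And>x. x \<in> H \<Longrightarrow> f x \<in> K"
  shows "f \<in> module_hom R (M\<lparr>carrier := H\<rparr>) (N\<lparr>carrier := K\<rparr>)"
  using assms by (auto simp: module_hom_def subset_iff)

lemma extendsD:
  assumes "extends R P K N" "f \<in> module_hom R (P\<lparr>carrier := K\<rparr>) N"
  obtains g where "g \<in> module_hom R P N" "\<And>x. x \<in> K \<Longrightarrow> g x = f x"
  using assms unfolding extends_def by metis

lemma retract_imp_stable_retract:
  assumes M: "left_module R M" and W: "left_module R W"
    and s: "s \<in> module_hom R M G" and p: "p \<in> module_hom R G M"
    and ps: "\<And>x. x \<in> carrier M \<Longrightarrow> p (s x) = x"
  shows "stable_retract R M G W"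
proof -
  interpret M: left_module R M by fact
  have "\<forall>x\<in>carrier M. p (s x) \<oplus>\<^bsub>M\<^esub> \<zero>\<^bsub>M\<^esub> = x" using ps by simp
  then show ?thesis
    unfolding stable_retract_def
    by (intro bexI[OF _ s] bexI[OF _ p] bexI[OF _ module_hom_zero_map[OF W]] bexI[OF _ module_hom_zero_map[OF M]])
qed

text \<open>
  The heart of Schanuel's lemma: lifts \<open>\<alpha>\<close>, \<open>\<beta>\<close> of \<open>s\<close>, \<open>p\<close> and \<open>w\<close> of \<open>v\<close> to the covers, with
  \<open>\<theta> x = x - (\<beta> (\<alpha> x) + w (u (b x)))\<close>.
\<close>

lemma syzygy_comparison:
  assumes M: "left_module R M" and G: "left_module R G"
    and P: "projective R P" and Q: "projective R Q" and W: "projective R W"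
    and c: "c \<in> module_hom R P G" "c ` carrier P = carrier G"
    and b: "b \<in> module_hom R Q M" "b ` carrier Q = carrier M"
    and "stable_retract R M G W"
  obtains \<alpha> \<beta> \<theta> where "\<alpha> \<in> module_hom R Q P" "\<beta> \<in> module_hom R P Q" "\<theta> \<in> module_hom R Q Q"
    "\<And>x. x \<in> a_kernel Q M b \<Longrightarrow> \<alpha> x \<in> a_kernel P G c"
    "\<And>x. x \<in> a_kernel P G c \<Longrightarrow> \<beta> x \<in> a_kernel Q M b"
    "\<And>x. x \<in> carrier Q \<Longrightarrow> \<theta> x \<in> a_kernel Q M b"
    "\<And>x. x \<in> a_kernel Q M b \<Longrightarrow> \<beta> (\<alpha> x) \<oplus>\<^bsub>Q\<^esub> \<theta> x = x"
proof -
  note PL = projective_left_module[OF P] and QL = projective_left_module[OF Q]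
    and WL = projective_left_module[OF W]
  interpret M: left_module R M by (rule M)
  interpret Q: left_module R Q by (rule QL)
  obtain s p u v where s: "s \<in> module_hom R M G" and p: "p \<in> module_hom R G M"
    and u: "u \<in> module_hom R M W" and v: "v \<in> module_hom R W M"
    and id: "\<forall>x\<in>carrier M. p (s x) \<oplus>\<^bsub>M\<^esub> v (u x) = x"
    using assms(10) unfolding stable_retract_def by (elim bexE)
  obtain \<alpha> where \<alpha>: "\<alpha> \<in> module_hom R Q P" and c\<alpha>: "\<forall>x\<in>carrier Q. c (\<alpha> x) = s (b x)"
    using projective_lift[OF Q PL G c module_hom_compose[OF b(1) s]] by (elim bexE)
  obtain \<beta> where \<beta>: "\<beta> \<in> module_hom R P Q" and b\<beta>: "\<forall>x\<in>carrier P. b (\<beta> x) = p (c x)"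
    using projective_lift[OF P QL M b module_hom_compose[OF c(1) p]] by (elim bexE)
  obtain w where w: "w \<in> module_hom R W Q" and bw: "\<forall>x\<in>carrier W. b (w x) = v x"
    using projective_lift[OF W QL M b v] by (elim bexE)
  define \<theta> where "\<theta> x = x \<ominus>\<^bsub>Q\<^esub> (\<beta> (\<alpha> x) \<oplus>\<^bsub>Q\<^esub> w (u (b x)))" for x
  have \<beta>\<alpha>: "(\<lambda>x. \<beta> (\<alpha> x)) \<in> module_hom R Q Q" using \<alpha> \<beta> by (rule module_hom_compose)
  have ub: "(\<lambda>x. u (b x)) \<in> module_hom R Q W" using b(1) u by (rule module_hom_compose)
  have wub: "(\<lambda>x. w (u (b x))) \<in> module_hom R Q Q" using ub w by (rule module_hom_compose)
  note h = module_hom_plus[OF QL \<beta>\<alpha> wub]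
  show ?thesis
  proof
    show "\<alpha> \<in> module_hom R Q P" "\<beta> \<in> module_hom R P Q" by fact+
    show "\<theta> \<in> module_hom R Q Q"
      unfolding \<theta>_def by (rule module_hom_diff[OF QL module_hom_ident h])
    show "\<alpha> x \<in> a_kernel P G c" if "x \<in> a_kernel Q M b" for x
      using that c\<alpha> module_hom_closed[OF \<alpha>] module_hom_zero[OF M G s] by (simp add: mem_a_kernel)
    show "\<beta> x \<in> a_kernel Q M b" if "x \<in> a_kernel P G c" for x
      using that b\<beta> module_hom_closed[OF \<beta>] module_hom_zero[OF G M p] by (simp add: mem_a_kernel)
    show "\<theta> x \<in> a_kernel Q M b" if x: "x \<in> carrier Q" for x
    proof -
      have bx: "b x \<in> carrier M" and cl: "\<beta> (\<alpha> x) \<in> carrier Q" "w (u (b x)) \<in> carrier Q" "\<alpha> x \<in> carrier P" "u (b x) \<in> carrier W"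
        using module_hom_closed[OF b(1) x] module_hom_closed[OF \<beta>\<alpha> x] module_hom_closed[OF wub x]
          module_hom_closed[OF \<alpha> x] module_hom_closed[OF ub x] by simp_all
      have "b (\<theta> x) = b x \<ominus>\<^bsub>M\<^esub> (p (s (b x)) \<oplus>\<^bsub>M\<^esub> v (u (b x)))"
        using x cl b\<beta> c\<alpha> bw unfolding \<theta>_def
        by (simp add: module_hom_minus[OF QL M b(1)] module_hom_add[OF b(1)])
      also have "\<dots> = \<zero>\<^bsub>M\<^esub>" using id bx by simp
      finally show ?thesis
        using x cl unfolding \<theta>_def by (simp add: mem_a_kernel)
    qed
    \<comment> \<open>On the kernel of \<open>b\<close> the term through \<open>W\<close> vanishes,
      which leaves the identity as \<beta> \<alpha> + \<theta>.\<close>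
    show "\<beta> (\<alpha> x) \<oplus>\<^bsub>Q\<^esub> \<theta> x = x" if "x \<in> a_kernel Q M b" for x
    proof -
      have x: "x \<in> carrier Q" and bx: "b x = \<zero>\<^bsub>M\<^esub>" using that by (simp_all add: mem_a_kernel)
      have "w (u (b x)) = \<zero>\<^bsub>Q\<^esub>"
        using bx module_hom_zero[OF M WL u] module_hom_zero[OF WL QL w] by simp
      then show ?thesis
        using x module_hom_closed[OF \<beta>\<alpha> x] unfolding \<theta>_def
        by (simp add: a_minus_def Q.M.a_lcomm Q.M.r_neg)
    qed
  qed
qed

text \<open>The correction term of the syzygies is the inclusion into \<open>Q\<close> followed by
  \<theta>, so the cover \<open>Q\<close> itself takes over the role of \<open>W\<close>.\<close>

lemma stable_retract_syzygy:
  assumes M: "left_module R M" and G: "left_module R G"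
    and P: "projective R P" and Q: "projective R Q" and W: "projective R W"
    and c: "c \<in> module_hom R P G" "c ` carrier P = carrier G"
    and b: "b \<in> module_hom R Q M" "b ` carrier Q = carrier M"
    and sr: "stable_retract R M G W"
  shows "stable_retract R (Q\<lparr>carrier := a_kernel Q M b\<rparr>) (P\<lparr>carrier := a_kernel P G c\<rparr>) Q"
proof -
  obtain \<alpha> \<beta> \<theta> where h: "\<alpha> \<in> module_hom R Q P" "\<beta> \<in> module_hom R P Q" "\<theta> \<in> module_hom R Q Q"
    "\<And>x. x \<in> a_kernel Q M b \<Longrightarrow> \<alpha> x \<in> a_kernel P G c"
    "\<And>x. x \<in> a_kernel P G c \<Longrightarrow> \<beta> x \<in> a_kernel Q M b"
    "\<And>x. x \<in> carrier Q \<Longrightarrow> \<theta> x \<in> a_kernel Q M b"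
    "\<And>x. x \<in> a_kernel Q M b \<Longrightarrow> \<beta> (\<alpha> x) \<oplus>\<^bsub>Q\<^esub> \<theta> x = x"
    using syzygy_comparison[OF M G P Q W c b sr] by metis
  have sub: "a_kernel Q M b \<subseteq> carrier Q" "a_kernel P G c \<subseteq> carrier P" by (auto simp: mem_a_kernel)
  show ?thesis
    unfolding stable_retract_def
  proof (intro bexI)
    show "\<alpha> \<in> module_hom R (Q\<lparr>carrier := a_kernel Q M b\<rparr>) (P\<lparr>carrier := a_kernel P G c\<rparr>)"
      by (rule module_hom_sub[OF h(1) sub(1) h(4)])
    show "\<beta> \<in> module_hom R (P\<lparr>carrier := a_kernel P G c\<rparr>) (Q\<lparr>carrier := a_kernel Q M b\<rparr>)"
      by (rule module_hom_sub[OF h(2) sub(2) h(5)])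
    show "(\<lambda>x. x) \<in> module_hom R (Q\<lparr>carrier := a_kernel Q M b\<rparr>) Q"
      by (rule module_hom_restrict[OF module_hom_ident sub(1)])
    show "\<theta> \<in> module_hom R Q (Q\<lparr>carrier := a_kernel Q M b\<rparr>)"
      by (rule module_hom_corestrict[OF h(3,6)])
  qed (use h(7) in simp)
qed

text \<open>If \<open>g\<close> extends f \<beta> to \<open>P\<close>, then g \<alpha> + f \<theta>
  extends \<open>f\<close>: it is defined on all of \<open>Q\<close> because \<theta> maps all of
  \<open>Q\<close> into the kernel of \<open>b\<close>.\<close>

lemma extends_syzygy:
  assumes M: "left_module R M" and G: "left_module R G" and N: "left_module R N"
    and P: "projective R P" and Q: "projective R Q" and W: "projective R W"
    and c: "c \<in> module_hom R P G" "c ` carrier P = carrier G"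
    and b: "b \<in> module_hom R Q M" "b ` carrier Q = carrier M"
    and sr: "stable_retract R M G W" and ext: "extends R P (a_kernel P G c) N"
  shows "extends R Q (a_kernel Q M b) N"
  unfolding extends_def
proof
  interpret N: left_module R N by fact
  obtain \<alpha> \<beta> \<theta> where h: "\<alpha> \<in> module_hom R Q P" "\<beta> \<in> module_hom R P Q" "\<theta> \<in> module_hom R Q Q"
    "\<And>x. x \<in> a_kernel Q M b \<Longrightarrow> \<alpha> x \<in> a_kernel P G c"
    "\<And>x. x \<in> a_kernel P G c \<Longrightarrow> \<beta> x \<in> a_kernel Q M b"
    "\<And>x. x \<in> carrier Q \<Longrightarrow> \<theta> x \<in> a_kernel Q M b"
    "\<And>x. x \<in> a_kernel Q M b \<Longrightarrow> \<beta> (\<alpha> x) \<oplus>\<^bsub>Q\<^esub> \<theta> x = x"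
    using syzygy_comparison[OF M G P Q W c b sr] by metis
  have sub: "a_kernel Q M b \<subseteq> carrier Q" "a_kernel P G c \<subseteq> carrier P" by (auto simp: mem_a_kernel)
  fix f assume f: "f \<in> module_hom R (Q\<lparr>carrier := a_kernel Q M b\<rparr>) N"
  have \<beta>: "\<beta> \<in> module_hom R (P\<lparr>carrier := a_kernel P G c\<rparr>) (Q\<lparr>carrier := a_kernel Q M b\<rparr>)"
    by (rule module_hom_sub[OF h(2) sub(2) h(5)])
  obtain g where g: "g \<in> module_hom R P N" "\<And>x. x \<in> a_kernel P G c \<Longrightarrow> g x = f (\<beta> x)"
    using extendsD[OF ext module_hom_compose[OF \<beta> f]] by metis
  have \<theta>: "\<theta> \<in> module_hom R Q (Q\<lparr>carrier := a_kernel Q M b\<rparr>)"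
    using h(3,6) by (rule module_hom_corestrict)
  note F = module_hom_plus[OF N module_hom_compose[OF h(1) g(1)] module_hom_compose[OF \<theta> f]]
  have "g (\<alpha> x) \<oplus>\<^bsub>N\<^esub> f (\<theta> x) = f x" if x: "x \<in> a_kernel Q M b" for x
  proof -
    have "f (\<beta> (\<alpha> x)) \<oplus>\<^bsub>N\<^esub> f (\<theta> x) = f (\<beta> (\<alpha> x) \<oplus>\<^bsub>Q\<^esub> \<theta> x)"
      using module_hom_add[OF f, of "\<beta> (\<alpha> x)" "\<theta> x"] h(4)[OF x] h(5)[of "\<alpha> x"] h(6)[of x] x sub by auto
    then show ?thesis using g(2)[OF h(4)[OF x]] h(7)[OF x] by simp
  qed
  then show "\<exists>g\<in>module_hom R Q N. \<forall>x\<in>a_kernel Q M b. g x = f x"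
    by (intro bexI[OF _ F]) simp
qed

section \<open>Comparison along whole resolutions\<close>

definition syzygy :: "(nat \<Rightarrow> ('r, 'p) module) \<Rightarrow> (nat \<Rightarrow> 'p \<Rightarrow> 'p) \<Rightarrow> ('r, 'm, 'e) module_scheme \<Rightarrow>
    ('p \<Rightarrow> 'm) \<Rightarrow> nat \<Rightarrow> 'p set"
  where "syzygy P d M e n = (case n of 0 \<Rightarrow> a_kernel (P 0) M e | Suc k \<Rightarrow> a_kernel (P (Suc k)) (P k) (d k))"

lemma a_kernel_corestrict: "a_kernel M (N\<lparr>carrier := H\<rparr>) f = a_kernel M N f"
  by (auto simp: mem_a_kernel)

text \<open>Presents a resolution as a chain of covers: \<open>d n\<close> maps onto the syzygy
  inside \<open>P n\<close>, and its kernel is the next one. The index is that of the containing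
  module, so the syzygy with index 0 is the first syzygy of \<open>M\<close> in the usual
  count.\<close>

lemma syzygy_props:
  assumes res: "projective_resolution R M P d e" and M: "left_module R M"
  shows "projective R (P n)" "submodule (syzygy P d M e n) R (P n)"
    "left_module R (P n\<lparr>carrier := syzygy P d M e n\<rparr>)"
    "d n \<in> module_hom R (P (Suc n)) (P n\<lparr>carrier := syzygy P d M e n\<rparr>)"
    "d n ` carrier (P (Suc n)) = carrier (P n\<lparr>carrier := syzygy P d M e n\<rparr>)"
    "syzygy P d M e (Suc n) = a_kernel (P (Suc n)) (P n\<lparr>carrier := syzygy P d M e n\<rparr>) (d n)"
    "syzygy P d M e 0 = a_kernel (P 0) M e"
    "e \<in> module_hom R (P 0) M" "e ` carrier (P 0) = carrier M"
proof -
  from res have P: "projective R (P n)" and d: "d n \<in> module_hom R (P (Suc n)) (P n)"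
    and e: "e \<in> module_hom R (P 0) M" for n
    by (auto simp: projective_resolution_def)
  note L = projective_left_module[OF P]
  show sub: "submodule (syzygy P d M e n) R (P n)"
    by (cases n) (simp_all add: syzygy_def submodule_kernel[OF L M e] submodule_kernel[OF L L d])
  show "left_module R (P n\<lparr>carrier := syzygy P d M e n\<rparr>)"
    by (rule submodule_left_module[OF L sub])
  show im: "d n ` carrier (P (Suc n)) = carrier (P n\<lparr>carrier := syzygy P d M e n\<rparr>)"
    using res by (cases n) (simp_all add: projective_resolution_def syzygy_def)
  show "d n \<in> module_hom R (P (Suc n)) (P n\<lparr>carrier := syzygy P d M e n\<rparr>)"
    using im by (intro module_hom_corestrict[OF d]) auto
  show "syzygy P d M e (Suc n) = a_kernel (P (Suc n)) (P n\<lparr>carrier := syzygy P d M e n\<rparr>) (d n)"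
    "syzygy P d M e 0 = a_kernel (P 0) M e"
    by (simp_all add: syzygy_def a_kernel_corestrict)
  show "projective R (P n)" "e \<in> module_hom R (P 0) M" "e ` carrier (P 0) = carrier M"
    using res by (auto simp: projective_resolution_def)
qed

text \<open>Vanishing of Ext in terms of extensions is independent of the resolution and passes to
  stable retracts; the two resolutions may live on different element types. The given
  \<open>W\<close> serves for the covers of \<open>G\<close> and \<open>M\<close>, and
  \<open>Q n\<close> for the later syzygies.\<close>

lemma extends_resolution:
  assumes resG: "projective_resolution R G P d e" and G: "left_module R G"
    and resM: "projective_resolution R M Q d' e'" and M: "left_module R M"
    and N: "left_module R N" and W: "projective R W" and sr: "stable_retract R M G W"
    and ext: "\<And>n. extends R (P n) (syzygy P d G e n) N"
  shows "extends R (Q n) (syzygy Q d' M e' n) N"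
proof -
  note sP = syzygy_props[OF resG G] and sQ = syzygy_props[OF resM M]
  have "stable_retract R (Q n\<lparr>carrier := syzygy Q d' M e' n\<rparr>) (P n\<lparr>carrier := syzygy P d G e n\<rparr>) (Q n)" for n
  proof (induction n)
    case 0
    show ?case
      using stable_retract_syzygy[OF M G sP(1) sQ(1) W sP(8,9) sQ(8,9) sr] by (simp add: sP(7) sQ(7))
  next
    case (Suc n)
    from stable_retract_syzygy[OF sQ(3) sP(3) sP(1) sQ(1) sQ(1) sP(4,5) sQ(4,5) Suc]
    show ?case by (simp add: sP(6) sQ(6))
  qed
  note sr' = this
  show ?thesis
  proof (cases n)
    case 0
    show ?thesis
      using extends_syzygy[OF M G N sP(1) sQ(1) W sP(8,9) sQ(8,9) sr] ext[of 0] 0 by (simp add: sP(7) sQ(7))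
  next
    case (Suc k)
    show ?thesis
      using extends_syzygy[OF sQ(3) sP(3) N sP(1) sQ(1) sQ(1) sP(4,5) sQ(4,5) sr'] ext[of "Suc k"] Suc
      by (simp add: sP(6) sQ(6))
  qed
qed

text \<open>\<open>M\<close> is covered by the direct sum of \<open>P\<close> and \<open>W\<close>:
  by the stable retraction every element of \<open>M\<close> is the sum of something from
  \<open>G\<close>, which \<open>P\<close> covers, and something from \<open>W\<close>.\<close>

lemma finitely_generated_resolution_step:
  fixes R :: "('r, 'k) ring_scheme" and M :: "('r, 'm, 'e) module_scheme"
  assumes M: "left_module R M" and G: "left_module R G"
    and P: "projective R P" "finitely_generated R P" and W: "projective R W" "finitely_generated R W"
    and c: "c \<in> module_hom R P G" "c ` carrier P = carrier G"
    and sr: "stable_retract R M G W"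
  shows "\<exists>(Q :: ('r, nat \<Rightarrow> 'r) module) b. projective R Q \<and> finitely_generated R Q \<and>
    b \<in> module_hom R Q M \<and> b ` carrier Q = carrier M \<and>
    stable_retract R (Q\<lparr>carrier := a_kernel Q M b\<rparr>) (P\<lparr>carrier := a_kernel P G c\<rparr>) Q"
proof -
  note PL = projective_left_module[OF P(1)] and WL = projective_left_module[OF W(1)]
  interpret M: left_module R M by (rule M)
  note reg = left_module_regular[OF M.R.ring_axioms]
  obtain Q :: "('r, nat \<Rightarrow> 'r) module" and i j q1 q2 where Q: "in_add R (regular_module R) Q"
    and i: "i \<in> module_hom R P Q" and j: "j \<in> module_hom R W Q"
    and q1: "q1 \<in> module_hom R Q P" and q2: "q2 \<in> module_hom R Q W"
    and e1: "\<forall>x\<in>carrier P. q1 (i x) = x \<and> q2 (i x) = \<zero>\<^bsub>W\<^esub>"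
    and e2: "\<forall>y\<in>carrier W. q1 (j y) = \<zero>\<^bsub>P\<^esub> \<and> q2 (j y) = y"
    and e3: "\<forall>z\<in>carrier Q. i (q1 z) \<oplus>\<^bsub>Q\<^esub> j (q2 z) = z"
    using biproduct_in_add[OF PL WL reg fg_projective_factors[OF P] fg_projective_factors[OF W]]
    by (elim exE conjE) (rule that)
  from Q have Q: "projective R Q" "finitely_generated R Q"
    unfolding in_add_regular[OF M.R.ring_axioms] by simp_all
  interpret Q: left_module R Q using Q(1) by (rule projective_left_module)
  obtain s p u v where s: "s \<in> module_hom R M G" and p: "p \<in> module_hom R G M"
    and u: "u \<in> module_hom R M W" and v: "v \<in> module_hom R W M"
    and id: "\<forall>x\<in>carrier M. p (s x) \<oplus>\<^bsub>M\<^esub> v (u x) = x"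
    using sr unfolding stable_retract_def by (elim bexE)
  note pc = module_hom_compose[OF c(1) p]
  \<comment> \<open>The map p c + v on the biproduct, with \<open>q1\<close> and \<open>q2\<close>
    its projections.\<close>
  define b where "b z = p (c (q1 z)) \<oplus>\<^bsub>M\<^esub> v (q2 z)" for z
  have b: "b \<in> module_hom R Q M"
    unfolding b_def
    by (rule module_hom_plus[OF M module_hom_compose[OF q1 pc] module_hom_compose[OF q2 v]])
  have "x \<in> b ` carrier Q" if x: "x \<in> carrier M" for x
  proof -
    have "s x \<in> c ` carrier P" using module_hom_closed[OF s x] c(2) by simp
    then obtain y where y: "y \<in> carrier P" "c y = s x" by (metis imageE)
    have ux: "u x \<in> carrier W" by (rule module_hom_closed[OF u x])
    have bi: "b (i y) = p (s x)"
      using y e1 module_hom_zero[OF WL M v] module_hom_closed[OF module_hom_compose[OF s p] x]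
      by (simp add: b_def)
    have bj: "b (j (u x)) = v (u x)"
      using ux e2 module_hom_zero[OF PL M pc] module_hom_closed[OF v ux] by (simp add: b_def)
    have "b (i y \<oplus>\<^bsub>Q\<^esub> j (u x)) = x"
      using module_hom_closed[OF i y(1)] module_hom_closed[OF j ux] id x
      by (simp add: module_hom_add[OF b] bi bj)
    then show ?thesis
      using module_hom_closed[OF i y(1)] module_hom_closed[OF j ux] by (metis Q.M.a_closed imageI)
  qed
  then have bs: "b ` carrier Q = carrier M" using module_hom_closed[OF b] by blast
  show ?thesis
    using Q b bs stable_retract_syzygy[OF M G P(1) Q(1) W(1) c b bs sr]
    by (intro exI[of _ Q] exI[of _ b]) simp
qed

text \<open>Each kernel remains a stable retract of the corresponding syzygy of \<open>G\<close>,
  and the cover built last is the finitely generated projective that serves as \<open>W\<close> in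
  the next step.\<close>

lemma finitely_generated_resolution_exists:
  fixes R :: "('r, 'k) ring_scheme" and M :: "('r, 'm, 'e) module_scheme"
  assumes res: "projective_resolution R G P d e" and fg: "\<And>n. finitely_generated R (P n)"
    and M: "left_module R M" and G: "left_module R G"
    and W: "projective R W" "finitely_generated R W" and sr: "stable_retract R M G W"
  shows "\<exists>(Q :: nat \<Rightarrow> ('r, nat \<Rightarrow> 'r) module) d' e'.
    projective_resolution R M Q d' e' \<and> (\<forall>n. finitely_generated R (Q n))"
proof -
  note sP = syzygy_props[OF res G]
  \<comment> \<open>A state pairs a module of the new resolution with the kernel in it that still
    has to be covered.\<close>
  define ok where "ok n s \<longleftrightarrow> projective R (fst s) \<and> finitely_generated R (fst s) \<and>
    left_module R ((fst s)\<lparr>carrier := snd s\<rparr>) \<and> snd s \<subseteq> carrier (fst s) \<and>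
    stable_retract R ((fst s)\<lparr>carrier := snd s\<rparr>) (P n\<lparr>carrier := syzygy P d G e n\<rparr>) (fst s)"
    for n and s :: "('r, nat \<Rightarrow> 'r) module \<times> (nat \<Rightarrow> 'r) set"
  define link where "link s t g \<longleftrightarrow> g \<in> module_hom R (fst t) (fst s) \<and> g ` carrier (fst t) = snd s \<and>
      snd t = a_kernel (fst t) (fst s) g"
    for s t :: "('r, nat \<Rightarrow> 'r) module \<times> (nat \<Rightarrow> 'r) set" and g
  have ex: "\<exists>t. ok (Suc n) t \<and> (\<exists>g. link s t g)" if s: "ok n s" for n s
  proof -
    let ?L = "(fst s)\<lparr>carrier := snd s\<rparr>"
    from s have S: "projective R (fst s)" "finitely_generated R (fst s)" "left_module R ?L"
      "snd s \<subseteq> carrier (fst s)" "stable_retract R ?L (P n\<lparr>carrier := syzygy P d G e n\<rparr>) (fst s)"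
      by (simp_all add: ok_def)
    obtain Q :: "('r, nat \<Rightarrow> 'r) module" and b where Q: "projective R Q" "finitely_generated R Q"
      and b: "b \<in> module_hom R Q ?L" "b ` carrier Q = carrier ?L"
      and sr': "stable_retract R (Q\<lparr>carrier := a_kernel Q ?L b\<rparr>)
        (P (Suc n)\<lparr>carrier := a_kernel (P (Suc n)) (P n\<lparr>carrier := syzygy P d G e n\<rparr>) (d n)\<rparr>) Q"
      using finitely_generated_resolution_step[OF S(3) sP(3) sP(1) fg S(1,2) sP(4,5) S(5)]
      by (elim exE conjE) (rule that)
    have "link s (Q, a_kernel Q ?L b) b"
      using b module_hom_expand[OF b(1) S(4)] by (simp add: link_def a_kernel_corestrict)
    moreover have "ok (Suc n) (Q, a_kernel Q ?L b)"
      using Q sr' left_module_kernel[OF projective_left_module[OF Q(1)] S(3) b(1)]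
      by (auto simp: ok_def sP(6) mem_a_kernel)
    ultimately show ?thesis by blast
  qed
  obtain Q0 :: "('r, nat \<Rightarrow> 'r) module" and e0 where Q0: "projective R Q0" "finitely_generated R Q0"
    and e0: "e0 \<in> module_hom R Q0 M" "e0 ` carrier Q0 = carrier M"
    and sr0: "stable_retract R (Q0\<lparr>carrier := a_kernel Q0 M e0\<rparr>) (P 0\<lparr>carrier := a_kernel (P 0) G e\<rparr>) Q0"
    using finitely_generated_resolution_step[OF M G sP(1) fg W sP(8,9) sr]
    by (elim exE conjE) (rule that)
  let ?s0 = "(Q0, a_kernel Q0 M e0)"
  have ok0: "ok 0 ?s0"
    using Q0 sr0 left_module_kernel[OF projective_left_module[OF Q0(1)] M e0(1)]
    by (auto simp: ok_def sP(7) mem_a_kernel)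
  \<comment> \<open>The clause for n = 0 pins the starting state, for which dependent choice alone
    guarantees only the property \<open>ok\<close>.\<close>
  have "\<exists>s. \<forall>n. (ok n (s n) \<and> (n = 0 \<longrightarrow> s n = ?s0)) \<and> (\<exists>g. link (s n) (s (Suc n)) g)"
  proof (rule dependent_nat_choice)
    show "\<exists>x. ok 0 x \<and> (0 = (0::nat) \<longrightarrow> x = ?s0)" using ok0 by blast
    show "\<exists>t. (ok (Suc n) t \<and> (Suc n = 0 \<longrightarrow> t = ?s0)) \<and> (\<exists>g. link s t g)"
      if "ok n s \<and> (n = 0 \<longrightarrow> s = ?s0)" for s n
      using ex[of n s] that by simp
  qed
  then obtain s where ok: "\<And>n. ok n (s n)" and s0: "s 0 = ?s0" and "\<And>n. \<exists>g. link (s n) (s (Suc n)) g"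
    by metis
  then obtain g where g: "\<And>n. link (s n) (s (Suc n)) (g n)" by metis
  have "projective_resolution R M (\<lambda>n. fst (s n)) g e0"
    using ok g s0 e0 by (simp add: projective_resolution_def link_def ok_def)
  with ok show ?thesis by (intro exI[of _ "\<lambda>n. fst (s n)"] exI[of _ g] exI[of _ e0]) (simp add: ok_def)
qed


section \<open>Ext and extension of homomorphisms\<close>

lemma hom_group_comm_group:
  assumes M: "left_module R M" and N: "left_module R N"
  shows "comm_group (hom_group R M N)"
proof (rule comm_groupI)
  interpret M: left_module R M by fact
  interpret N: left_module R N by fact
  note cong = module_hom_cong[OF _ M]
  fix f assume f: "f \<in> carrier (hom_group R M N)"
  then have fh: "f \<in> module_hom R M N" by (simp add: hom_group_def)
  show "\<one>\<^bsub>hom_group R M N\<^esub> \<otimes>\<^bsub>hom_group R M N\<^esub> f = f"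
    using f module_hom_closed[OF fh]
    by (auto simp: hom_group_def intro!: extensionalityI[of _ "carrier M"])
  let ?g = "\<lambda>x\<in>carrier M. \<zero>\<^bsub>N\<^esub> \<ominus>\<^bsub>N\<^esub> f x"
  have "?g \<in> module_hom R M N"
    by (rule cong[OF module_hom_diff[OF N module_hom_zero_map[OF N] fh]]) simp
  then show "\<exists>g\<in>carrier (hom_group R M N). g \<otimes>\<^bsub>hom_group R M N\<^esub> f = \<one>\<^bsub>hom_group R M N\<^esub>"
    using module_hom_closed[OF fh]
    by (intro bexI[of _ ?g]) (auto simp: hom_group_def a_minus_def N.M.l_neg intro!: restrict_ext)
next
  interpret M: left_module R M by fact
  interpret N: left_module R N by fact
  note cong = module_hom_cong[OF _ M]
  show "\<one>\<^bsub>hom_group R M N\<^esub> \<in> carrier (hom_group R M N)"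
    by (simp add: hom_group_def cong[OF module_hom_zero_map[OF N]])
  fix f g assume "f \<in> carrier (hom_group R M N)" "g \<in> carrier (hom_group R M N)"
  then have f: "f \<in> module_hom R M N" and g: "g \<in> module_hom R M N" by (simp_all add: hom_group_def)
  show "f \<otimes>\<^bsub>hom_group R M N\<^esub> g \<in> carrier (hom_group R M N)"
    by (simp add: hom_group_def cong[OF module_hom_plus[OF N f g]])
  show "f \<otimes>\<^bsub>hom_group R M N\<^esub> g = g \<otimes>\<^bsub>hom_group R M N\<^esub> f"
    using module_hom_closed[OF f] module_hom_closed[OF g]
    by (auto simp: hom_group_def N.M.a_comm intro!: restrict_ext)
  fix h assume "h \<in> carrier (hom_group R M N)"
  then have h: "h \<in> module_hom R M N" by (simp add: hom_group_def)
  show "f \<otimes>\<^bsub>hom_group R M N\<^esub> g \<otimes>\<^bsub>hom_group R M N\<^esub> h = f \<otimes>\<^bsub>hom_group R M N\<^esub> (g \<otimes>\<^bsub>hom_group R M N\<^esub> h)"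
    using module_hom_closed[OF f] module_hom_closed[OF g] module_hom_closed[OF h]
    by (auto simp: hom_group_def N.M.a_assoc intro!: restrict_ext)
qed

lemma hom_precomp_group_hom:
  assumes L: "left_module R L" and M: "left_module R M" and N: "left_module R N"
    and f: "f \<in> module_hom R L M"
  shows "group_hom (hom_group R M N) (hom_group R L N) (hom_precomp L f)"
proof -
  interpret L: left_module R L by fact
  have "hom_precomp L f \<in> hom (hom_group R M N) (hom_group R L N)"
  proof (rule homI)
    fix h assume "h \<in> carrier (hom_group R M N)"
    then have h: "h \<in> module_hom R M N" by (simp add: hom_group_def)
    show "hom_precomp L f h \<in> carrier (hom_group R L N)"
      using module_hom_cong[OF module_hom_compose[OF f h] L, of "compose (carrier L) h f"]
      by (simp add: hom_group_def hom_precomp_def compose_def)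
    fix g assume "g \<in> carrier (hom_group R M N)"
    show "hom_precomp L f (h \<otimes>\<^bsub>hom_group R M N\<^esub> g) =
        hom_precomp L f h \<otimes>\<^bsub>hom_group R L N\<^esub> hom_precomp L f g"
      using module_hom_closed[OF f]
      by (auto simp: hom_group_def hom_precomp_def compose_def intro!: restrict_ext)
  qed
  then show ?thesis
    using hom_group_comm_group[OF L N] hom_group_comm_group[OF M N]
    by (simp add: group_hom_def group_hom_axioms_def comm_group_def)
qed

lemma trivial_quotient_iff:
  assumes G: "comm_group G" and Z: "subgroup Z G" and B: "subgroup B G" and "B \<subseteq> Z"
  shows "trivial_group (G\<lparr>carrier := Z\<rparr> Mod B) \<longleftrightarrow> Z \<subseteq> B"
proof -
  interpret G: comm_group G by fact
  let ?Z = "G\<lparr>carrier := Z\<rparr>"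
  interpret Zg: group ?Z by (rule subgroup.subgroup_is_group[OF Z G.is_group])
  interpret Zg: comm_group ?Z
    using Z by (intro Zg.group_comm_groupI) (auto simp: G.m_comm subgroup.mem_carrier)
  have B': "subgroup B ?Z" by (rule G.subgroup_incl[OF B Z assms(4)])
  interpret Q: comm_group "?Z Mod B" by (rule Zg.abelian_FactGroup[OF B'])
  show ?thesis
  proof
    assume "trivial_group (?Z Mod B)"
    then have "B #>\<^bsub>?Z\<^esub> z = B" if "z \<in> Z" for z
      using that by (auto simp: trivial_group_def carrier_FactGroup)
    then show "Z \<subseteq> B"
      using Zg.rcos_self[OF _ B'] by auto
  next
    assume "Z \<subseteq> B"
    then have "B #>\<^bsub>?Z\<^esub> z = B" if "z \<in> Z" for z
      using that Zg.coset_join2[OF _ B'] by auto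
    then show "trivial_group (?Z Mod B)"
      by (auto simp: Q.trivial_group_subset carrier_FactGroup)
  qed
qed

lemma hom_precomp_image_subset:
  assumes L: "left_module R L" and M: "left_module R M" and N: "left_module R N"
    and f: "f \<in> module_hom R L M"
  shows "hom_precomp L f ` carrier (hom_group R M N) \<subseteq>
    {z \<in> carrier (hom_group R L N). \<forall>x\<in>carrier L. f x = \<zero>\<^bsub>M\<^esub> \<longrightarrow> z x = \<zero>\<^bsub>N\<^esub>}"
proof (rule image_subsetI)
  fix h assume h: "h \<in> carrier (hom_group R M N)"
  then have hh: "h \<in> module_hom R M N" by (simp add: hom_group_def)
  have "hom_precomp L f h \<in> carrier (hom_group R L N)"
    by (rule group_hom.hom_closed[OF hom_precomp_group_hom[OF L M N f] h])
  then show "hom_precomp L f h \<in>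
      {z \<in> carrier (hom_group R L N). \<forall>x\<in>carrier L. f x = \<zero>\<^bsub>M\<^esub> \<longrightarrow> z x = \<zero>\<^bsub>N\<^esub>}"
    using module_hom_zero[OF M N hh] by (auto simp: hom_precomp_def compose_def)
qed

text \<open>Maps on \<open>L\<close> that vanish on the kernel of \<open>f\<close> are exactly the
  maps defined on the image of \<open>f\<close>; those in the image of precomposition are the ones
  that extend from there to all of \<open>M\<close>.\<close>

lemma extends_iff_hom_precomp_image:
  assumes L: "left_module R L" and M: "left_module R M" and N: "left_module R N"
    and f: "f \<in> module_hom R L M"
  shows "extends R M (f ` carrier L) N \<longleftrightarrow>
    {z \<in> carrier (hom_group R L N). \<forall>x\<in>carrier L. f x = \<zero>\<^bsub>M\<^esub> \<longrightarrow> z x = \<zero>\<^bsub>N\<^esub>}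
    \<subseteq> hom_precomp L f ` carrier (hom_group R M N)" (is "_ \<longleftrightarrow> ?Z \<subseteq> ?B")
proof
  interpret N: left_module R N by fact
  have I: "left_module R (M\<lparr>carrier := f ` carrier L\<rparr>)"
    by (rule submodule_left_module[OF M submodule_image[OF L M f]])
  have fI: "f \<in> module_hom R L (M\<lparr>carrier := f ` carrier L\<rparr>)"
    by (rule module_hom_corestrict[OF f]) simp
  assume ZB: "?Z \<subseteq> ?B"
  show "extends R M (f ` carrier L) N"
    unfolding extends_def
  proof
    fix k assume k: "k \<in> module_hom R (M\<lparr>carrier := f ` carrier L\<rparr>) N"
    let ?z = "\<lambda>x\<in>carrier L. k (f x)"
    have "?z \<in> module_hom R L N"
      by (rule module_hom_cong[OF module_hom_compose[OF fI k] L]) simp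
    moreover have "k \<zero>\<^bsub>M\<^esub> = \<zero>\<^bsub>N\<^esub>" using module_hom_zero[OF I N k] by simp
    ultimately have "?z \<in> ?Z" by (auto simp: hom_group_def)
    with ZB obtain h where "h \<in> carrier (hom_group R M N)" and zh: "?z = hom_precomp L f h" by blast
    then have h: "h \<in> module_hom R M N" by (simp add: hom_group_def)
    have "h (f x) = k (f x)" if "x \<in> carrier L" for x
      using fun_cong[OF zh, of x] that by (simp add: hom_precomp_def compose_def)
    then have "\<forall>x\<in>f ` carrier L. h x = k x" by simp
    then show "\<exists>g\<in>module_hom R M N. \<forall>x\<in>f ` carrier L. g x = k x" using h by (rule bexI)
  qed
next
  assume ext: "extends R M (f ` carrier L) N"
  show "?Z \<subseteq> ?B"
  proof
    fix z assume "z \<in> ?Z"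
    then have z: "z \<in> module_hom R L N" "z \<in> extensional (carrier L)"
      and z0: "\<And>x. x \<in> carrier L \<Longrightarrow> f x = \<zero>\<^bsub>M\<^esub> \<Longrightarrow> z x = \<zero>\<^bsub>N\<^esub>"
      by (auto simp: hom_group_def)
    have "\<exists>k\<in>module_hom R (M\<lparr>carrier := f ` carrier L\<rparr>) N. \<forall>x\<in>carrier L. k (f x) = z x"
      by (rule module_hom_factor[OF L M N z(1) f]) (rule z0)
    then obtain k where k: "k \<in> module_hom R (M\<lparr>carrier := f ` carrier L\<rparr>) N"
      and kz: "\<forall>x\<in>carrier L. k (f x) = z x"
      by (elim bexE)
    obtain g where g: "g \<in> module_hom R M N" and gk: "\<And>x. x \<in> f ` carrier L \<Longrightarrow> g x = k x"
      using extendsD[OF ext k] by metis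
    let ?g = "restrict g (carrier M)"
    have "?g \<in> carrier (hom_group R M N)"
      using module_hom_cong[OF g M, of ?g] by (simp add: hom_group_def)
    moreover have "hom_precomp L f ?g = z"
    proof (rule extensionalityI[OF _ z(2)])
      show "hom_precomp L f ?g \<in> extensional (carrier L)" by (simp add: hom_precomp_def)
      fix x assume x: "x \<in> carrier L"
      then show "hom_precomp L f ?g x = z x"
        using gk[of "f x"] kz module_hom_closed[OF f x] by (simp add: hom_precomp_def compose_def)
    qed
    ultimately show "z \<in> ?B" by blast
  qed
qed

lemma kernel_hom_precomp:
  "kernel (hom_group R M N) (hom_group R L N) (hom_precomp L f) =
    {z \<in> carrier (hom_group R M N). \<forall>x\<in>carrier L. z (f x) = \<zero>\<^bsub>N\<^esub>}"
  by (auto simp: kernel_def hom_group_def hom_precomp_def compose_def fun_eq_iff restrict_def)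

text \<open>A cocycle in degree n + 1 vanishes on the image of \<open>d (Suc n)\<close>, which is
  the kernel of \<open>d n\<close>, so it is a map on the syzygy inside \<open>P n\<close>. It is a
  coboundary when that map extends to \<open>P n\<close>; hence the shift of degree.\<close>

lemma trivial_cohomology_iff_extends:
  assumes res: "projective_resolution R M P d e" and M: "left_module R M" and N: "left_module R N"
  shows "trivial_group (hom_cohomology R P d N (Suc n)) \<longleftrightarrow> extends R (P n) (syzygy P d M e n) N"
proof -
  note s = syzygy_props[OF res M]
  note PL = projective_left_module[OF s(1)]
  have d: "d n \<in> module_hom R (P (Suc n)) (P n)" for n
    by (rule module_hom_expand[OF s(4) submodule_subset[OF s(2)]])
  have im: "d n ` carrier (P (Suc n)) = syzygy P d M e n" for n using s(5)[of n] by simp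
  let ?C = "\<lambda>n. hom_group R (P n) N" and ?\<delta> = "\<lambda>n. hom_precomp (P (Suc n)) (d n)"
  let ?Z = "kernel (?C (Suc n)) (?C (Suc (Suc n))) (?\<delta> (Suc n))" and ?B = "?\<delta> n ` carrier (?C n)"
  have "?Z = {z \<in> carrier (?C (Suc n)). \<forall>x\<in>d (Suc n) ` carrier (P (Suc (Suc n))). z x = \<zero>\<^bsub>N\<^esub>}"
    by (simp add: kernel_hom_precomp)
  then have Z: "?Z = {z \<in> carrier (?C (Suc n)). \<forall>x\<in>carrier (P (Suc n)). d n x = \<zero>\<^bsub>P n\<^esub> \<longrightarrow> z x = \<zero>\<^bsub>N\<^esub>}"
    by (auto simp: im s(6) mem_a_kernel)
  have "?B \<subseteq> ?Z"
    unfolding Z by (rule hom_precomp_image_subset[OF PL PL N d])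
  moreover note gh = hom_precomp_group_hom[OF PL PL N d]
  ultimately have "trivial_group (hom_cohomology R P d N (Suc n)) \<longleftrightarrow> ?Z \<subseteq> ?B"
    unfolding hom_cohomology_def Let_def nat.case
    by (intro trivial_quotient_iff hom_group_comm_group PL N group_hom.subgroup_kernel[OF gh]
        group_hom.img_is_subgroup[OF gh])
  then show ?thesis
    unfolding Z extends_iff_hom_precomp_image[OF PL PL N d, symmetric] im .
qed

text \<open>All that is known of the resolution behind \<open>Ext\<close> is that it is one, and its
  terms have their own element type; it is therefore handed out by \<open>obtains\<close>, to be
  compared with other resolutions.\<close>

lemma Ext_trivial_iff_extends:
  fixes R :: "('r, 'k) ring_scheme" and M :: "('r, 'm, 'e) module_scheme"
  assumes M: "left_module R M" and N: "left_module R N"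
  obtains P :: "nat \<Rightarrow> ('r, ('r, 'm) resolvent) module" and d e where "projective_resolution R M P d e"
    "(\<forall>i>0. trivial_group (Ext R i M N)) \<longleftrightarrow> (\<forall>n. extends R (P n) (syzygy P d M e n) N)"
proof -
  obtain P d e where c: "chosen_resolution R M = (P, d, e)" by (metis prod_cases3)
  obtain P' d' e' where "case (P' :: nat \<Rightarrow> ('r, ('r, 'm) resolvent) module, d', e') of
      (P, d, e) \<Rightarrow> projective_resolution R M P d e"
    using projective_resolution_exists[OF M] by auto
  then have "case chosen_resolution R M of (P, d, e) \<Rightarrow> projective_resolution R M P d e"
    unfolding chosen_resolution_def by (rule someI)
  then have res: "projective_resolution R M P d e" by (simp add: c)
  have "(\<forall>i>0. trivial_group (Ext R i M N)) \<longleftrightarrow> (\<forall>n. trivial_group (hom_cohomology R P d N (Suc n)))"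
    unfolding Ext_def c by (auto simp: gr0_conv_Suc)
  then show ?thesis
    using that[OF res] trivial_cohomology_iff_extends[OF res M N] by simp
qed

section \<open>Coresolutions of direct summands\<close>

text \<open>Taken as an image from the left, so that index 0 is the embedded copy of
  \<open>M\<close> inside \<open>C 0\<close> and index n lies inside \<open>C n\<close>; by
  exactness it is also the kernel of \<open>d n\<close>.\<close>

definition cosyzygy :: "(nat \<Rightarrow> ('r, 'c) module) \<Rightarrow> (nat \<Rightarrow> 'c \<Rightarrow> 'c) \<Rightarrow> ('r, 'm, 'e) module_scheme \<Rightarrow>
    ('m \<Rightarrow> 'c) \<Rightarrow> nat \<Rightarrow> 'c set"
  where "cosyzygy C d M e n = (case n of 0 \<Rightarrow> e ` carrier M | Suc k \<Rightarrow> d k ` carrier (C k))"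

lemma cosyzygy_props:
  assumes "coresolution R M C d e"
  shows "left_module R (C n)" "d n \<in> module_hom R (C n) (C (Suc n))"
    "a_kernel (C n) (C (Suc n)) (d n) = cosyzygy C d M e n"
    "d n ` carrier (C n) = cosyzygy C d M e (Suc n)"
    "e \<in> module_hom R M (C 0)" "inj_on e (carrier M)" "e ` carrier M = cosyzygy C d M e 0"
    "submodule (cosyzygy C d M e n) R (C n)"
proof -
  show C: "left_module R (C n)" and d: "d n \<in> module_hom R (C n) (C (Suc n))"
    and "e \<in> module_hom R M (C 0)" "inj_on e (carrier M)" for n
    using assms by (auto simp: coresolution_def)
  show ker: "a_kernel (C n) (C (Suc n)) (d n) = cosyzygy C d M e n"
    using assms by (cases n) (simp_all add: coresolution_def cosyzygy_def)
  show "d n ` carrier (C n) = cosyzygy C d M e (Suc n)" "e ` carrier M = cosyzygy C d M e 0"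
    by (simp_all add: cosyzygy_def)
  show "submodule (cosyzygy C d M e n) R (C n)"
    using submodule_kernel[OF C[of n] C[of "Suc n"] d[of n]] by (simp add: ker)
qed

text \<open>Maps on \<open>C n\<close> that vanish on the preceding image are maps on the cosyzygy
  inside \<open>C (Suc n)\<close>, so exactness at Hom(C n, N) is an extension property for
  \<open>C (Suc n)\<close>. Surjectivity onto Hom(M, N) is the one for \<open>C 0\<close>.\<close>

lemma hom_into_exact_iff_extends:
  assumes res: "coresolution R M C d e" and M: "left_module R M" and N: "left_module R N"
  shows "hom_into_exact R M C d e N \<longleftrightarrow> (\<forall>n. extends R (C n) (cosyzygy C d M e n) N)"
proof -
  interpret N: left_module R N by fact
  note s = cosyzygy_props[OF res]
  let ?H = "\<lambda>n. hom_group R (C n) N"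
  have e0: "e x = \<zero>\<^bsub>C 0\<^esub> \<longleftrightarrow> x = \<zero>\<^bsub>M\<^esub>" if "x \<in> carrier M" for x
    using module_hom_zero[OF M s(1,5)] inj_onD[OF s(6), of x "\<zero>\<^bsub>M\<^esub>"] that
      abelian_monoid.zero_closed[OF abelian_group.axioms(1)[OF left_module.axioms(2)[OF M]]] by auto
  have zM: "z \<zero>\<^bsub>M\<^esub> = \<zero>\<^bsub>N\<^esub>" if "z \<in> carrier (hom_group R M N)" for z
    using that module_hom_zero[OF M N, of z] by (simp add: hom_group_def)
  \<comment> \<open>Injectivity of \<open>e\<close> leaves only zero in its kernel, which makes the
    vanishing condition automatic.\<close>
  have eqM: "{z \<in> carrier (hom_group R M N). \<forall>x\<in>carrier M. e x = \<zero>\<^bsub>C 0\<^esub> \<longrightarrow> z x = \<zero>\<^bsub>N\<^esub>} =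
      carrier (hom_group R M N)"
    using zM by (auto simp: e0)
  have ker0: "kernel (?H 0) (hom_group R M N) (hom_precomp M e) =
      {z \<in> carrier (?H 0). \<forall>x\<in>carrier (C 0). d 0 x = \<zero>\<^bsub>C (Suc 0)\<^esub> \<longrightarrow> z x = \<zero>\<^bsub>N\<^esub>}"
  proof -
    have "kernel (?H 0) (hom_group R M N) (hom_precomp M e) =
        {z \<in> carrier (?H 0). \<forall>x\<in>e ` carrier M. z x = \<zero>\<^bsub>N\<^esub>}"
      by (simp add: kernel_hom_precomp)
    then show ?thesis
      unfolding s(7) s(3)[symmetric] by (auto simp: mem_a_kernel)
  qed
  have ker: "kernel (?H (Suc n)) (?H n) (hom_precomp (C n) (d n)) =
      {z \<in> carrier (?H (Suc n)). \<forall>x\<in>carrier (C (Suc n)). d (Suc n) x = \<zero>\<^bsub>C (Suc (Suc n))\<^esub> \<longrightarrow> z x = \<zero>\<^bsub>N\<^esub>}" for n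
  proof -
    have "kernel (?H (Suc n)) (?H n) (hom_precomp (C n) (d n)) =
        {z \<in> carrier (?H (Suc n)). \<forall>x\<in>d n ` carrier (C n). z x = \<zero>\<^bsub>N\<^esub>}"
      by (simp add: kernel_hom_precomp)
    then show ?thesis
      unfolding s(4) s(3)[symmetric] by (auto simp: mem_a_kernel)
  qed
  have eq: "A = B \<longleftrightarrow> B \<subseteq> A" if "A \<subseteq> B" for A B :: "('x \<Rightarrow> 'y) set" using that by auto
  have "hom_into_exact R M C d e N \<longleftrightarrow>
      extends R (C 0) (cosyzygy C d M e 0) N \<and> (\<forall>n. extends R (C (Suc n)) (cosyzygy C d M e (Suc n)) N)"
  proof -
    note sub = hom_precomp_image_subset[OF M s(1) N s(5)] hom_precomp_image_subset[OF s(1) s(1) N s(2)]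
    note ext = extends_iff_hom_precomp_image[OF M s(1) N s(5), unfolded s(7)]
      extends_iff_hom_precomp_image[OF s(1) s(1) N s(2), unfolded s(4)]
    have 1: "hom_precomp M e ` carrier (?H 0) = carrier (hom_group R M N) \<longleftrightarrow>
        extends R (C 0) (cosyzygy C d M e 0) N"
      unfolding ext(1) using eq[OF sub(1)] unfolding eqM .
    have 2: "hom_precomp (C n) (d n) ` carrier (?H (Suc n)) =
        {z \<in> carrier (?H n). \<forall>x\<in>carrier (C n). d n x = \<zero>\<^bsub>C (Suc n)\<^esub> \<longrightarrow> z x = \<zero>\<^bsub>N\<^esub>} \<longleftrightarrow>
        extends R (C (Suc n)) (cosyzygy C d M e (Suc n)) N" for n
      unfolding ext(2) by (rule eq[OF sub(2)])
    show ?thesis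
      unfolding hom_into_exact_def One_nat_def ker0 ker 1 2
      by (metis not0_implies_Suc)
  qed
  also have "\<dots> \<longleftrightarrow> (\<forall>n. extends R (C n) (cosyzygy C d M e n) N)"
    by (metis not0_implies_Suc)
  finally show ?thesis .
qed

section \<open>Passing to a summand of the coresolved module\<close>

lemma extends_factors:
  assumes C: "left_module R C" and H: "submodule H R C" and N: "left_module R N" and L: "left_module R L"
    and ext: "extends R C H T" and f: "f \<in> module_hom R (C\<lparr>carrier := H\<rparr>) N"
    and h: "factors R T N L h"
  shows "\<exists>g \<in> module_hom R C L. \<forall>x\<in>H. g x = h (f x)"
  using h
proof induction
  case (zero h)
  then show ?case
    using module_hom_closed[OF f] by (intro bexI[OF _ module_hom_zero_map[OF L]]) simp
next
  case (step h s p h')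
  then obtain g where g: "g \<in> module_hom R C L" "\<And>x. x \<in> H \<Longrightarrow> g x = h (f x)" by metis
  \<comment> \<open>One component into \<open>T\<close> is extended at a time; composing with
    \<open>p\<close> and adding then gives the extension into \<open>L\<close>.\<close>
  obtain k where k: "k \<in> module_hom R C T" "\<And>x. x \<in> H \<Longrightarrow> k x = s (f x)"
    using extendsD[OF ext module_hom_compose[OF f step(2)]] by metis
  show ?case
    using module_hom_closed[OF f] g(2) k(2)
    by (intro bexI[OF _ module_hom_plus[OF L g(1) module_hom_compose[OF k(1) step(3)]]]) (simp add: step(4))
qed

text \<open>
  \<open>\<epsilon>\<close> is idempotent on \<open>H\<close>, and \<open>\<epsilon> H\<close> is the module being coresolved. With \<open>\<phi> : D \<rightarrow> D\<close> extending \<open>\<epsilon>\<close>, take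
  \<open>D' = C \<oplus> D\<close>, \<open>H' = G \<oplus> D\<close>, \<open>\<mu> x = (\<delta> x, x - \<phi> x)\<close> and \<open>\<epsilon>' (\<delta> x, y) = \<mu> (\<phi> x + y)\<close>.
\<close>

lemma relative_coresolution_step:
  fixes R :: "('r, 'k) ring_scheme" and T :: "('r, 't, 'e) module_scheme"
    and D :: "('r, nat \<Rightarrow> 't) module" and C :: "('r, 'c) module"
  assumes T: "left_module R T" and addD: "in_add R T D" and H: "submodule H R D"
    and extD: "extends R D H T"
    and \<epsilon>: "\<epsilon> \<in> module_hom R (D\<lparr>carrier := H\<rparr>) (D\<lparr>carrier := H\<rparr>)"
    and idem: "\<And>x. x \<in> H \<Longrightarrow> \<epsilon> (\<epsilon> x) = \<epsilon> x"
    and \<delta>: "\<delta> \<in> module_hom R D C" and ker\<delta>: "a_kernel D C \<delta> = H" and im\<delta>: "\<delta> ` carrier D = G"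
    and addC: "factors R T C C (\<lambda>x. x)" and C: "left_module R C" and C': "left_module R C'"
    and d: "d \<in> module_hom R C C'" and kerd: "a_kernel C C' d = G" and extC: "extends R C G T"
  shows "\<exists>(D' :: ('r, nat \<Rightarrow> 't) module) H' \<epsilon>' \<delta>' \<mu>. in_add R T D' \<and> submodule H' R D' \<and> extends R D' H' T \<and>
    \<epsilon>' \<in> module_hom R (D'\<lparr>carrier := H'\<rparr>) (D'\<lparr>carrier := H'\<rparr>) \<and> (\<forall>x\<in>H'. \<epsilon>' (\<epsilon>' x) = \<epsilon>' x) \<and>
    \<delta>' \<in> module_hom R D' C' \<and> a_kernel D' C' \<delta>' = H' \<and> \<delta>' ` carrier D' = d ` carrier C \<and>
    \<mu> \<in> module_hom R D D' \<and> a_kernel D D' \<mu> = \<epsilon> ` H \<and> \<mu> ` carrier D = \<epsilon>' ` H'"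
proof -
  note iff = in_add_iff_factors[OF T]
  have D: "left_module R D" and fD: "factors R T D D (\<lambda>x. x)" using addD iff by blast+
  interpret D: left_module R D by (rule D)
  interpret C: left_module R C by (rule C)
  note Hc = submodule_subset[OF H]
  obtain D' :: "('r, nat \<Rightarrow> 't) module" and i j q1 q2 where addD': "in_add R T D'"
    and i: "i \<in> module_hom R C D'" and j: "j \<in> module_hom R D D'"
    and q1: "q1 \<in> module_hom R D' C" and q2: "q2 \<in> module_hom R D' D"
    and e1: "\<forall>x\<in>carrier C. q1 (i x) = x \<and> q2 (i x) = \<zero>\<^bsub>D\<^esub>"
    and e2: "\<forall>y\<in>carrier D. q1 (j y) = \<zero>\<^bsub>C\<^esub> \<and> q2 (j y) = y"
    and e3: "\<forall>z\<in>carrier D'. i (q1 z) \<oplus>\<^bsub>D'\<^esub> j (q2 z) = z"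
    using biproduct_in_add[OF C D T addC fD] by (elim exE conjE) (rule that)
  have D': "left_module R D'" using addD' by (simp add: in_add_def)
  interpret D': left_module R D' by (rule D')
  note cl = module_hom_closed[OF i] module_hom_closed[OF j] module_hom_closed[OF q1] module_hom_closed[OF q2]
    module_hom_closed[OF \<delta>]
  have \<epsilon>H: "\<epsilon> x \<in> H" if "x \<in> H" for x using module_hom_closed[OF \<epsilon>] that by simp
  have H_iff: "x \<in> H \<longleftrightarrow> x \<in> carrier D \<and> \<delta> x = \<zero>\<^bsub>C\<^esub>" for x by (simp add: mem_a_kernel flip: ker\<delta>)
  have G_iff: "x \<in> G \<longleftrightarrow> x \<in> carrier C \<and> d x = \<zero>\<^bsub>C'\<^esub>" for x by (simp add: mem_a_kernel flip: kerd)
  have G0: "\<zero>\<^bsub>C\<^esub> \<in> G" using module_hom_zero[OF C C' d] by (simp add: G_iff)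
  have \<delta>G: "\<delta> x \<in> G" if "x \<in> carrier D" for x using that im\<delta> by auto
  \<comment> \<open>The extension property is given for maps into \<open>T\<close>; it applies to
    \<epsilon> because \<open>D\<close> itself lies in add \<open>T\<close>. Nothing forces \<phi>
    to be idempotent outside \<open>H\<close>.\<close>
  obtain \<phi> where \<phi>: "\<phi> \<in> module_hom R D D" and \<phi>\<epsilon>: "\<forall>x\<in>H. \<phi> x = \<epsilon> x"
    using extends_factors[OF D H D D extD module_hom_expand[OF \<epsilon> Hc] fD] by (elim bexE)
  note \<phi>c = module_hom_closed[OF \<phi>]
  define \<mu> where "\<mu> x = i (\<delta> x) \<oplus>\<^bsub>D'\<^esub> j (x \<ominus>\<^bsub>D\<^esub> \<phi> x)" for x
  have \<mu>: "\<mu> \<in> module_hom R D D'"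
    unfolding \<mu>_def
    by (rule module_hom_plus[OF D' module_hom_compose[OF \<delta> i]
          module_hom_compose[OF module_hom_diff[OF D module_hom_ident \<phi>] j]])
  note \<mu>c = module_hom_closed[OF \<mu>]
  have q\<mu>: "q1 (\<mu> x) = \<delta> x" "q2 (\<mu> x) = x \<ominus>\<^bsub>D\<^esub> \<phi> x" if "x \<in> carrier D" for x
    using that cl \<phi>c e1 e2 unfolding \<mu>_def by (simp_all add: module_hom_add[OF q1] module_hom_add[OF q2])
  \<comment> \<open>The first coordinate vanishes exactly on \<open>H\<close>; the second then cuts
    \<open>H\<close> down to the fixed points of the idempotent \<epsilon>, that is, to its
    image.\<close>
  have ker\<mu>: "\<mu> x = \<zero>\<^bsub>D'\<^esub> \<longleftrightarrow> x \<in> \<epsilon> ` H" if x: "x \<in> carrier D" for x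
  proof
    assume "\<mu> x = \<zero>\<^bsub>D'\<^esub>"
    then have "\<delta> x = \<zero>\<^bsub>C\<^esub>" "x \<ominus>\<^bsub>D\<^esub> \<phi> x = \<zero>\<^bsub>D\<^esub>"
      using q\<mu>[OF x] module_hom_zero[OF D' C q1] module_hom_zero[OF D' D q2] by simp_all
    then have "x \<in> H" "x = \<phi> x" using x \<phi>c by (simp_all add: H_iff D.M.minus_eq_zero_iff)
    with \<phi>\<epsilon> show "x \<in> \<epsilon> ` H" by auto
  next
    assume "x \<in> \<epsilon> ` H"
    then obtain y where y: "y \<in> H" "x = \<epsilon> y" by blast
    then have "x \<in> H" "\<phi> x = x" using \<epsilon>H idem \<phi>\<epsilon> by auto
    then show "\<mu> x = \<zero>\<^bsub>D'\<^esub>"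
      using x module_hom_zero[OF C D' i] module_hom_zero[OF D D' j]
      by (simp add: \<mu>_def H_iff)
  qed
  \<comment> \<open>On the kernel \<open>H\<close> of \<delta> the map \<phi> agrees with
    \<epsilon>, whose image is killed by \<mu>; so \<mu> \<phi> descends along \<delta> to
    \<open>G\<close>.\<close>
  have "\<exists>\<kappa>\<in>module_hom R (C\<lparr>carrier := \<delta> ` carrier D\<rparr>) D'. \<forall>x\<in>carrier D. \<kappa> (\<delta> x) = \<mu> (\<phi> x)"
  proof (rule module_hom_factor[OF D C D' module_hom_compose[OF \<phi> \<mu>] \<delta>])
    fix x assume "x \<in> carrier D" "\<delta> x = \<zero>\<^bsub>C\<^esub>"
    then have "x \<in> H" by (simp add: H_iff)
    then show "\<mu> (\<phi> x) = \<zero>\<^bsub>D'\<^esub>" using ker\<mu>[of "\<phi> x"] \<phi>\<epsilon> \<epsilon>H Hc by (auto simp: subset_iff)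
  qed
  then obtain \<kappa> where \<kappa>: "\<kappa> \<in> module_hom R (C\<lparr>carrier := G\<rparr>) D'" and \<kappa>\<delta>: "\<forall>x\<in>carrier D. \<kappa> (\<delta> x) = \<mu> (\<phi> x)"
    unfolding im\<delta> by (elim bexE)
  define H' where "H' = a_kernel D' C' (\<lambda>z. d (q1 z))"
  note \<delta>' = module_hom_compose[OF q1 d]
  have H': "submodule H' R D'" unfolding H'_def by (rule submodule_kernel[OF D' C' \<delta>'])
  have H'_iff: "z \<in> H' \<longleftrightarrow> z \<in> carrier D' \<and> q1 z \<in> G" for z
    using cl by (auto simp: H'_def mem_a_kernel G_iff)
  have H'c: "H' \<subseteq> carrier D'" by (rule submodule_subset[OF H'])
  have q1G: "q1 \<in> module_hom R (D'\<lparr>carrier := H'\<rparr>) (C\<lparr>carrier := G\<rparr>)"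
    by (rule module_hom_sub[OF q1 H'c]) (simp add: H'_iff)
  have jH': "j \<in> module_hom R D (D'\<lparr>carrier := H'\<rparr>)"
    by (rule module_hom_corestrict[OF j]) (use cl e2 G0 in \<open>simp add: H'_iff\<close>)
  have iH': "i \<in> module_hom R (C\<lparr>carrier := G\<rparr>) (D'\<lparr>carrier := H'\<rparr>)"
    by (rule module_hom_sub[OF i]) (use cl e1 in \<open>auto simp: H'_iff G_iff\<close>)
  have \<mu>H': "\<mu> x \<in> H'" if "x \<in> carrier D" for x
    using that \<mu>c q\<mu> \<delta>G by (simp add: H'_iff)
  define \<epsilon>' where "\<epsilon>' z = \<kappa> (q1 z) \<oplus>\<^bsub>D'\<^esub> \<mu> (q2 z)" for z
  have \<epsilon>': "\<epsilon>' \<in> module_hom R (D'\<lparr>carrier := H'\<rparr>) D'"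
    unfolding \<epsilon>'_def
    by (rule module_hom_plus[OF D' module_hom_compose[OF q1G \<kappa>]
          module_hom_compose[OF module_hom_restrict[OF q2 H'c] \<mu>]])
  have \<epsilon>'im: "\<exists>x\<in>carrier D. \<epsilon>' z = \<mu> x" if zH: "z \<in> H'" for z
  proof -
    obtain x where x: "x \<in> carrier D" "q1 z = \<delta> x" using zH im\<delta> by (auto simp: H'_iff)
    have z: "q2 z \<in> carrier D" using zH cl by (simp add: H'_iff)
    have "\<epsilon>' z = \<mu> (\<phi> x \<oplus>\<^bsub>D\<^esub> q2 z)"
      using x z \<kappa>\<delta> \<phi>c by (simp add: \<epsilon>'_def module_hom_add[OF \<mu>])
    then show ?thesis using x z \<phi>c by blast
  qed
  \<comment> \<open>The pair (\<delta> x, x - \<phi> x) is sent to \<mu> (\<phi> x + (x - \<phi>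
    x)). Since \<epsilon>' also maps into the image of \<mu>, it is idempotent with exactly that
    image.\<close>
  have \<epsilon>'\<mu>: "\<epsilon>' (\<mu> x) = \<mu> x" if x: "x \<in> carrier D" for x
  proof -
    have "\<epsilon>' (\<mu> x) = \<mu> (\<phi> x \<oplus>\<^bsub>D\<^esub> (x \<ominus>\<^bsub>D\<^esub> \<phi> x))"
      using x \<kappa>\<delta> \<phi>c by (simp add: \<epsilon>'_def q\<mu> module_hom_add[OF \<mu>])
    also have "\<phi> x \<oplus>\<^bsub>D\<^esub> (x \<ominus>\<^bsub>D\<^esub> \<phi> x) = x"
      using x \<phi>c by (simp add: a_minus_def D.M.a_lcomm D.M.r_neg)
    finally show ?thesis .
  qed
  have \<epsilon>'H': "\<epsilon>' \<in> module_hom R (D'\<lparr>carrier := H'\<rparr>) (D'\<lparr>carrier := H'\<rparr>)"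
    by (rule module_hom_corestrict[OF \<epsilon>']) (use \<epsilon>'im \<mu>H' in fastforce)
  \<comment> \<open>Inside \<open>H'\<close> the summand \<open>D\<close> is already complete, so
    only the component on \<open>G\<close> has to be extended.\<close>
  have "extends R D' H' T"
    unfolding extends_def
  proof
    fix f assume f: "f \<in> module_hom R (D'\<lparr>carrier := H'\<rparr>) T"
    obtain g where g: "g \<in> module_hom R C T" "\<And>x. x \<in> G \<Longrightarrow> g x = f (i x)"
      using extendsD[OF extC module_hom_compose[OF iH' f]] by metis
    have "g (q1 z) \<oplus>\<^bsub>T\<^esub> f (j (q2 z)) = f z" if z: "z \<in> H'" for z
    proof -
      have "i (q1 z) \<in> H'" "j (q2 z) \<in> H'" "z \<in> carrier D'"
        using z cl module_hom_closed[OF iH', of "q1 z"] module_hom_closed[OF jH', of "q2 z"] by (auto simp: H'_iff)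
      then have "f (i (q1 z)) \<oplus>\<^bsub>T\<^esub> f (j (q2 z)) = f z"
        using module_hom_add[OF f, of "i (q1 z)" "j (q2 z)"] e3 by simp
      then show ?thesis using g(2)[of "q1 z"] z by (simp add: H'_iff)
    qed
    then show "\<exists>h\<in>module_hom R D' T. \<forall>x\<in>H'. h x = f x"
      by (intro bexI[OF _ module_hom_plus[OF T module_hom_compose[OF q1 g(1)]
              module_hom_compose[OF q2 module_hom_compose[OF jH' f]]]]) simp
  qed
  moreover have "(\<lambda>z. d (q1 z)) ` carrier D' = d ` carrier C"
    using cl e1 by (auto intro!: image_eqI[of _ _ "i _"])
  moreover have "\<forall>x\<in>H'. \<epsilon>' (\<epsilon>' x) = \<epsilon>' x" using \<epsilon>'im \<epsilon>'\<mu> by fastforce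
  moreover have "a_kernel D D' \<mu> = \<epsilon> ` H"
  proof -
    have "\<epsilon> ` H \<subseteq> carrier D" using Hc \<epsilon>H by auto
    then show ?thesis using ker\<mu> by (auto simp: mem_a_kernel simp del: image_iff)
  qed
  moreover have "\<mu> ` carrier D = \<epsilon>' ` H'"
  proof
    show "\<mu> ` carrier D \<subseteq> \<epsilon>' ` H'" 
    proof (rule image_subsetI)
      fix x assume x: "x \<in> carrier D"
      show "\<mu> x \<in> \<epsilon>' ` H'" using imageI[OF \<mu>H'[OF x], of \<epsilon>'] \<epsilon>'\<mu>[OF x] by simp
    qed
    show "\<epsilon>' ` H' \<subseteq> \<mu> ` carrier D" using \<epsilon>'im by fastforce
  qed
  ultimately show ?thesis
    using addD' H' \<epsilon>'H' \<delta>' \<mu> H'_def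
    by (intro exI[of _ D'] exI[of _ H'] exI[of _ \<epsilon>'] exI[of _ "\<lambda>z. d (q1 z)"] exI[of _ \<mu>]) simp
qed


text \<open>The n-th term of the new coresolution is isomorphic to the direct sum of
  \<open>C 0\<close>, ..., \<open>C n\<close>: each step adjoins the previous term in order to
  absorb the failure of the extended idempotent to be idempotent.\<close>

lemma relative_coresolution_retract:
  fixes R :: "('r, 'k) ring_scheme" and T :: "('r, 't, 'e) module_scheme"
    and C :: "nat \<Rightarrow> ('r, 'c) module" and M :: "('r, 'm, 'f) module_scheme"
  assumes res: "coresolution R G C d e" and G: "left_module R G" and T: "left_module R T"
    and addC: "\<And>n. factors R T (C n) (C n) (\<lambda>x. x)"
    and ext: "\<And>n. extends R (C n) (cosyzygy C d G e n) T"
    and M: "left_module R M" and s: "s \<in> module_hom R M G" and p: "p \<in> module_hom R G M"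
    and ps: "\<And>x. x \<in> carrier M \<Longrightarrow> p (s x) = x"
  shows "\<exists>(D :: nat \<Rightarrow> ('r, nat \<Rightarrow> 't) module) d' e'.
    coresolution R M D d' e' \<and> (\<forall>n. in_add R T (D n)) \<and> hom_into_exact R M D d' e' T"
proof -
  note iff = in_add_iff_factors[OF T]
  note c = cosyzygy_props[OF res]
  let ?K = "cosyzygy C d G e"
  \<comment> \<open>The image of \<open>H\<close> under \<epsilon> is the current cosyzygy of
    \<open>M\<close>, while \<delta> identifies the quotient of \<open>D\<close> by \<open>H\<close>
    with the cosyzygy of \<open>G\<close> inside \<open>C (Suc n)\<close>; this second part lets the
    given coresolution drive the next step.\<close>
  define ok where "ok n st \<longleftrightarrow> (case st of (D, H, \<epsilon>, \<delta>) \<Rightarrow>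
      in_add R T D \<and> submodule H R D \<and> extends R D H T \<and>
      \<epsilon> \<in> module_hom R (D\<lparr>carrier := H\<rparr>) (D\<lparr>carrier := H\<rparr>) \<and> (\<forall>x\<in>H. \<epsilon> (\<epsilon> x) = \<epsilon> x) \<and>
      \<delta> \<in> module_hom R D (C (Suc n)) \<and> a_kernel D (C (Suc n)) \<delta> = H \<and> \<delta> ` carrier D = ?K (Suc n))"
    for n and st :: "('r, nat \<Rightarrow> 't) module \<times> (nat \<Rightarrow> 't) set \<times> ((nat \<Rightarrow> 't) \<Rightarrow> nat \<Rightarrow> 't) \<times> ((nat \<Rightarrow> 't) \<Rightarrow> 'c)"
  define link where "link st st' \<mu> \<longleftrightarrow> (case st of (D, H, \<epsilon>, \<delta>) \<Rightarrow> case st' of (D', H', \<epsilon>', \<delta>') \<Rightarrow>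
      \<mu> \<in> module_hom R D D' \<and> a_kernel D D' \<mu> = \<epsilon> ` H \<and> \<mu> ` carrier D = \<epsilon>' ` H')"
    for st st' :: "('r, nat \<Rightarrow> 't) module \<times> (nat \<Rightarrow> 't) set \<times> ((nat \<Rightarrow> 't) \<Rightarrow> nat \<Rightarrow> 't) \<times> ((nat \<Rightarrow> 't) \<Rightarrow> 'c)" and \<mu>
  have step: "\<exists>st'. ok (Suc n) st' \<and> (\<exists>\<mu>. link st st' \<mu>)" if st: "ok n st" for n st
  proof -
    obtain D H \<epsilon> \<delta> where st_eq: "st = (D, H, \<epsilon>, \<delta>)" by (metis prod_cases4)
    from st have a: "in_add R T D" "submodule H R D" "extends R D H T"
      "\<epsilon> \<in> module_hom R (D\<lparr>carrier := H\<rparr>) (D\<lparr>carrier := H\<rparr>)" "\<And>x. x \<in> H \<Longrightarrow> \<epsilon> (\<epsilon> x) = \<epsilon> x"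
      "\<delta> \<in> module_hom R D (C (Suc n))" "a_kernel D (C (Suc n)) \<delta> = H" "\<delta> ` carrier D = ?K (Suc n)"
      by (auto simp: ok_def st_eq)
    have "\<exists>(D' :: ('r, nat \<Rightarrow> 't) module) H' \<epsilon>' \<delta>' \<mu>. in_add R T D' \<and> submodule H' R D' \<and> extends R D' H' T \<and>
      \<epsilon>' \<in> module_hom R (D'\<lparr>carrier := H'\<rparr>) (D'\<lparr>carrier := H'\<rparr>) \<and> (\<forall>x\<in>H'. \<epsilon>' (\<epsilon>' x) = \<epsilon>' x) \<and>
      \<delta>' \<in> module_hom R D' (C (Suc (Suc n))) \<and> a_kernel D' (C (Suc (Suc n))) \<delta>' = H' \<and>
      \<delta>' ` carrier D' = d (Suc n) ` carrier (C (Suc n)) \<and>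
      \<mu> \<in> module_hom R D D' \<and> a_kernel D D' \<mu> = \<epsilon> ` H \<and> \<mu> ` carrier D = \<epsilon>' ` H'"
      by (rule relative_coresolution_step[OF T a(1-4) _ a(6-8) addC c(1) c(1) c(2) c(3) ext]) (rule a(5))
    then obtain D' :: "('r, nat \<Rightarrow> 't) module" and H' \<epsilon>' \<delta>' \<mu> where b: "in_add R T D' \<and> submodule H' R D' \<and> extends R D' H' T \<and>
      \<epsilon>' \<in> module_hom R (D'\<lparr>carrier := H'\<rparr>) (D'\<lparr>carrier := H'\<rparr>) \<and> (\<forall>x\<in>H'. \<epsilon>' (\<epsilon>' x) = \<epsilon>' x) \<and>
      \<delta>' \<in> module_hom R D' (C (Suc (Suc n))) \<and> a_kernel D' (C (Suc (Suc n))) \<delta>' = H' \<and>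
      \<delta>' ` carrier D' = d (Suc n) ` carrier (C (Suc n)) \<and>
      \<mu> \<in> module_hom R D D' \<and> a_kernel D D' \<mu> = \<epsilon> ` H \<and> \<mu> ` carrier D = \<epsilon>' ` H'"
      by (elim exE) (rule that)
    then have "ok (Suc n) (D', H', \<epsilon>', \<delta>')" "link st (D', H', \<epsilon>', \<delta>') \<mu>"
      by (simp_all add: ok_def link_def st_eq c(4))
    then show ?thesis by blast
  qed
  \<comment> \<open>The start is a copy of \<open>C 0\<close> on the required element type.
    \<open>H0\<close> is the copy of \<open>G\<close> in it, and \<sigma> \<rho> is the idempotent
    of \<open>G\<close> with image \<open>M\<close>.\<close>
  obtain D0 :: "('r, nat \<Rightarrow> 't) module" and i q where addD0: "in_add R T D0"
    and i: "i \<in> module_hom R (C 0) D0" and q: "q \<in> module_hom R D0 (C 0)"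
    and qi: "\<forall>x\<in>carrier (C 0). q (i x) = x" and iq: "\<forall>y\<in>carrier D0. i (q y) = y"
    using factors_id_realize[OF c(1)[of 0] T addC[of 0]] by (elim exE conjE) (rule that)
  have D0: "left_module R D0" using addD0 by (simp add: in_add_def)
  note \<delta>0 = module_hom_compose[OF q c(2)]
  define H0 where "H0 = a_kernel D0 (C (Suc 0)) (\<lambda>z. d 0 (q z))"
  have H0: "submodule H0 R D0" unfolding H0_def by (rule submodule_kernel[OF D0 c(1) \<delta>0])
  have H0c: "H0 \<subseteq> carrier D0" by (rule submodule_subset[OF H0])
  have Kc: "?K 0 \<subseteq> carrier (C 0)" by (rule submodule_subset[OF c(8)])
  have H0_iff: "z \<in> H0 \<longleftrightarrow> z \<in> carrier D0 \<and> q z \<in> ?K 0" for z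
    using module_hom_closed[OF q] by (auto simp: H0_def mem_a_kernel simp flip: c(3))
  have iH0: "i \<in> module_hom R (C 0\<lparr>carrier := ?K 0\<rparr>) (D0\<lparr>carrier := H0\<rparr>)"
    by (rule module_hom_sub[OF i Kc]) (use Kc module_hom_closed[OF i] qi in \<open>auto simp: H0_iff\<close>)
  have qH0: "q \<in> module_hom R (D0\<lparr>carrier := H0\<rparr>) (C 0\<lparr>carrier := ?K 0\<rparr>)"
    by (rule module_hom_sub[OF q H0c]) (simp add: H0_iff)
  have eK: "e \<in> module_hom R G (C 0\<lparr>carrier := ?K 0\<rparr>)"
    by (rule module_hom_corestrict[OF c(5)]) (simp flip: c(7))
  define r where "r = inv_into (carrier G) e"
  have bij: "bij_betw e (carrier G) (carrier (C 0\<lparr>carrier := ?K 0\<rparr>))"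
    using c(6,7) by (simp add: bij_betw_def)
  have r: "r \<in> module_hom R (C 0\<lparr>carrier := ?K 0\<rparr>) G"
    unfolding r_def by (rule module_hom_inverse[OF G eK bij])
  have re: "r (e x) = x" if "x \<in> carrier G" for x using that c(6) by (simp add: r_def)
  define \<sigma> where "\<sigma> x = i (e (s x))" for x
  define \<rho> where "\<rho> z = p (r (q z))" for z
  have \<sigma>: "\<sigma> \<in> module_hom R M (D0\<lparr>carrier := H0\<rparr>)"
    unfolding \<sigma>_def by (rule module_hom_compose[OF module_hom_compose[OF s eK] iH0])
  have \<rho>: "\<rho> \<in> module_hom R (D0\<lparr>carrier := H0\<rparr>) M"
    unfolding \<rho>_def by (rule module_hom_compose[OF module_hom_compose[OF qH0 r] p])
  have \<rho>\<sigma>: "\<rho> (\<sigma> x) = x" if "x \<in> carrier M" for x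
    using module_hom_closed[OF s that] module_hom_closed[OF c(5), of "s x"] qi
    by (simp add: \<rho>_def \<sigma>_def re ps[OF that])
  let ?s0 = "(D0, H0, \<lambda>z. \<sigma> (\<rho> z), \<lambda>z. d 0 (q z))"
  have im0: "(\<lambda>z. \<sigma> (\<rho> z)) ` H0 = \<sigma> ` carrier M"
    using module_hom_closed[OF \<rho>] module_hom_closed[OF \<sigma>] \<rho>\<sigma>
    by (auto intro!: image_eqI[of _ "\<lambda>z. \<sigma> (\<rho> z)" "\<sigma> _"])
  have "extends R D0 H0 T"
    unfolding extends_def
  proof
    fix f assume f: "f \<in> module_hom R (D0\<lparr>carrier := H0\<rparr>) T"
    obtain g where g: "g \<in> module_hom R (C 0) T" "\<And>x. x \<in> ?K 0 \<Longrightarrow> g x = f (i x)"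
      using extendsD[OF ext module_hom_compose[OF iH0 f]] by metis
    then show "\<exists>h\<in>module_hom R D0 T. \<forall>x\<in>H0. h x = f x"
      using iq by (intro bexI[OF _ module_hom_compose[OF q g(1)]]) (simp add: H0_iff)
  qed
  moreover have "(\<lambda>z. d 0 (q z)) ` carrier D0 = ?K (Suc 0)"
    using module_hom_closed[OF q] module_hom_closed[OF i] qi
    by (auto simp: c(4)[symmetric] intro!: image_eqI[of _ _ "i _"])
  ultimately have ok0: "ok 0 ?s0"
    using addD0 H0 module_hom_compose[OF \<rho> \<sigma>] module_hom_closed[OF \<rho>] \<rho>\<sigma> \<delta>0
    by (simp add: ok_def H0_def)
  have "\<exists>s. \<forall>n. (ok n (s n) \<and> (n = 0 \<longrightarrow> s n = ?s0)) \<and> (\<exists>\<mu>. link (s n) (s (Suc n)) \<mu>)"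
  proof (rule dependent_nat_choice)
    show "\<exists>x. ok 0 x \<and> (0 = (0::nat) \<longrightarrow> x = ?s0)" using ok0 by blast
    show "\<exists>t. (ok (Suc n) t \<and> (Suc n = 0 \<longrightarrow> t = ?s0)) \<and> (\<exists>\<mu>. link st t \<mu>)"
      if "ok n st \<and> (n = 0 \<longrightarrow> st = ?s0)" for st n
      using step[of n st] that by simp
  qed
  then obtain S where okS: "\<And>n. ok n (S n)" and S0: "S 0 = ?s0" and "\<And>n. \<exists>\<mu>. link (S n) (S (Suc n)) \<mu>"
    by metis
  then obtain \<mu> where linkS: "\<And>n. link (S n) (S (Suc n)) (\<mu> n)" by metis
  define D H \<epsilon> where "D n = fst (S n)" and "H n = fst (snd (S n))" and "\<epsilon> n = fst (snd (snd (S n)))" for n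
  have D: "in_add R T (D n)" "left_module R (D n)" and H: "submodule (H n) R (D n)" and extD: "extends R (D n) (H n) T"
    and \<epsilon>: "\<epsilon> n \<in> module_hom R (D n\<lparr>carrier := H n\<rparr>) (D n\<lparr>carrier := H n\<rparr>)"
    and idem: "x \<in> H n \<Longrightarrow> \<epsilon> n (\<epsilon> n x) = \<epsilon> n x" for n x
    using okS[of n] by (auto simp: ok_def D_def H_def \<epsilon>_def case_prod_beta in_add_def)
  have \<mu>: "\<mu> n \<in> module_hom R (D n) (D (Suc n))" "a_kernel (D n) (D (Suc n)) (\<mu> n) = \<epsilon> n ` H n"
    "\<mu> n ` carrier (D n) = \<epsilon> (Suc n) ` H (Suc n)" for n
    using linkS[of n] by (auto simp: link_def D_def H_def \<epsilon>_def case_prod_beta)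
  have zero: "D 0 = D0" "H 0 = H0" "\<epsilon> 0 ` H 0 = \<sigma> ` carrier M"
    using im0 by (simp_all add: D_def H_def \<epsilon>_def S0)
  have cores: "coresolution R M D \<mu> \<sigma>"
    using D \<mu> module_hom_expand[OF \<sigma> H0c] inj_on_inverseI[of "carrier M" \<rho> \<sigma>, OF \<rho>\<sigma>] zero(3) \<mu>(2)[of 0]
    by (simp add: coresolution_def zero(1))
  have cos: "cosyzygy D \<mu> M \<sigma> n = \<epsilon> n ` H n" for n
    by (cases n) (simp_all add: cosyzygy_def zero(3) \<mu>(3))
  \<comment> \<open>A map on the image of \<epsilon> is first pulled back to \<open>H n\<close>
    along \<epsilon>, then extended; on the image the pullback changes nothing because \<epsilon> is
    idempotent.\<close>
  have "extends R (D n) (\<epsilon> n ` H n) T" for n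
    unfolding extends_def
  proof
    fix f assume f: "f \<in> module_hom R (D n\<lparr>carrier := \<epsilon> n ` H n\<rparr>) T"
    have "\<epsilon> n \<in> module_hom R (D n\<lparr>carrier := H n\<rparr>) (D n\<lparr>carrier := \<epsilon> n ` H n\<rparr>)"
      using module_hom_corestrict[OF \<epsilon>[of n], of "\<epsilon> n ` H n"] by simp
    from module_hom_compose[OF this f]
    obtain g where g: "g \<in> module_hom R (D n) T" "\<And>x. x \<in> H n \<Longrightarrow> g x = f (\<epsilon> n x)"
      using extendsD[OF extD] by metis
    have "g x = f x" if "x \<in> \<epsilon> n ` H n" for x
      using that g(2)[of x] idem module_hom_closed[OF \<epsilon>[of n]] by auto
    then show "\<exists>g\<in>module_hom R (D n) T. \<forall>x\<in>\<epsilon> n ` H n. g x = f x"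
      by (intro bexI[OF _ g(1)]) simp
  qed
  then have "hom_into_exact R M D \<mu> \<sigma> T"
    using hom_into_exact_iff_extends[OF cores M T] by (simp add: cos)
  with cores D(1) show ?thesis by (intro exI[of _ D] exI[of _ \<mu>] exI[of _ \<sigma>]) simp
qed

section \<open>Induced modules\<close>

lemma restrict_scalars_simps [simp]:
  "carrier (restrict_scalars \<iota> M) = carrier M" "\<zero>\<^bsub>restrict_scalars \<iota> M\<^esub> = \<zero>\<^bsub>M\<^esub>"
  "x \<oplus>\<^bsub>restrict_scalars \<iota> M\<^esub> y = x \<oplus>\<^bsub>M\<^esub> y" "r \<odot>\<^bsub>restrict_scalars \<iota> M\<^esub> x = \<iota> r \<odot>\<^bsub>M\<^esub> x"
  "(restrict_scalars \<iota> M)\<lparr>carrier := H\<rparr> = restrict_scalars \<iota> (M\<lparr>carrier := H\<rparr>)"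
  by (simp_all add: restrict_scalars_def)

section \<open>The tensor product as cosets in a free abelian group\<close>

locale ring_extension_module =
  fixes R :: "('r, 'k) ring_scheme" and A :: "('a, 'l) ring_scheme" and \<iota> :: "'r \<Rightarrow> 'a"
    and T :: "('r, 't, 'e) module_scheme"
  assumes ext: "ring_extension R A \<iota>" and T: "left_module R T"
begin

sublocale R: ring R using ext by (simp add: ring_extension_def)
sublocale A: ring A using ext by (simp add: ring_extension_def)
sublocale T: left_module R T by (rule T)

lemma \<iota>_closed [simp]: "r \<in> carrier R \<Longrightarrow> \<iota> r \<in> carrier A"
  and \<iota>_mult: "r \<in> carrier R \<Longrightarrow> s \<in> carrier R \<Longrightarrow> \<iota> (r \<otimes>\<^bsub>R\<^esub> s) = \<iota> r \<otimes>\<^bsub>A\<^esub> \<iota> s"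
  and \<iota>_add: "r \<in> carrier R \<Longrightarrow> s \<in> carrier R \<Longrightarrow> \<iota> (r \<oplus>\<^bsub>R\<^esub> s) = \<iota> r \<oplus>\<^bsub>A\<^esub> \<iota> s"
  and \<iota>_one [simp]: "\<iota> \<one>\<^bsub>R\<^esub> = \<one>\<^bsub>A\<^esub>"
  using ext by (auto simp: ring_extension_def ring_hom_def)

abbreviation free_group ("F") where "F \<equiv> free_Abelian_group (carrier A \<times> carrier T)"
definition relations ("Rel") where "Rel = tensor_relations R (ring_bimodule id A \<iota>) T"
definition induced ("U") where "U = induced_module R A \<iota> T"

definition relation_group ("K") where "K = generate F Rel"

definition pure_tensor (infixl "\<otimes>\<^sub>t" 70) where "a \<otimes>\<^sub>t t = K #>\<^bsub>F\<^esub> frag_of (a, t)"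

lemma U_simps:
  "carrier U = carrier (F Mod K)" "\<zero>\<^bsub>U\<^esub> = \<one>\<^bsub>F Mod K\<^esub>" "u \<oplus>\<^bsub>U\<^esub> v = u \<otimes>\<^bsub>F Mod K\<^esub> v"
  "a \<odot>\<^bsub>U\<^esub> u = K <#>\<^bsub>F\<^esub> frag_extend (\<lambda>(b, t). frag_of (a \<otimes>\<^bsub>A\<^esub> b, t)) ` u"
  by (simp_all add: tensor_product_def Let_def relation_group_def ring_bimodule_def relations_def induced_def FactGroup_def)

lemma Rel_cases:
  assumes "z \<in> Rel"
  obtains (left) b b' t where "z = frag_of (b \<oplus>\<^bsub>A\<^esub> b', t) - (frag_of (b, t) + frag_of (b', t))"
      "b \<in> carrier A" "b' \<in> carrier A" "t \<in> carrier T"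
    | (right) b t t' where "z = frag_of (b, t \<oplus>\<^bsub>T\<^esub> t') - (frag_of (b, t) + frag_of (b, t'))"
      "b \<in> carrier A" "t \<in> carrier T" "t' \<in> carrier T"
    | (balance) b r t where "z = frag_of (b \<otimes>\<^bsub>A\<^esub> \<iota> r, t) - frag_of (b, r \<odot>\<^bsub>T\<^esub> t)"
      "b \<in> carrier A" "r \<in> carrier R" "t \<in> carrier T"
  using assms unfolding relations_def tensor_relations_def ring_bimodule_def by auto

lemma Rel_intros:
  "\<lbrakk>b \<in> carrier A; b' \<in> carrier A; t \<in> carrier T\<rbrakk> \<Longrightarrow>
    frag_of (b \<oplus>\<^bsub>A\<^esub> b', t) - (frag_of (b, t) + frag_of (b', t)) \<in> Rel"
  "\<lbrakk>b \<in> carrier A; t \<in> carrier T; t' \<in> carrier T\<rbrakk> \<Longrightarrow>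
    frag_of (b, t \<oplus>\<^bsub>T\<^esub> t') - (frag_of (b, t) + frag_of (b, t')) \<in> Rel"
  "\<lbrakk>b \<in> carrier A; r \<in> carrier R; t \<in> carrier T\<rbrakk> \<Longrightarrow>
    frag_of (b \<otimes>\<^bsub>A\<^esub> \<iota> r, t) - frag_of (b, r \<odot>\<^bsub>T\<^esub> t) \<in> Rel"
  unfolding relations_def tensor_relations_def ring_bimodule_def by auto

lemma F_closed:
  "x \<in> carrier F \<Longrightarrow> y \<in> carrier F \<Longrightarrow> x - y \<in> carrier F"
  "x \<in> carrier F \<Longrightarrow> y \<in> carrier F \<Longrightarrow> x + y \<in> carrier F"
  using keys_diff[of x y] keys_add[of x y] by auto

lemma frag_of_in_F: "a \<in> carrier A \<Longrightarrow> t \<in> carrier T \<Longrightarrow> frag_of (a, t) \<in> carrier F"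
  by simp

lemma Rel_subset: "Rel \<subseteq> carrier F"
proof
  fix z assume "z \<in> Rel"
  then show "z \<in> carrier F"
    by (cases rule: Rel_cases) (simp_all add: F_closed frag_of_in_F del: carrier_free_Abelian_group_iff)
qed

sublocale F: comm_group F by (rule abelian_free_Abelian_group)

lemma K_subgroup: "subgroup K F"
  unfolding relation_group_def by (rule F.generate_is_subgroup[OF Rel_subset])

lemma K_normal: "K \<lhd> F"
  using K_subgroup by (simp add: F.normal_iff_subgroup)

lemma mem_coset: "z \<in> K #>\<^bsub>F\<^esub> x \<longleftrightarrow> (\<exists>k\<in>K. z = k + x)"
  by (auto simp: r_coset_def)

lemma K_diff_coset_eq:
  assumes "x \<in> carrier F" "y \<in> carrier F" "x - y \<in> K"
  shows "K #>\<^bsub>F\<^esub> x = K #>\<^bsub>F\<^esub> y"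
proof -
  have "x \<in> K #>\<^bsub>F\<^esub> y" unfolding mem_coset using assms(3) by (intro bexI[of _ "x - y"]) auto
  then show ?thesis using F.repr_independence[OF _ _ K_subgroup] assms(2) by metis
qed

lemma coset_add:
  assumes "x \<in> carrier F" "y \<in> carrier F"
  shows "(K #>\<^bsub>F\<^esub> x) \<oplus>\<^bsub>U\<^esub> (K #>\<^bsub>F\<^esub> y) = K #>\<^bsub>F\<^esub> (x + y)"
  using normal.rcos_sum[OF K_normal assms] by (simp add: U_simps)

lemma Rel_in_K: "z \<in> Rel \<Longrightarrow> z \<in> K"
  unfolding relation_group_def by (rule generate.incl)

lemma pure_closed: "a \<in> carrier A \<Longrightarrow> t \<in> carrier T \<Longrightarrow> a \<otimes>\<^sub>t t \<in> carrier U"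
  by (auto simp: U_simps carrier_FactGroup pure_tensor_def)

lemma pure_add_left:
  "\<lbrakk>a \<in> carrier A; b \<in> carrier A; t \<in> carrier T\<rbrakk> \<Longrightarrow> (a \<oplus>\<^bsub>A\<^esub> b) \<otimes>\<^sub>t t = a \<otimes>\<^sub>t t \<oplus>\<^bsub>U\<^esub> b \<otimes>\<^sub>t t"
  unfolding pure_tensor_def
  by (simp only: coset_add frag_of_in_F)
    (intro K_diff_coset_eq Rel_in_K Rel_intros F_closed frag_of_in_F; simp)

lemma pure_add_right:
  "\<lbrakk>a \<in> carrier A; s \<in> carrier T; t \<in> carrier T\<rbrakk> \<Longrightarrow> a \<otimes>\<^sub>t (s \<oplus>\<^bsub>T\<^esub> t) = a \<otimes>\<^sub>t s \<oplus>\<^bsub>U\<^esub> a \<otimes>\<^sub>t t"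
  unfolding pure_tensor_def
  by (simp only: coset_add frag_of_in_F)
    (intro K_diff_coset_eq Rel_in_K Rel_intros F_closed frag_of_in_F; simp)

lemma pure_balanced:
  "\<lbrakk>a \<in> carrier A; r \<in> carrier R; t \<in> carrier T\<rbrakk> \<Longrightarrow> (a \<otimes>\<^bsub>A\<^esub> \<iota> r) \<otimes>\<^sub>t t = a \<otimes>\<^sub>t (r \<odot>\<^bsub>T\<^esub> t)"
  unfolding pure_tensor_def
  by (intro K_diff_coset_eq frag_of_in_F Rel_in_K Rel_intros) auto

text \<open>Multiplication by \<open>a\<close> on the first component sends relations to relations,
  hence \<open>K\<close> into \<open>K\<close>. Adding \<open>K\<close> to the image of a coset
  therefore gives precisely the coset of the image of a representative.\<close>

lemma smult_pure:
  assumes a: "a \<in> carrier A" and b: "b \<in> carrier A" and t: "t \<in> carrier T"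
  shows "a \<odot>\<^bsub>U\<^esub> (b \<otimes>\<^sub>t t) = (a \<otimes>\<^bsub>A\<^esub> b) \<otimes>\<^sub>t t"
proof -
  let ?\<phi> = "frag_extend (\<lambda>(b, t). frag_of (a \<otimes>\<^bsub>A\<^esub> b, t))"
  have \<phi>F: "?\<phi> x \<in> carrier F" if "x \<in> carrier F" for x
    using that a keys_frag_extend[of "\<lambda>(b, t). frag_of (a \<otimes>\<^bsub>A\<^esub> b, t)" x]
    by (fastforce simp: subset_iff)
  have \<phi>Rel: "?\<phi> z \<in> Rel" if "z \<in> Rel" for z
    using that a
    by (cases rule: Rel_cases)
      (auto simp: frag_extend_diff frag_extend_add A.r_distr A.m_assoc[symmetric] intro!: Rel_intros)
  have \<phi>K: "?\<phi> k \<in> K" if "k \<in> K" for k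
    using that unfolding relation_group_def
  proof induction
    case one
    show ?case using generate.one[of F] by simp
  next
    case (incl h)
    then show ?case by (intro generate.incl \<phi>Rel)
  next
    case (inv h)
    then have h: "h \<in> carrier F" using Rel_subset by blast
    then have "inv\<^bsub>F\<^esub> (?\<phi> h) = ?\<phi> (inv\<^bsub>F\<^esub> h)" using \<phi>F[OF h] by (simp add: frag_extend_minus)
    with generate.inv[OF \<phi>Rel[OF inv], of F] show ?case by (simp only:)
  next
    case (eng h1 h2)
    then show ?case using generate.eng[of _ F] by (fastforce simp: frag_extend_add)
  qed
  have K: "k + l \<in> K" if "k \<in> K" "l \<in> K" for k l using subgroup.m_closed[OF K_subgroup that] by simp
  have "0 \<in> K" using subgroup.one_closed[OF K_subgroup] by simp
  have iff: "z \<in> K <#>\<^bsub>F\<^esub> ?\<phi> ` (b \<otimes>\<^sub>t t) \<longleftrightarrow>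
      (\<exists>k\<in>K. \<exists>l\<in>K. z = k + (?\<phi> l + frag_of (a \<otimes>\<^bsub>A\<^esub> b, t)))" for z
    by (auto simp: set_mult_def pure_tensor_def r_coset_def frag_extend_add)
  show ?thesis
    unfolding U_simps
  proof (intro equalityI subsetI)
    fix z assume "z \<in> K <#>\<^bsub>F\<^esub> ?\<phi> ` (b \<otimes>\<^sub>t t)"
    then obtain k l where "k \<in> K" "l \<in> K" "z = (k + ?\<phi> l) + frag_of (a \<otimes>\<^bsub>A\<^esub> b, t)"
      unfolding iff by (auto simp: add.assoc)
    then show "z \<in> (a \<otimes>\<^bsub>A\<^esub> b) \<otimes>\<^sub>t t"
      unfolding pure_tensor_def mem_coset using K \<phi>K by blast
  next
    fix z assume "z \<in> (a \<otimes>\<^bsub>A\<^esub> b) \<otimes>\<^sub>t t"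
    then obtain k where "k \<in> K" "z = k + frag_of (a \<otimes>\<^bsub>A\<^esub> b, t)"
      unfolding pure_tensor_def mem_coset by blast
    then show "z \<in> K <#>\<^bsub>F\<^esub> ?\<phi> ` (b \<otimes>\<^sub>t t)"
      unfolding iff using \<open>0 \<in> K\<close> by (intro bexI[of _ k] bexI[of _ 0]) simp_all
  qed
qed

end

section \<open>Maps out of the induced module\<close>

locale induced_module_context = ring_extension_module +
  assumes U: "left_module A U"
begin

sublocale U: left_module A U by (rule U)

text \<open>Differences replace sums because elements of the free abelian group have integer
  coefficients, so negatives of pure tensors must be reached as well.\<close>

lemma U_induct [consumes 1, case_names zero pure diff]:
  assumes "u \<in> carrier U" and "P \<zero>\<^bsub>U\<^esub>"
    and "\<And>a t. \<lbrakk>a \<in> carrier A; t \<in> carrier T\<rbrakk> \<Longrightarrow> P (a \<otimes>\<^sub>t t)"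
    and diff: "\<And>u v. \<lbrakk>u \<in> carrier U; v \<in> carrier U; P u; P v\<rbrakk> \<Longrightarrow> P (u \<ominus>\<^bsub>U\<^esub> v)"
  shows "P u"
proof -
  obtain x where x: "Poly_Mapping.keys x \<subseteq> carrier A \<times> carrier T" "u = K #>\<^bsub>F\<^esub> x"
    using assms(1) by (auto simp: U_simps carrier_FactGroup)
  have cl: "K #>\<^bsub>F\<^esub> y \<in> carrier U" if "y \<in> carrier F" for y
    using that by (auto simp: U_simps carrier_FactGroup)
  from x(1) have "P (K #>\<^bsub>F\<^esub> x)"
  proof (rule free_Abelian_group_induct)
    have "K #>\<^bsub>F\<^esub> 0 = \<zero>\<^bsub>U\<^esub>"
      using F.coset_mult_one[of K] subgroup.subset[OF K_subgroup] by (simp add: U_simps)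
    then show "P (K #>\<^bsub>F\<^esub> 0)" using assms(2) by simp
  next
    fix y z assume 2: "Poly_Mapping.keys y \<subseteq> carrier A \<times> carrier T" "Poly_Mapping.keys z \<subseteq> carrier A \<times> carrier T"
      "P (K #>\<^bsub>F\<^esub> y)" "P (K #>\<^bsub>F\<^esub> z)"
    have d: "y - z \<in> carrier F" using F_closed 2 by simp
    have "(K #>\<^bsub>F\<^esub> (y - z)) \<oplus>\<^bsub>U\<^esub> (K #>\<^bsub>F\<^esub> z) = K #>\<^bsub>F\<^esub> y"
      using coset_add[OF d, of z] 2 by simp
    then have "(K #>\<^bsub>F\<^esub> y) \<ominus>\<^bsub>U\<^esub> (K #>\<^bsub>F\<^esub> z) = K #>\<^bsub>F\<^esub> (y - z)"
      using cl[OF d] cl[of y] cl[of z] 2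
      by (metis U.M.a_assoc U.M.a_inv_closed U.M.r_neg U.M.r_zero a_minus_def carrier_free_Abelian_group_iff)
    then show "P (K #>\<^bsub>F\<^esub> (y - z))" using diff[OF cl cl] 2 by (metis carrier_free_Abelian_group_iff)
  next
    fix p assume "p \<in> carrier A \<times> carrier T"
    then show "P (K #>\<^bsub>F\<^esub> frag_of p)" using assms(3) by (auto simp: pure_tensor_def)
  qed
  then show ?thesis using x by simp
qed

text \<open>The universal property for balanced biadditive maps, here with values in
  \<open>T\<close>: the extension to the free abelian group kills the relations and so passes to the
  quotient.\<close>

lemma U_additive_map:
  assumes f: "\<And>a t. \<lbrakk>a \<in> carrier A; t \<in> carrier T\<rbrakk> \<Longrightarrow> f a t \<in> carrier T"
    and left: "\<And>a b t. \<lbrakk>a \<in> carrier A; b \<in> carrier A; t \<in> carrier T\<rbrakk> \<Longrightarrow> f (a \<oplus>\<^bsub>A\<^esub> b) t = f a t \<oplus>\<^bsub>T\<^esub> f b t"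
    and right: "\<And>a s t. \<lbrakk>a \<in> carrier A; s \<in> carrier T; t \<in> carrier T\<rbrakk> \<Longrightarrow> f a (s \<oplus>\<^bsub>T\<^esub> t) = f a s \<oplus>\<^bsub>T\<^esub> f a t"
    and bal: "\<And>a r t. \<lbrakk>a \<in> carrier A; r \<in> carrier R; t \<in> carrier T\<rbrakk> \<Longrightarrow> f (a \<otimes>\<^bsub>A\<^esub> \<iota> r) t = f a (r \<odot>\<^bsub>T\<^esub> t)"
  obtains h where "\<And>u. u \<in> carrier U \<Longrightarrow> h u \<in> carrier T"
    "\<And>u v. \<lbrakk>u \<in> carrier U; v \<in> carrier U\<rbrakk> \<Longrightarrow> h (u \<oplus>\<^bsub>U\<^esub> v) = h u \<oplus>\<^bsub>T\<^esub> h v"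
    "\<And>a t. \<lbrakk>a \<in> carrier A; t \<in> carrier T\<rbrakk> \<Longrightarrow> h (a \<otimes>\<^sub>t t) = f a t"
proof -
  have "case_prod f ` (carrier A \<times> carrier T) \<subseteq> carrier (add_monoid T)" using f by auto
  then obtain g where g: "g \<in> hom F (add_monoid T)"
    and gf: "\<And>p. p \<in> carrier A \<times> carrier T \<Longrightarrow> g (frag_of p) = case_prod f p"
    by (rule comm_group.free_Abelian_group_universal[OF T.M.a_comm_group]) (rule that)
  interpret g: group_hom F "add_monoid T" g
    using g by (simp add: group_hom_def group_hom_axioms_def T.M.a_group)
  have gc: "g x \<in> carrier T" if "x \<in> carrier F" for x using g.hom_closed[OF that] by simp
  have gadd: "g (x + y) = g x \<oplus>\<^bsub>T\<^esub> g y" if "x \<in> carrier F" "y \<in> carrier F" for x y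
    using g.hom_mult[OF that] by simp
  \<comment> \<open>Each relation is a difference of two elements of the free group, so it suffices
    that \<open>g\<close> takes equal values on them.\<close>
  have gdiff: "g (x - y) = \<zero>\<^bsub>T\<^esub>" if "x \<in> carrier F" "y \<in> carrier F" "g x = g y" for x y
  proof -
    have "x - y \<in> carrier F" using that F_closed by simp
    then show ?thesis
      using gadd[of "x - y" y] gc[of "x - y"] gc[of y] that by (simp add: T.M.add.l_cancel_one')
  qed
  have "g z = \<zero>\<^bsub>T\<^esub>" if "z \<in> Rel" for z
    using that
  proof (cases rule: Rel_cases)
    case (left b b' t)
    then show ?thesis
      unfolding left(1)
      by (intro gdiff)
        (simp_all add: gf gadd[OF frag_of_in_F frag_of_in_F] assms F_closed frag_of_in_F del: carrier_free_Abelian_group_iff)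
  next
    case (right b t t')
    then show ?thesis
      unfolding right(1)
      by (intro gdiff)
        (simp_all add: gf gadd[OF frag_of_in_F frag_of_in_F] assms F_closed frag_of_in_F del: carrier_free_Abelian_group_iff)
  next
    case (balance b r t)
    then show ?thesis
      unfolding balance(1)
      by (intro gdiff)
        (simp_all add: gf assms F_closed frag_of_in_F del: carrier_free_Abelian_group_iff)
  qed
  then have "Rel \<subseteq> kernel F (add_monoid T) g"
    using Rel_subset by (auto simp: kernel_def simp del: carrier_free_Abelian_group_iff)
  then have "K \<subseteq> kernel F (add_monoid T) g"
    unfolding relation_group_def by (rule F.generate_subgroup_incl[OF _ g.subgroup_kernel])
  then have gK: "g k = \<zero>\<^bsub>T\<^esub>" "k \<in> carrier F" if "k \<in> K" for k
    using that by (auto simp: kernel_def)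
  have "g x = g y" if "x \<in> carrier F" "y \<in> carrier F" "K #>\<^bsub>F\<^esub> x = K #>\<^bsub>F\<^esub> y" for x y
  proof -
    have "x \<in> K #>\<^bsub>F\<^esub> y" using F.rcos_self[OF that(1) K_subgroup] that(3) by simp
    then obtain k where "k \<in> K" "x = k + y" unfolding mem_coset by blast
    then show ?thesis using gadd[of k y] gK[of k] gc[of y] that(2) by simp
  qed
  then obtain h where h: "h \<in> hom (F Mod K) (add_monoid T)"
    and hg: "\<And>x. x \<in> carrier F \<Longrightarrow> h (K #>\<^bsub>F\<^esub> x) = g x"
    by (metis FactGroup_universal[OF g K_normal])
  show ?thesis
  proof
    show "h u \<in> carrier T" if "u \<in> carrier U" for u
      using hom_in_carrier[OF h] that by (simp add: U_simps)
    show "h (u \<oplus>\<^bsub>U\<^esub> v) = h u \<oplus>\<^bsub>T\<^esub> h v" if "u \<in> carrier U" "v \<in> carrier U" for u v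
      using hom_mult[OF h, of u v] that by (simp add: U_simps)
    show "h (a \<otimes>\<^sub>t t) = f a t" if "a \<in> carrier A" "t \<in> carrier T" for a t
      using hg[OF frag_of_in_F[OF that]] gf[of "(a, t)"] that by (simp add: pure_tensor_def)
  qed
qed

text \<open>The map \<chi> \<otimes> 1 for a bimodule map \<chi> from \<open>A\<close> to
  \<open>R\<close>: right linearity makes it balanced, left linearity makes it
  \<open>R\<close>-linear. It serves both for the Frobenius form and for the retraction of
  \<iota>.\<close>

lemma U_restrict_hom:
  assumes \<chi>: "\<And>a. a \<in> carrier A \<Longrightarrow> \<chi> a \<in> carrier R"
    "\<And>a b. \<lbrakk>a \<in> carrier A; b \<in> carrier A\<rbrakk> \<Longrightarrow> \<chi> (a \<oplus>\<^bsub>A\<^esub> b) = \<chi> a \<oplus>\<^bsub>R\<^esub> \<chi> b"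
    "\<And>r a. \<lbrakk>r \<in> carrier R; a \<in> carrier A\<rbrakk> \<Longrightarrow> \<chi> (\<iota> r \<otimes>\<^bsub>A\<^esub> a) = r \<otimes>\<^bsub>R\<^esub> \<chi> a"
    "\<And>r a. \<lbrakk>r \<in> carrier R; a \<in> carrier A\<rbrakk> \<Longrightarrow> \<chi> (a \<otimes>\<^bsub>A\<^esub> \<iota> r) = \<chi> a \<otimes>\<^bsub>R\<^esub> r"
  obtains h where "h \<in> module_hom R (restrict_scalars \<iota> U) T"
    "\<And>a t. \<lbrakk>a \<in> carrier A; t \<in> carrier T\<rbrakk> \<Longrightarrow> h (a \<otimes>\<^sub>t t) = \<chi> a \<odot>\<^bsub>T\<^esub> t"
proof -
  obtain h where hc: "\<And>u. u \<in> carrier U \<Longrightarrow> h u \<in> carrier T"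
    and hadd: "\<And>u v. \<lbrakk>u \<in> carrier U; v \<in> carrier U\<rbrakk> \<Longrightarrow> h (u \<oplus>\<^bsub>U\<^esub> v) = h u \<oplus>\<^bsub>T\<^esub> h v"
    and hp: "\<And>a t. \<lbrakk>a \<in> carrier A; t \<in> carrier T\<rbrakk> \<Longrightarrow> h (a \<otimes>\<^sub>t t) = \<chi> a \<odot>\<^bsub>T\<^esub> t"
  proof (rule U_additive_map[of "\<lambda>a t. \<chi> a \<odot>\<^bsub>T\<^esub> t"])
    fix h assume "\<And>u. u \<in> carrier U \<Longrightarrow> h u \<in> carrier T"
      "\<And>u v. \<lbrakk>u \<in> carrier U; v \<in> carrier U\<rbrakk> \<Longrightarrow> h (u \<oplus>\<^bsub>U\<^esub> v) = h u \<oplus>\<^bsub>T\<^esub> h v"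
      "\<And>a t. \<lbrakk>a \<in> carrier A; t \<in> carrier T\<rbrakk> \<Longrightarrow> h (a \<otimes>\<^sub>t t) = \<chi> a \<odot>\<^bsub>T\<^esub> t"
    then show thesis by (rule that)
  qed (simp_all add: \<chi> T.smult_l_distr T.smult_r_distr T.smult_assoc1)
  have h0: "h \<zero>\<^bsub>U\<^esub> = \<zero>\<^bsub>T\<^esub>"
    using hadd[of "\<zero>\<^bsub>U\<^esub>" "\<zero>\<^bsub>U\<^esub>"] hc[of "\<zero>\<^bsub>U\<^esub>"] by (simp add: T.M.add.l_cancel_one')
  have hneg: "h (u \<ominus>\<^bsub>U\<^esub> v) = h u \<ominus>\<^bsub>T\<^esub> h v" if "u \<in> carrier U" "v \<in> carrier U" for u v
  proof -
    have "h (\<ominus>\<^bsub>U\<^esub> v) \<oplus>\<^bsub>T\<^esub> h v = \<zero>\<^bsub>T\<^esub>"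
      using hadd[of "\<ominus>\<^bsub>U\<^esub> v" v] that by (simp add: U.M.l_neg h0)
    then have "\<ominus>\<^bsub>T\<^esub> h v = h (\<ominus>\<^bsub>U\<^esub> v)"
      using that hc by (intro T.M.minus_equality) auto
    then show ?thesis using that hadd[of u "\<ominus>\<^bsub>U\<^esub> v"] by (simp add: a_minus_def)
  qed
  have "h (\<iota> r \<odot>\<^bsub>U\<^esub> u) = r \<odot>\<^bsub>T\<^esub> h u" if r: "r \<in> carrier R" and u: "u \<in> carrier U" for r u
    using u
  proof (induction rule: U_induct)
    case zero
    then show ?case using r by (simp add: h0)
  next
    case (pure a t)
    then show ?case using r by (simp add: smult_pure hp \<chi> T.smult_assoc1)
  next
    case (diff u v)
    have "\<iota> r \<odot>\<^bsub>U\<^esub> (u \<ominus>\<^bsub>U\<^esub> v) = (\<iota> r \<odot>\<^bsub>U\<^esub> u) \<ominus>\<^bsub>U\<^esub> (\<iota> r \<odot>\<^bsub>U\<^esub> v)"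
      using r diff by (simp add: a_minus_def U.smult_r_distr U.uminus_eq_smult A.l_minus A.r_minus
          flip: U.smult_assoc1)
    moreover have "r \<odot>\<^bsub>T\<^esub> (h u \<ominus>\<^bsub>T\<^esub> h v) = (r \<odot>\<^bsub>T\<^esub> h u) \<ominus>\<^bsub>T\<^esub> (r \<odot>\<^bsub>T\<^esub> h v)"
      using r diff hc by (simp add: a_minus_def T.smult_r_distr T.uminus_eq_smult R.l_minus R.r_minus
          flip: T.smult_assoc1)
    ultimately show ?case using r diff by (simp add: hneg)
  qed
  then have "h \<in> module_hom R (restrict_scalars \<iota> U) T"
    using hc hadd by (intro module_homI) simp_all
  then show ?thesis using hp by (rule that)
qed

end

section \<open>Frobenius extensions\<close>

lemma additive_finsum:
  assumes G: "abelian_group G" and H: "abelian_group H"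
    and cl: "\<And>x. x \<in> carrier G \<Longrightarrow> g x \<in> carrier H"
    and add: "\<And>x y. \<lbrakk>x \<in> carrier G; y \<in> carrier G\<rbrakk> \<Longrightarrow> g (x \<oplus>\<^bsub>G\<^esub> y) = g x \<oplus>\<^bsub>H\<^esub> g y"
    and S: "finite S" "\<And>i. i \<in> S \<Longrightarrow> k i \<in> carrier G"
  shows "g (finsum G k S) = (\<Oplus>\<^bsub>H\<^esub>i\<in>S. g (k i))"
proof -
  interpret G: abelian_group G by fact
  interpret H: abelian_group H by fact
  have "g \<zero>\<^bsub>G\<^esub> = \<zero>\<^bsub>H\<^esub>"
    using add[of "\<zero>\<^bsub>G\<^esub>" "\<zero>\<^bsub>G\<^esub>"] cl[of "\<zero>\<^bsub>G\<^esub>"] by (simp add: H.add.l_cancel_one')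
  with S show ?thesis
    by (induction S rule: finite_induct) (simp_all add: add cl Pi_iff)
qed

lemma (in abelian_monoid) finsum_swap:
  assumes "finite S" "finite S'" "\<And>i j. \<lbrakk>i \<in> S; j \<in> S'\<rbrakk> \<Longrightarrow> g i j \<in> carrier G"
  shows "(\<Oplus>i\<in>S. \<Oplus>j\<in>S'. g i j) = (\<Oplus>j\<in>S'. \<Oplus>i\<in>S. g i j)"
  using assms(1,3)
proof (induction S rule: finite_induct)
  case empty
  then show ?case by simp
next
  case (insert i S)
  then have "(\<Oplus>j\<in>S'. \<Oplus>i\<in>insert i S. g i j) = (\<Oplus>j\<in>S'. g i j \<oplus> (\<Oplus>i\<in>S. g i j))"
    by (intro finsum_cong') (auto intro!: finsum_closed)
  also have "\<dots> = (\<Oplus>j\<in>S'. g i j) \<oplus> (\<Oplus>j\<in>S'. \<Oplus>i\<in>S. g i j)"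
    using insert by (intro finsum_addf) (auto intro!: finsum_closed)
  finally show ?case
    using insert by (subst finsum_insert) (auto intro!: finsum_closed)
qed

text \<open>Coordinates: a map through the ring is x \<mapsto> s x times the image of the unit. For
  the identity map this is the dual basis of a finitely generated projective module.\<close>

lemma factors_regular_expansion:
  assumes N: "left_module R N" and "factors R (regular_module R) M N f"
  shows "\<exists>(n::nat) s p. (\<forall>i<n. s i \<in> module_hom R M (regular_module R) \<and> p i \<in> carrier N) \<and>
    (\<forall>x\<in>carrier M. f x = (\<Oplus>\<^bsub>N\<^esub>i\<in>{..<n}. s i x \<odot>\<^bsub>N\<^esub> p i))"
  using assms(2)
proof induction
  interpret N: left_module R N by (rule N)
  case (zero f)
  then show ?case by (intro exI[of _ 0]) simp
next
  interpret N: left_module R N by (rule N)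
  case (step f s0 p0 f')
  then obtain n :: nat and s p where sp: "\<forall>i<n. s i \<in> module_hom R M (regular_module R) \<and> p i \<in> carrier N"
    and f: "\<forall>x\<in>carrier M. f x = (\<Oplus>\<^bsub>N\<^esub>i\<in>{..<n}. s i x \<odot>\<^bsub>N\<^esub> p i)"
    by (elim exE conjE)
  let ?s = "\<lambda>i. if i < n then s i else s0" and ?p = "\<lambda>i. if i < n then p i else p0 \<one>\<^bsub>R\<^esub>"
  have p1: "p0 \<one>\<^bsub>R\<^esub> \<in> carrier N" using module_hom_closed[OF step(3)] by simp
  have sc: "s i x \<in> carrier R" if "i < n" "x \<in> carrier M" for i x
    using module_hom_closed[of "s i" R M "regular_module R" x] sp that by simp
  have "f' x = (\<Oplus>\<^bsub>N\<^esub>i\<in>{..<Suc n}. ?s i x \<odot>\<^bsub>N\<^esub> ?p i)" if x: "x \<in> carrier M" for x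
  proof -
    have s0x: "s0 x \<in> carrier R" using module_hom_closed[OF step(2) x] by simp
    have "(\<Oplus>\<^bsub>N\<^esub>i\<in>{..<n}. ?s i x \<odot>\<^bsub>N\<^esub> ?p i) = f x"
      using f x sp sc by (simp, intro N.M.finsum_cong') auto
    moreover have "(\<Oplus>\<^bsub>N\<^esub>i\<in>{..<n}. ?s i x \<odot>\<^bsub>N\<^esub> ?p i) \<in> carrier N"
      using sp sc x by (intro N.M.finsum_closed) auto
    moreover have "p0 (s0 x) = s0 x \<odot>\<^bsub>N\<^esub> p0 \<one>\<^bsub>R\<^esub>"
      using module_hom_smult[OF step(3), of "\<one>\<^bsub>R\<^esub>" "s0 x"] s0x by simp
    ultimately show ?thesis
      using x sp sc s0x p1
      by (subst lessThan_Suc, subst N.M.finsum_insert) (auto simp: step(4) N.M.a_comm)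
  qed
  then show ?case
    using sp p1 step(2) by (intro exI[of _ "Suc n"] exI[of _ ?s] exI[of _ ?p]) simp
qed

section \<open>Restriction of scalars\<close>

context ring_extension_module
begin

lemma restrict_left_module:
  assumes "left_module A M"
  shows "left_module R (restrict_scalars \<iota> M)"
proof -
  interpret M: left_module A M by fact
  show ?thesis
    by (intro left_moduleI abelian_groupI R.ring_axioms)
      (auto simp: M.M.a_ac M.smult_l_distr M.smult_r_distr M.smult_assoc1 \<iota>_add \<iota>_mult intro: M.M.add.l_inv_ex)
qed

lemma restrict_module_hom:
  "f \<in> module_hom A M N \<Longrightarrow> f \<in> module_hom R (restrict_scalars \<iota> M) (restrict_scalars \<iota> N)"
  by (auto simp: module_hom_def)

lemma restrict_factors:
  "factors A S M N f \<Longrightarrow> factors R (restrict_scalars \<iota> S) (restrict_scalars \<iota> M) (restrict_scalars \<iota> N) f"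
proof (induction rule: factors.induct)
  case (zero f)
  then show ?case by (intro factors.zero) simp
next
  case (step f s p g)
  show ?case
    by (rule factors.step[OF step(5) restrict_module_hom[OF step(2)] restrict_module_hom[OF step(3)]])
      (simp add: step(4))
qed

lemma restrict_a_kernel: "a_kernel (restrict_scalars \<iota> M) (restrict_scalars \<iota> N) f = a_kernel M N f"
  by (auto simp: mem_a_kernel)

lemma restrict_coresolution:
  assumes "coresolution A M C d e"
  shows "coresolution R (restrict_scalars \<iota> M) (\<lambda>n. restrict_scalars \<iota> (C n)) d e"
  using assms by (auto simp: coresolution_def restrict_a_kernel restrict_left_module restrict_module_hom)

end

locale frobenius_module = ring_extension_module R A \<iota> T
  for R :: "('r, 'k) ring_scheme" and A :: "('a, 'l) ring_scheme" and \<iota> :: "'r \<Rightarrow> 'a"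
    and T :: "('r, 't, 'e) module_scheme" +
  assumes frob: "frobenius_extension R A \<iota>" and U_left_module: "left_module A U"

sublocale frobenius_module \<subseteq> induced_module_context
  by (rule induced_module_context.intro[OF ring_extension_module_axioms
        induced_module_context_axioms.intro[OF U_left_module]])

section \<open>The Frobenius form, dual bases and coinduction\<close>

context frobenius_module
begin

abbreviation "A\<^sub>R \<equiv> restrict_scalars \<iota> (regular_module A)"

lemma A_factors: "factors R (regular_module R) A\<^sub>R A\<^sub>R (\<lambda>x. x)"
  using frob by (intro fg_projective_factors) (simp_all add: frobenius_extension_def)

lemma A\<^sub>R_left_module: "left_module R A\<^sub>R"
  by (rule restrict_left_module[OF left_module_regular[OF A.ring_axioms]])

text \<open>\<open>P\<close> lies in add of \<open>A\<close>, and \<open>A\<close> lies in add of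
  \<open>R\<close> by the Frobenius hypothesis; transitivity of add does the rest.\<close>

lemma restrict_projective:
  assumes "projective A P" "finitely_generated A P"
  shows "projective R (restrict_scalars \<iota> P)" "finitely_generated R (restrict_scalars \<iota> P)"
proof -
  note P = restrict_left_module[OF projective_left_module[OF assms(1)]]
  have "factors R (regular_module R) (restrict_scalars \<iota> P) (restrict_scalars \<iota> P) (\<lambda>x. x)"
    by (rule factors_trans[OF P A\<^sub>R_left_module P restrict_factors[OF fg_projective_factors[OF assms]] A_factors])
  then show "projective R (restrict_scalars \<iota> P)" "finitely_generated R (restrict_scalars \<iota> P)"
    using factors_regular_projective[OF P] factors_regular_finitely_generated[OF P] by blast+
qed

lemma restrict_projective_resolution:
  assumes "projective_resolution A M P d e" "\<And>n. finitely_generated A (P n)"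
  shows "projective_resolution R (restrict_scalars \<iota> M) (\<lambda>n. restrict_scalars \<iota> (P n)) d e"
  using assms
  by (auto simp: projective_resolution_def restrict_a_kernel restrict_projective restrict_module_hom)

text \<open>Projectivity of \<open>A\<close> provides elements \<open>a i\<close> with coordinate
  functions, and the Frobenius isomorphism turns each coordinate function into E (x b) for a unique
  \<open>b\<close>. This is the first identity; the second is the first one read through the
  injectivity of the isomorphism.\<close>

lemma frobenius_system:
  obtains E and n :: nat and a b where
    "E \<in> module_hom R A\<^sub>R (regular_module R)"
    "\<And>x r. \<lbrakk>x \<in> carrier A; r \<in> carrier R\<rbrakk> \<Longrightarrow> E (x \<otimes>\<^bsub>A\<^esub> \<iota> r) = E x \<otimes>\<^bsub>R\<^esub> r"
    "\<And>i. i < n \<Longrightarrow> a i \<in> carrier A" "\<And>i. i < n \<Longrightarrow> b i \<in> carrier A"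
    "\<And>x. x \<in> carrier A \<Longrightarrow> (\<Oplus>\<^bsub>A\<^esub>i\<in>{..<n}. \<iota> (E (x \<otimes>\<^bsub>A\<^esub> b i)) \<otimes>\<^bsub>A\<^esub> a i) = x"
    "\<And>x. x \<in> carrier A \<Longrightarrow> (\<Oplus>\<^bsub>A\<^esub>i\<in>{..<n}. b i \<otimes>\<^bsub>A\<^esub> \<iota> (E (a i \<otimes>\<^bsub>A\<^esub> x))) = x"
proof -
  obtain \<Phi> where \<Phi>: "\<Phi> \<in> bimodule_iso A R (ring_bimodule id A \<iota>) (dual_bimodule R A \<iota>)"
    using frob by (auto simp: frobenius_extension_def)
  note c = \<Phi>[unfolded bimodule_iso_def bimodule_hom_def module_hom_def[of A] ring_bimodule_def
      dual_bimodule_def hom_group_def Let_def, simplified]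
  from c have bij: "bij_betw \<Phi> (carrier A) (module_hom R A\<^sub>R (regular_module R) \<inter> extensional (carrier A))"
    and \<Phi>_mult: "\<And>a x. \<lbrakk>a \<in> carrier A; x \<in> carrier A\<rbrakk> \<Longrightarrow> \<Phi> (a \<otimes>\<^bsub>A\<^esub> x) = (\<lambda>y\<in>carrier A. \<Phi> x (y \<otimes>\<^bsub>A\<^esub> a))"
    and \<Phi>_right: "\<And>r x. \<lbrakk>r \<in> carrier R; x \<in> carrier A\<rbrakk> \<Longrightarrow> \<Phi> (x \<otimes>\<^bsub>A\<^esub> \<iota> r) = (\<lambda>y\<in>carrier A. \<Phi> x y \<otimes>\<^bsub>R\<^esub> r)"
    by blast+
  \<comment> \<open>The form is the image of the unit; by left linearity \<Phi> x is then the
    functional y \<mapsto> E (y x).\<close>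
  define E where "E = \<Phi> \<one>\<^bsub>A\<^esub>"
  have E: "E \<in> module_hom R A\<^sub>R (regular_module R)"
    using bij by (auto simp: E_def bij_betw_def)
  have \<Phi>E: "\<Phi> x y = E (y \<otimes>\<^bsub>A\<^esub> x)" if "x \<in> carrier A" "y \<in> carrier A" for x y
    using \<Phi>_mult[of x "\<one>\<^bsub>A\<^esub>"] that by (simp add: E_def)
  have Er: "E (x \<otimes>\<^bsub>A\<^esub> \<iota> r) = E x \<otimes>\<^bsub>R\<^esub> r" if "x \<in> carrier A" "r \<in> carrier R" for x r
    using \<Phi>_right[of r "\<one>\<^bsub>A\<^esub>"] \<Phi>E[of "\<iota> r" x] that by (simp add: E_def)
  have Ec: "E x \<in> carrier R" if "x \<in> carrier A" for x
    using module_hom_closed[OF E, of x] that by simp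
  have El: "E (\<iota> r \<otimes>\<^bsub>A\<^esub> x) = r \<otimes>\<^bsub>R\<^esub> E x" if "x \<in> carrier A" "r \<in> carrier R" for x r
    using module_hom_smult[OF E, of x r] that by simp
  have Esum: "E (finsum A k S) = (\<Oplus>\<^bsub>R\<^esub>i\<in>S. E (k i))" if "finite S" "\<And>i. i \<in> S \<Longrightarrow> k i \<in> carrier A" for k and S :: "nat set"
    using that module_hom_add[OF E] Ec
    by (intro additive_finsum[OF A.abelian_group_axioms R.abelian_group_axioms]) simp_all
  obtain n :: nat and s a where sa: "\<forall>i<n. s i \<in> module_hom R A\<^sub>R (regular_module R) \<and> a i \<in> carrier A\<^sub>R"
    and id: "\<forall>x\<in>carrier A\<^sub>R. x = (\<Oplus>\<^bsub>A\<^sub>R\<^esub>i\<in>{..<n}. s i x \<odot>\<^bsub>A\<^sub>R\<^esub> a i)"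
    using factors_regular_expansion[OF A\<^sub>R_left_module A_factors] by (elim exE conjE)
  \<comment> \<open>A finite sum depends only on the additive structure, which restriction of
    scalars does not touch.\<close>
  have sum_eq: "finsum A\<^sub>R k S = finsum A k S" for k and S :: "nat set"
    by (simp add: finsum_def finprod_def restrict_scalars_def regular_module_def)
  have ac: "a i \<in> carrier A" if "i < n" for i using sa that by simp
  have "\<exists>b\<in>carrier A. \<forall>x\<in>carrier A. s i x = E (x \<otimes>\<^bsub>A\<^esub> b)" if i: "i < n" for i
  proof -
    have "restrict (s i) (carrier A) \<in> module_hom R A\<^sub>R (regular_module R)"
      by (rule module_hom_cong[OF conjunct1[OF sa[rule_format, OF i]] A\<^sub>R_left_module]) simp
    then have "restrict (s i) (carrier A) \<in> \<Phi> ` carrier A"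
      using bij by (simp add: bij_betw_def)
    then obtain b where b: "b \<in> carrier A" "restrict (s i) (carrier A) = \<Phi> b" by (elim imageE)
    have "s i x = E (x \<otimes>\<^bsub>A\<^esub> b)" if "x \<in> carrier A" for x
      using fun_cong[OF b(2), of x] that \<Phi>E[OF b(1) that] by simp
    with b(1) show ?thesis by blast
  qed
  then obtain b where bc: "\<And>i. i < n \<Longrightarrow> b i \<in> carrier A"
    and sb: "\<And>i x. \<lbrakk>i < n; x \<in> carrier A\<rbrakk> \<Longrightarrow> s i x = E (x \<otimes>\<^bsub>A\<^esub> b i)" by metis
  have id1: "(\<Oplus>\<^bsub>A\<^esub>i\<in>{..<n}. \<iota> (E (x \<otimes>\<^bsub>A\<^esub> b i)) \<otimes>\<^bsub>A\<^esub> a i) = x" if x: "x \<in> carrier A" for x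
  proof -
    have "(\<Oplus>\<^bsub>A\<^esub>i\<in>{..<n}. \<iota> (E (x \<otimes>\<^bsub>A\<^esub> b i)) \<otimes>\<^bsub>A\<^esub> a i) = (\<Oplus>\<^bsub>A\<^esub>i\<in>{..<n}. s i x \<odot>\<^bsub>A\<^sub>R\<^esub> a i)"
      using x ac bc Ec by (intro A.finsum_cong') (auto simp: sb)
    also have "\<dots> = x" using id x by (simp only: sum_eq) simp
    finally show ?thesis .
  qed
  have id2: "(\<Oplus>\<^bsub>A\<^esub>i\<in>{..<n}. b i \<otimes>\<^bsub>A\<^esub> \<iota> (E (a i \<otimes>\<^bsub>A\<^esub> x))) = x" if x: "x \<in> carrier A" for x
  proof -
    let ?x = "\<Oplus>\<^bsub>A\<^esub>i\<in>{..<n}. b i \<otimes>\<^bsub>A\<^esub> \<iota> (E (a i \<otimes>\<^bsub>A\<^esub> x))"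
    have x': "?x \<in> carrier A" using x ac bc Ec by (intro A.finsum_closed) auto
    \<comment> \<open>Equality of the two functionals for all y gives \<Phi> ?x = \<Phi> x, and
      \<Phi> is injective.\<close>
    have "E (y \<otimes>\<^bsub>A\<^esub> ?x) = E (y \<otimes>\<^bsub>A\<^esub> x)" if y: "y \<in> carrier A" for y
    proof -
      have "E (y \<otimes>\<^bsub>A\<^esub> ?x) = E (\<Oplus>\<^bsub>A\<^esub>i\<in>{..<n}. y \<otimes>\<^bsub>A\<^esub> (b i \<otimes>\<^bsub>A\<^esub> \<iota> (E (a i \<otimes>\<^bsub>A\<^esub> x))))"
        using x y ac bc Ec by (subst A.finsum_rdistr) auto
      also have "\<dots> = (\<Oplus>\<^bsub>R\<^esub>i\<in>{..<n}. E (y \<otimes>\<^bsub>A\<^esub> (b i \<otimes>\<^bsub>A\<^esub> \<iota> (E (a i \<otimes>\<^bsub>A\<^esub> x)))))"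
        using x y ac bc Ec by (intro Esum) auto
      also have "\<dots> = (\<Oplus>\<^bsub>R\<^esub>i\<in>{..<n}. E (\<iota> (E (y \<otimes>\<^bsub>A\<^esub> b i)) \<otimes>\<^bsub>A\<^esub> a i \<otimes>\<^bsub>A\<^esub> x))"
      proof (intro R.finsum_cong')
        fix i assume "i \<in> {..<n}"
        then have i: "a i \<in> carrier A" "b i \<in> carrier A" using ac bc by auto
        \<comment> \<open>Right linearity pulls E (a i x) out of the form, left linearity pushes E
          (y b i) back in; the first identity can then be applied to y.\<close>
        have "E (y \<otimes>\<^bsub>A\<^esub> (b i \<otimes>\<^bsub>A\<^esub> \<iota> (E (a i \<otimes>\<^bsub>A\<^esub> x)))) = E (y \<otimes>\<^bsub>A\<^esub> b i) \<otimes>\<^bsub>R\<^esub> E (a i \<otimes>\<^bsub>A\<^esub> x)"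
          using Er[of "y \<otimes>\<^bsub>A\<^esub> b i" "E (a i \<otimes>\<^bsub>A\<^esub> x)"] x y i Ec by (simp add: A.m_assoc)
        also have "\<dots> = E (\<iota> (E (y \<otimes>\<^bsub>A\<^esub> b i)) \<otimes>\<^bsub>A\<^esub> a i \<otimes>\<^bsub>A\<^esub> x)"
          using El[of "a i \<otimes>\<^bsub>A\<^esub> x" "E (y \<otimes>\<^bsub>A\<^esub> b i)"] x y i Ec by (simp add: A.m_assoc)
        finally show "E (y \<otimes>\<^bsub>A\<^esub> (b i \<otimes>\<^bsub>A\<^esub> \<iota> (E (a i \<otimes>\<^bsub>A\<^esub> x)))) = E (\<iota> (E (y \<otimes>\<^bsub>A\<^esub> b i)) \<otimes>\<^bsub>A\<^esub> a i \<otimes>\<^bsub>A\<^esub> x)" .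
      qed (use x y ac bc Ec in auto)
      also have "\<dots> = E (\<Oplus>\<^bsub>A\<^esub>i\<in>{..<n}. \<iota> (E (y \<otimes>\<^bsub>A\<^esub> b i)) \<otimes>\<^bsub>A\<^esub> a i \<otimes>\<^bsub>A\<^esub> x)"
        using x y ac bc Ec by (intro Esum[symmetric]) auto
      also have "(\<Oplus>\<^bsub>A\<^esub>i\<in>{..<n}. \<iota> (E (y \<otimes>\<^bsub>A\<^esub> b i)) \<otimes>\<^bsub>A\<^esub> a i \<otimes>\<^bsub>A\<^esub> x) =
          (\<Oplus>\<^bsub>A\<^esub>i\<in>{..<n}. \<iota> (E (y \<otimes>\<^bsub>A\<^esub> b i)) \<otimes>\<^bsub>A\<^esub> a i) \<otimes>\<^bsub>A\<^esub> x"
        using x y ac bc Ec by (intro A.finsum_ldistr[symmetric]) auto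
      finally show ?thesis by (simp add: id1[OF y])
    qed
    then have "\<Phi> ?x y = \<Phi> x y" if "y \<in> carrier A" for y
      using that \<Phi>E[OF x that] \<Phi>E[OF x' that] by simp
    moreover have "\<Phi> ?x \<in> extensional (carrier A)" "\<Phi> x \<in> extensional (carrier A)"
      using bij x x' by (auto simp: bij_betw_def)
    ultimately have "\<Phi> ?x = \<Phi> x" by (intro extensionalityI[of _ "carrier A"])
    then show ?thesis using bij x x' by (auto simp: bij_betw_def dest: inj_onD)
  qed
  show ?thesis by (rule that[OF E Er ac bc id1 id2])
qed

text \<open>Lifting along \<epsilon> is the only part of the isomorphism of induction with
  coinduction that extending homomorphisms requires, so uniqueness of \<open>h\<close> is left
  out.\<close>

lemma coinduced_lift:
  obtains \<epsilon> where "\<epsilon> \<in> module_hom R (restrict_scalars \<iota> U) T"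
    "\<And>(X :: ('a, 'x) module) f. \<lbrakk>left_module A X; f \<in> module_hom R (restrict_scalars \<iota> X) T\<rbrakk> \<Longrightarrow>
      \<exists>h\<in>module_hom A X U. \<forall>x\<in>carrier X. \<epsilon> (h x) = f x"
proof -
  obtain E and n :: nat and a b where E: "E \<in> module_hom R A\<^sub>R (regular_module R)"
    and Er: "\<And>x r. \<lbrakk>x \<in> carrier A; r \<in> carrier R\<rbrakk> \<Longrightarrow> E (x \<otimes>\<^bsub>A\<^esub> \<iota> r) = E x \<otimes>\<^bsub>R\<^esub> r"
    and ac: "\<And>i. i < n \<Longrightarrow> a i \<in> carrier A" and bc: "\<And>i. i < n \<Longrightarrow> b i \<in> carrier A"
    and id1: "\<And>x. x \<in> carrier A \<Longrightarrow> (\<Oplus>\<^bsub>A\<^esub>i\<in>{..<n}. \<iota> (E (x \<otimes>\<^bsub>A\<^esub> b i)) \<otimes>\<^bsub>A\<^esub> a i) = x"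
    and id2: "\<And>x. x \<in> carrier A \<Longrightarrow> (\<Oplus>\<^bsub>A\<^esub>i\<in>{..<n}. b i \<otimes>\<^bsub>A\<^esub> \<iota> (E (a i \<otimes>\<^bsub>A\<^esub> x))) = x"
    by (rule frobenius_system) (rule that)
  have Ec: "E x \<in> carrier R" if "x \<in> carrier A" for x
    using module_hom_closed[OF E, of x] that by simp
  obtain \<epsilon> where \<epsilon>: "\<epsilon> \<in> module_hom R (restrict_scalars \<iota> U) T"
    and \<epsilon>p: "\<And>a t. \<lbrakk>a \<in> carrier A; t \<in> carrier T\<rbrakk> \<Longrightarrow> \<epsilon> (a \<otimes>\<^sub>t t) = E a \<odot>\<^bsub>T\<^esub> t"
    using module_hom_add[OF E] module_hom_smult[OF E] Ec Er by (rule_tac U_restrict_hom[of E]) simp_all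
  have "\<exists>h\<in>module_hom A X U. \<forall>x\<in>carrier X. \<epsilon> (h x) = f x"
    if X: "left_module A X" and f: "f \<in> module_hom R (restrict_scalars \<iota> X) T" for X :: "('a, 'x) module" and f
  proof -
    interpret X: left_module A X by (rule X)
    have fc: "f x \<in> carrier T" if "x \<in> carrier X" for x
      using module_hom_closed[OF f, of x] that by simp
    have fadd: "f (x \<oplus>\<^bsub>X\<^esub> y) = f x \<oplus>\<^bsub>T\<^esub> f y" if "x \<in> carrier X" "y \<in> carrier X" for x y
      using module_hom_add[OF f, of x y] that by simp
    have fsm: "f (\<iota> r \<odot>\<^bsub>X\<^esub> x) = r \<odot>\<^bsub>T\<^esub> f x" if "r \<in> carrier R" "x \<in> carrier X" for r x
      using module_hom_smult[OF f, of x r] that by simp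
    \<comment> \<open>The first dual basis identity applied to c, with \<open>R\<close>-linearity of
      \<open>f\<close> moving the coefficients E (c b j) outside.\<close>
    have expand: "f (c \<odot>\<^bsub>X\<^esub> x) = (\<Oplus>\<^bsub>T\<^esub>j\<in>{..<n}. E (c \<otimes>\<^bsub>A\<^esub> b j) \<odot>\<^bsub>T\<^esub> f (a j \<odot>\<^bsub>X\<^esub> x))"
      if c: "c \<in> carrier A" and x: "x \<in> carrier X" for c x
    proof -
      have "f (c \<odot>\<^bsub>X\<^esub> x) = f ((\<Oplus>\<^bsub>A\<^esub>j\<in>{..<n}. \<iota> (E (c \<otimes>\<^bsub>A\<^esub> b j)) \<otimes>\<^bsub>A\<^esub> a j) \<odot>\<^bsub>X\<^esub> x)"
        by (simp only: id1[OF c])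
      also have "\<dots> = (\<Oplus>\<^bsub>T\<^esub>j\<in>{..<n}. f ((\<iota> (E (c \<otimes>\<^bsub>A\<^esub> b j)) \<otimes>\<^bsub>A\<^esub> a j) \<odot>\<^bsub>X\<^esub> x))"
        using c x ac bc Ec fc
        by (intro additive_finsum[OF A.abelian_group_axioms T.M.abelian_group_axioms, of "\<lambda>c. f (c \<odot>\<^bsub>X\<^esub> x)"])
          (auto simp: X.smult_l_distr fadd)
      also have "\<dots> = (\<Oplus>\<^bsub>T\<^esub>j\<in>{..<n}. E (c \<otimes>\<^bsub>A\<^esub> b j) \<odot>\<^bsub>T\<^esub> f (a j \<odot>\<^bsub>X\<^esub> x))"
        using c x ac bc Ec fc by (intro T.M.finsum_cong') (auto simp: X.smult_assoc1 fsm)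
      finally show ?thesis .
    qed
    define h where "h x = (\<Oplus>\<^bsub>U\<^esub>i\<in>{..<n}. b i \<otimes>\<^sub>t f (a i \<odot>\<^bsub>X\<^esub> x))" for x
    have summand: "b i \<otimes>\<^sub>t f (a j \<odot>\<^bsub>X\<^esub> x) \<in> carrier U" if "i < n" "j < n" "x \<in> carrier X" for i j x
      using that ac bc fc by (intro pure_closed) auto
    have "h \<in> module_hom A X U"
    proof (rule module_homI)
      fix x assume x: "x \<in> carrier X"
      then show "h x \<in> carrier U" unfolding h_def using summand by (intro U.M.finsum_closed) auto
      fix y assume y: "y \<in> carrier X"
      have "h (x \<oplus>\<^bsub>X\<^esub> y) = (\<Oplus>\<^bsub>U\<^esub>i\<in>{..<n}. b i \<otimes>\<^sub>t f (a i \<odot>\<^bsub>X\<^esub> x) \<oplus>\<^bsub>U\<^esub> b i \<otimes>\<^sub>t f (a i \<odot>\<^bsub>X\<^esub> y))"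
        unfolding h_def using x y ac bc fc summand
        by (intro U.M.finsum_cong') (auto simp: X.smult_r_distr fadd pure_add_right)
      also have "\<dots> = h x \<oplus>\<^bsub>U\<^esub> h y"
        unfolding h_def using x y summand by (intro U.M.finsum_addf) auto
      finally show "h (x \<oplus>\<^bsub>X\<^esub> y) = h x \<oplus>\<^bsub>U\<^esub> h y" .
    next
      fix c x assume c: "c \<in> carrier A" and x: "x \<in> carrier X"
      \<comment> \<open>The coefficients produced by expanding f (a i c x) are carried across the
        tensor sign to the left factor.\<close>
      let ?g = "\<lambda>i j. (b i \<otimes>\<^bsub>A\<^esub> \<iota> (E (a i \<otimes>\<^bsub>A\<^esub> (c \<otimes>\<^bsub>A\<^esub> b j)))) \<otimes>\<^sub>t f (a j \<odot>\<^bsub>X\<^esub> x)"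
      have g: "?g i j \<in> carrier U" if "i < n" "j < n" for i j
        using that c x ac bc fc Ec by (intro pure_closed) auto
      have "h (c \<odot>\<^bsub>X\<^esub> x) = (\<Oplus>\<^bsub>U\<^esub>i\<in>{..<n}. \<Oplus>\<^bsub>U\<^esub>j\<in>{..<n}. ?g i j)"
        unfolding h_def
      proof (intro U.M.finsum_cong')
        fix i assume "i \<in> {..<n}"
        then have i: "i < n" "a i \<in> carrier A" "b i \<in> carrier A" using ac bc by auto
        have "b i \<otimes>\<^sub>t f (a i \<odot>\<^bsub>X\<^esub> (c \<odot>\<^bsub>X\<^esub> x)) =
            b i \<otimes>\<^sub>t (\<Oplus>\<^bsub>T\<^esub>j\<in>{..<n}. E (a i \<otimes>\<^bsub>A\<^esub> c \<otimes>\<^bsub>A\<^esub> b j) \<odot>\<^bsub>T\<^esub> f (a j \<odot>\<^bsub>X\<^esub> x))"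
          using expand[of "a i \<otimes>\<^bsub>A\<^esub> c" x] c x i by (simp add: X.smult_assoc1)
        also have "\<dots> = (\<Oplus>\<^bsub>U\<^esub>j\<in>{..<n}. b i \<otimes>\<^sub>t (E (a i \<otimes>\<^bsub>A\<^esub> c \<otimes>\<^bsub>A\<^esub> b j) \<odot>\<^bsub>T\<^esub> f (a j \<odot>\<^bsub>X\<^esub> x)))"
          using c x i ac bc Ec fc
          by (intro additive_finsum[OF T.M.abelian_group_axioms U.M.abelian_group_axioms])
            (auto simp: pure_closed pure_add_right)
        also have "\<dots> = (\<Oplus>\<^bsub>U\<^esub>j\<in>{..<n}. ?g i j)"
          using c x i ac bc Ec fc g by (intro U.M.finsum_cong') (auto simp: pure_balanced A.m_assoc)
        finally show "b i \<otimes>\<^sub>t f (a i \<odot>\<^bsub>X\<^esub> (c \<odot>\<^bsub>X\<^esub> x)) = (\<Oplus>\<^bsub>U\<^esub>j\<in>{..<n}. ?g i j)" .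
      qed (use g in \<open>auto intro!: U.M.finsum_closed\<close>)
      \<comment> \<open>After the interchange the inner sum runs over i, and the second dual basis
        identity collapses it to c b j.\<close>
      also have "\<dots> = (\<Oplus>\<^bsub>U\<^esub>j\<in>{..<n}. \<Oplus>\<^bsub>U\<^esub>i\<in>{..<n}. ?g i j)"
        using g by (intro U.M.finsum_swap) auto
      also have "\<dots> = (\<Oplus>\<^bsub>U\<^esub>j\<in>{..<n}. c \<odot>\<^bsub>U\<^esub> (b j \<otimes>\<^sub>t f (a j \<odot>\<^bsub>X\<^esub> x)))"
      proof (intro U.M.finsum_cong')
        fix j assume "j \<in> {..<n}"
        then have j: "j < n" "a j \<in> carrier A" "b j \<in> carrier A" using ac bc by auto
        have "(\<Oplus>\<^bsub>U\<^esub>i\<in>{..<n}. ?g i j) =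
            (\<Oplus>\<^bsub>A\<^esub>i\<in>{..<n}. b i \<otimes>\<^bsub>A\<^esub> \<iota> (E (a i \<otimes>\<^bsub>A\<^esub> (c \<otimes>\<^bsub>A\<^esub> b j)))) \<otimes>\<^sub>t f (a j \<odot>\<^bsub>X\<^esub> x)"
          using c x j ac bc Ec fc
          by (intro additive_finsum[OF A.abelian_group_axioms U.M.abelian_group_axioms,
                of "\<lambda>y. y \<otimes>\<^sub>t f (a j \<odot>\<^bsub>X\<^esub> x)", symmetric])
            (auto simp: pure_closed pure_add_left)
        also have "\<dots> = (c \<otimes>\<^bsub>A\<^esub> b j) \<otimes>\<^sub>t f (a j \<odot>\<^bsub>X\<^esub> x)"
          using c j by (simp add: id2)
        finally show "(\<Oplus>\<^bsub>U\<^esub>i\<in>{..<n}. ?g i j) = c \<odot>\<^bsub>U\<^esub> (b j \<otimes>\<^sub>t f (a j \<odot>\<^bsub>X\<^esub> x))"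
          using c x j fc by (simp add: smult_pure)
      qed (use c x summand in auto)
      also have "\<dots> = c \<odot>\<^bsub>U\<^esub> h x"
        unfolding h_def using c x summand by (intro U.finsum_smult[symmetric]) auto
      finally show "h (c \<odot>\<^bsub>X\<^esub> x) = c \<odot>\<^bsub>U\<^esub> h x" .
    qed
    moreover have "\<epsilon> (h x) = f x" if x: "x \<in> carrier X" for x
    proof -
      have "\<epsilon> (h x) = (\<Oplus>\<^bsub>T\<^esub>i\<in>{..<n}. \<epsilon> (b i \<otimes>\<^sub>t f (a i \<odot>\<^bsub>X\<^esub> x)))"
        unfolding h_def using x summand module_hom_closed[OF \<epsilon>] module_hom_add[OF \<epsilon>]
        by (intro additive_finsum[OF U.M.abelian_group_axioms T.M.abelian_group_axioms]) auto
      \<comment> \<open>The unit is inserted so that the sum is literally the expansion of f at c =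
        1.\<close>
      also have "\<dots> = (\<Oplus>\<^bsub>T\<^esub>i\<in>{..<n}. E (\<one>\<^bsub>A\<^esub> \<otimes>\<^bsub>A\<^esub> b i) \<odot>\<^bsub>T\<^esub> f (a i \<odot>\<^bsub>X\<^esub> x))"
        using x ac bc fc Ec by (intro T.M.finsum_cong') (auto simp: \<epsilon>p)
      also have "\<dots> = f x"
        using expand[of "\<one>\<^bsub>A\<^esub>" x] x by simp
      finally show ?thesis .
    qed
    ultimately show ?thesis by blast
  qed
  then show ?thesis by (rule that[OF \<epsilon>])
qed

text \<open>Write \<open>f\<close> as \<epsilon> h with \<open>h\<close> linear over
  \<open>A\<close>, extend \<open>h\<close> to \<open>g\<close> over \<open>A\<close>; then
  \<epsilon> g extends \<open>f\<close>.\<close>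

lemma restrict_extends:
  fixes P :: "('a, 'x) module"
  assumes P: "left_module A P" and K: "submodule H A P" and ext: "extends A P H U"
  shows "extends R (restrict_scalars \<iota> P) H T"
  unfolding extends_def
proof
  obtain \<epsilon> where \<epsilon>: "\<epsilon> \<in> module_hom R (restrict_scalars \<iota> U) T"
    and lift: "\<And>(X :: ('a, 'x) module) f. \<lbrakk>left_module A X; f \<in> module_hom R (restrict_scalars \<iota> X) T\<rbrakk> \<Longrightarrow>
      \<exists>h\<in>module_hom A X U. \<forall>x\<in>carrier X. \<epsilon> (h x) = f x"
    by (rule coinduced_lift) (rule that)
  fix f assume "f \<in> module_hom R ((restrict_scalars \<iota> P)\<lparr>carrier := H\<rparr>) T"
  then have f: "f \<in> module_hom R (restrict_scalars \<iota> (P\<lparr>carrier := H\<rparr>)) T" by simp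
  obtain h where h: "h \<in> module_hom A (P\<lparr>carrier := H\<rparr>) U" "\<forall>x\<in>H. \<epsilon> (h x) = f x"
    using lift[OF submodule_left_module[OF P K] f] by auto
  obtain g where g: "g \<in> module_hom A P U" "\<And>x. x \<in> H \<Longrightarrow> g x = h x"
    using extendsD[OF ext h(1)] by metis
  show "\<exists>g\<in>module_hom R (restrict_scalars \<iota> P) T. \<forall>x\<in>H. g x = f x"
    using g(2) h(2) by (intro bexI[OF _ module_hom_compose[OF restrict_module_hom[OF g(1)] \<epsilon>]]) simp
qed

end

section \<open>Descent of the Wakamatsu tilting property\<close>

lemma syzygy_restrict:
  "syzygy (\<lambda>n. restrict_scalars \<iota> (P n)) d (restrict_scalars \<iota> M) e n = syzygy P d M e n"
  by (auto simp: syzygy_def mem_a_kernel split: nat.split)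

lemma cosyzygy_restrict:
  "cosyzygy (\<lambda>n. restrict_scalars \<iota> (C n)) d (restrict_scalars \<iota> M) e n = cosyzygy C d M e n"
  by (auto simp: cosyzygy_def split: nat.split)

lemma regular_module_projective:
  assumes "ring R"
  shows "projective R (regular_module R)" "finitely_generated R (regular_module R)"
proof -
  note reg = left_module_regular[OF assms]
  have "factors R (regular_module R) (regular_module R) (regular_module R) (\<lambda>x. x)"
    by (rule factors_single[OF reg reg module_hom_ident module_hom_ident])
  then show "projective R (regular_module R)" "finitely_generated R (regular_module R)"
    using factors_regular_projective[OF reg] factors_regular_finitely_generated[OF reg] by blast+
qed

locale split_frobenius_module = frobenius_module R A \<iota> T
  for R :: "('r, 'k) ring_scheme" and A :: "('a, 'l) ring_scheme" and \<iota> :: "'r \<Rightarrow> 'a"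
    and T :: "('r, 't, 'e) module_scheme" +
  assumes split: "split_extension R A \<iota>"
begin

abbreviation "U\<^sub>R \<equiv> restrict_scalars \<iota> U"

lemma U\<^sub>R_left_module: "left_module R U\<^sub>R"
  by (rule restrict_left_module[OF U_left_module])

lemma splitting:
  obtains \<pi> where "\<And>a. a \<in> carrier A \<Longrightarrow> \<pi> a \<in> carrier R"
    "\<And>a b. \<lbrakk>a \<in> carrier A; b \<in> carrier A\<rbrakk> \<Longrightarrow> \<pi> (a \<oplus>\<^bsub>A\<^esub> b) = \<pi> a \<oplus>\<^bsub>R\<^esub> \<pi> b"
    "\<And>r a. \<lbrakk>r \<in> carrier R; a \<in> carrier A\<rbrakk> \<Longrightarrow> \<pi> (\<iota> r \<otimes>\<^bsub>A\<^esub> a) = r \<otimes>\<^bsub>R\<^esub> \<pi> a"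
    "\<And>r a. \<lbrakk>r \<in> carrier R; a \<in> carrier A\<rbrakk> \<Longrightarrow> \<pi> (a \<otimes>\<^bsub>A\<^esub> \<iota> r) = \<pi> a \<otimes>\<^bsub>R\<^esub> r"
    "\<And>r. r \<in> carrier R \<Longrightarrow> \<pi> (\<iota> r) = r"
proof -
  obtain \<pi> where \<pi>: "\<pi> \<in> bimodule_hom R R (ring_bimodule \<iota> A \<iota>) (ring_bimodule id R id)"
    and \<pi>\<iota>: "\<And>r. r \<in> carrier R \<Longrightarrow> \<pi> (\<iota> r) = r"
    using split by (auto simp: split_extension_def)
  note c = \<pi>[unfolded bimodule_hom_def module_hom_def ring_bimodule_def, simplified]
  show ?thesis by (rule that[of \<pi>]) (use c \<pi>\<iota> in \<open>auto simp: Pi_iff\<close>)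
qed

text \<open>The maps are t \<mapsto> 1 \<otimes> t and \<pi> \<otimes> 1, and \<pi> sends the unit
  of \<open>A\<close> to the unit of \<open>R\<close>.\<close>

lemma T_retract:
  obtains j p where "j \<in> module_hom R T U\<^sub>R" "p \<in> module_hom R U\<^sub>R T" "\<And>t. t \<in> carrier T \<Longrightarrow> p (j t) = t"
proof -
  obtain \<pi> where \<pi>: "\<And>a. a \<in> carrier A \<Longrightarrow> \<pi> a \<in> carrier R"
    "\<And>a b. \<lbrakk>a \<in> carrier A; b \<in> carrier A\<rbrakk> \<Longrightarrow> \<pi> (a \<oplus>\<^bsub>A\<^esub> b) = \<pi> a \<oplus>\<^bsub>R\<^esub> \<pi> b"
    "\<And>r a. \<lbrakk>r \<in> carrier R; a \<in> carrier A\<rbrakk> \<Longrightarrow> \<pi> (\<iota> r \<otimes>\<^bsub>A\<^esub> a) = r \<otimes>\<^bsub>R\<^esub> \<pi> a"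
    "\<And>r a. \<lbrakk>r \<in> carrier R; a \<in> carrier A\<rbrakk> \<Longrightarrow> \<pi> (a \<otimes>\<^bsub>A\<^esub> \<iota> r) = \<pi> a \<otimes>\<^bsub>R\<^esub> r"
    "\<And>r. r \<in> carrier R \<Longrightarrow> \<pi> (\<iota> r) = r"
    by (rule splitting) (rule that)
  obtain p where p: "p \<in> module_hom R U\<^sub>R T"
    "\<And>a t. \<lbrakk>a \<in> carrier A; t \<in> carrier T\<rbrakk> \<Longrightarrow> p (a \<otimes>\<^sub>t t) = \<pi> a \<odot>\<^bsub>T\<^esub> t"
  proof (rule U_restrict_hom[of \<pi>])
    fix h assume "h \<in> module_hom R U\<^sub>R T"
      "\<And>a t. \<lbrakk>a \<in> carrier A; t \<in> carrier T\<rbrakk> \<Longrightarrow> h (a \<otimes>\<^sub>t t) = \<pi> a \<odot>\<^bsub>T\<^esub> t"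
    then show thesis by (rule that)
  qed (simp_all add: \<pi>)
  have "(\<lambda>t. \<one>\<^bsub>A\<^esub> \<otimes>\<^sub>t t) \<in> module_hom R T U\<^sub>R"
    using pure_balanced[of "\<one>\<^bsub>A\<^esub>"]
    by (intro module_homI) (simp_all add: pure_closed pure_add_right smult_pure)
  then show ?thesis
    using p \<pi>(5)[of "\<one>\<^bsub>R\<^esub>"] by (intro that[of "\<lambda>t. \<one>\<^bsub>A\<^esub> \<otimes>\<^sub>t t" p]) simp_all
qed

lemma T_stable_retract: "left_module R W \<Longrightarrow> stable_retract R T U\<^sub>R W"
  by (rule T_retract, rule retract_imp_stable_retract[OF T])

lemma T_finitely_generated_resolution:
  assumes "projective_resolution A U P d e" "\<And>n. finitely_generated A (P n)"
  shows "\<exists>(Q :: nat \<Rightarrow> ('r, nat \<Rightarrow> 'r) module) d' e'.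
    projective_resolution R T Q d' e' \<and> (\<forall>n. finitely_generated R (Q n))"
proof (rule finitely_generated_resolution_exists[OF restrict_projective_resolution[OF assms] _ T U\<^sub>R_left_module
      regular_module_projective[OF R.ring_axioms] T_stable_retract[OF left_module_regular[OF R.ring_axioms]]])
  fix n
  have "projective A (P n)" using assms(1) by (simp add: projective_resolution_def)
  then show "finitely_generated R (restrict_scalars \<iota> (P n))"
    by (rule restrict_projective(2)[OF _ assms(2)])
qed

text \<open>Three transports of the extension property: from the resolution chosen over
  \<open>A\<close> to the finitely generated one, whose terms remain projective under restriction;
  then to \<open>R\<close> with target \<open>T\<close>; then, through the retraction of
  \<open>U\<close> onto \<open>T\<close>, to the resolution chosen over \<open>R\<close>.\<close>

lemma T_Ext_trivial:
  assumes P: "projective_resolution A U P d e" "\<And>n. finitely_generated A (P n)"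
    and Ext: "\<forall>i>0. trivial_group (Ext A i U U)"
  shows "\<forall>i>0. trivial_group (Ext R i T T)"
proof -
  note A_reg = regular_module_projective(1)[OF A.ring_axioms]
  note R_reg = regular_module_projective(1)[OF R.ring_axioms]
  obtain P' :: "nat \<Rightarrow> ('a, ('a, ('a \<times> 't \<Rightarrow>\<^sub>0 int) set) resolvent) module" and d' e' where P': "projective_resolution A U P' d' e'"
    and ext': "(\<forall>i>0. trivial_group (Ext A i U U)) \<longleftrightarrow> (\<forall>n. extends A (P' n) (syzygy P' d' U e' n) U)"
    by (rule Ext_trivial_iff_extends[OF U_left_module U_left_module]) (rule that)
  obtain Q :: "nat \<Rightarrow> ('r, ('r, 't) resolvent) module" and \<delta> \<epsilon> where Q: "projective_resolution R T Q \<delta> \<epsilon>"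
    and extQ: "(\<forall>i>0. trivial_group (Ext R i T T)) \<longleftrightarrow> (\<forall>n. extends R (Q n) (syzygy Q \<delta> T \<epsilon> n) T)"
    by (rule Ext_trivial_iff_extends[OF T T]) (rule that)
  have "stable_retract A U U (regular_module A)"
    by (rule retract_imp_stable_retract[OF U_left_module projective_left_module[OF A_reg] module_hom_ident module_hom_ident]) simp
  then have "extends A (P n) (syzygy P d U e n) U" for n
    using Ext unfolding ext'
    by (intro extends_resolution[OF P' U_left_module P(1) U_left_module U_left_module A_reg]) simp_all
  note extP = this
  have "extends R (restrict_scalars \<iota> (P n)) (syzygy P d U e n) T" for n
    by (rule restrict_extends[OF projective_left_module[OF syzygy_props(1)[OF P(1) U_left_module]]
          syzygy_props(2)[OF P(1) U_left_module] extP])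
  then have "extends R (Q n) (syzygy Q \<delta> T \<epsilon> n) T" for n
    by (intro extends_resolution[OF restrict_projective_resolution[OF P] U\<^sub>R_left_module Q T T R_reg
          T_stable_retract[OF projective_left_module[OF R_reg]]]) (simp add: syzygy_restrict)
  then show ?thesis unfolding extQ by blast
qed

text \<open>The restricted terms lie in add of \<open>U\<close>, hence in add of \<open>T\<close>,
  so the coresolution of \<open>A\<close> becomes one over \<open>R\<close> of the required kind.
  Then \<iota> and \<pi> exhibit \<open>R\<close> as a retract of \<open>A\<close>.\<close>

lemma R_coresolution:
  assumes U_add: "in_add R T U\<^sub>R"
    and C: "coresolution A (regular_module A) C d e" and C_add: "\<And>n. in_add A U (C n)"
    and exact: "hom_into_exact A (regular_module A) C d e U"
  shows "\<exists>(D :: nat \<Rightarrow> ('r, nat \<Rightarrow> 't) module) d' e'. coresolution R (regular_module R) D d' e' \<and>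
    (\<forall>n. in_add R T (D n)) \<and> hom_into_exact R (regular_module R) D d' e' T"
proof -
  note regA = left_module_regular[OF A.ring_axioms] and regR = left_module_regular[OF R.ring_axioms]
  note c = cosyzygy_props[OF C]
  obtain \<pi> where \<pi>: "\<And>a. a \<in> carrier A \<Longrightarrow> \<pi> a \<in> carrier R"
    "\<And>a b. \<lbrakk>a \<in> carrier A; b \<in> carrier A\<rbrakk> \<Longrightarrow> \<pi> (a \<oplus>\<^bsub>A\<^esub> b) = \<pi> a \<oplus>\<^bsub>R\<^esub> \<pi> b"
    "\<And>r a. \<lbrakk>r \<in> carrier R; a \<in> carrier A\<rbrakk> \<Longrightarrow> \<pi> (\<iota> r \<otimes>\<^bsub>A\<^esub> a) = r \<otimes>\<^bsub>R\<^esub> \<pi> a"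
    "\<And>r a. \<lbrakk>r \<in> carrier R; a \<in> carrier A\<rbrakk> \<Longrightarrow> \<pi> (a \<otimes>\<^bsub>A\<^esub> \<iota> r) = \<pi> a \<otimes>\<^bsub>R\<^esub> r"
    "\<And>r. r \<in> carrier R \<Longrightarrow> \<pi> (\<iota> r) = r"
    by (rule splitting) (rule that)
  have s: "\<iota> \<in> module_hom R (regular_module R) A\<^sub>R" and p: "\<pi> \<in> module_hom R A\<^sub>R (regular_module R)"
    using \<pi> by (auto intro!: module_homI simp: \<iota>_add \<iota>_mult)
  have UR: "factors R T U\<^sub>R U\<^sub>R (\<lambda>x. x)"
    using U_add in_add_iff_factors[OF T] by blast
  have "factors A U (C n) (C n) (\<lambda>x. x)" for n
    using C_add in_add_iff_factors[OF U_left_module] by blast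
  then have add: "factors R T (restrict_scalars \<iota> (C n)) (restrict_scalars \<iota> (C n)) (\<lambda>x. x)" for n
    using restrict_left_module[OF c(1)] by (intro factors_trans[OF _ U\<^sub>R_left_module _ restrict_factors UR])
  have "extends A (C n) (cosyzygy C d (regular_module A) e n) U" for n
    using exact hom_into_exact_iff_extends[OF C regA U_left_module] by blast
  then have "extends R (restrict_scalars \<iota> (C n)) (cosyzygy C d (regular_module A) e n) T" for n
    by (rule restrict_extends[OF c(1) c(8)])
  then show ?thesis
    using \<pi>(5)
    by (intro relative_coresolution_retract[OF restrict_coresolution[OF C] A\<^sub>R_left_module T add _ regR s p])
      (simp_all add: cosyzygy_restrict)
qed

lemma T_wakamatsu_tilting:
  assumes "in_add R T U\<^sub>R" "wakamatsu_tilting A U"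
  shows "wakamatsu_tilting R T"
proof -
  obtain P :: "nat \<Rightarrow> ('a, nat \<Rightarrow> 'a) module" and d e where
    P: "projective_resolution A U P d e" "\<And>n. finitely_generated A (P n)"
    using assms(2) unfolding wakamatsu_tilting_def by blast
  obtain C :: "nat \<Rightarrow> ('a, nat \<Rightarrow> ('a \<times> 't \<Rightarrow>\<^sub>0 int) set) module" and d' e' where
    C: "coresolution A (regular_module A) C d' e'" "\<And>n. in_add A U (C n)"
      "hom_into_exact A (regular_module A) C d' e' U"
    using assms(2) unfolding wakamatsu_tilting_def by blast
  have "\<forall>i>0. trivial_group (Ext A i U U)"
    using assms(2) unfolding wakamatsu_tilting_def by blast
  then show ?thesis
    unfolding wakamatsu_tilting_def
    using T T_finitely_generated_resolution[OF P] T_Ext_trivial[OF P] R_coresolution[OF assms(1) C] by blast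
qed

end

theorem theorem2p8:
  fixes R :: "('r, 'k) ring_scheme"
    and A :: "('a, 'l) ring_scheme"
    and \<iota> :: "'r \<Rightarrow> 'a"
    and T :: "('r, 't, 'e) module_scheme"
  assumes "frobenius_extension R A \<iota>"
    and "split_extension R A \<iota>"
    and "left_module R T"
    and "in_add R T (restrict_scalars \<iota> (induced_module R A \<iota> T))"
    and "wakamatsu_tilting A (induced_module R A \<iota> T)"
  shows "wakamatsu_tilting R T"
proof -
  have ext: "ring_extension_module R A \<iota> T"
    using assms(1,3) by (intro ring_extension_module.intro) (simp_all add: frobenius_extension_def)
  note U_def = ring_extension_module.induced_def[OF ext]
  \<comment> \<open>The module axioms for the induced module, which the locale assumes, are part of
    its being Wakamatsu tilting.\<close>
  have "left_module A (ring_extension_module.induced R A \<iota> T)"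
    using assms(5) by (simp add: U_def wakamatsu_tilting_def)
  then have "split_frobenius_module R A \<iota> T"
    using ext assms(1,2)
    by (intro split_frobenius_module.intro frobenius_module.intro frobenius_module_axioms.intro
        split_frobenius_module_axioms.intro)
  from split_frobenius_module.T_wakamatsu_tilting[OF this] show ?thesis
    using assms(4,5) by (simp add: U_def)
qed

end
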